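(* Let $T$ be a nonempty separable metric space and let $X=\{X(t),\,t\in T\}$ be a separable, bounded, centered Gaussian process with values in $\mathbb{R}^d$. Let $(X_i)_{i\ge 1}$ be a sequence of i.i.d. copies of $X$. Put $W_n=\mathrm{conv}\{X_1(t),\ldots,X_n(t),\ t\in T\}$ and $W=\mathrm{conv}\{K_t,\ t\in T\}$, where $K_t$ is the ellipsoid of concentration of $X(t)$. Let $p\ge 0$ and let $f:\mathcal{K}^d\to\mathbb{R}$ be a function that is continuous (with respect to the Hausdorff distance) and satisfies (i) $f(A)\ge 0$ for all $A\in\mathcal{K}^d$; (ii) $f(A_1)\le f(A_2)$ for all $A_1,A_2\in\mathcal{K}^d$ with $A_1\subset A_2$; (iii) $f(cA)=c^p f(A)$ for all $c\ge 0$ and $A\in\mathcal{K}^d$. Then $$E f\left(\frac{1}{\sqrt{2\ln n}}W_n\right)\longrightarrow f(W)\qquad\text{as } n\to\infty.$$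
   Context: $\mathcal{K}^d$ is the space of nonempty compact convex subsets of $\mathbb{R}^d$ with the Hausdorff distance $\rho(A,B)=\max\{\inf\{\epsilon>0: A\subset B^\epsilon\},\ \inf\{\epsilon>0: B\subset A^\epsilon\}\}$, where $A^\epsilon$ is the open $\epsilon$-neighbourhood of $A$ in the Euclidean norm. For $S\subset\mathbb{R}^d$, $\mathrm{conv}\,S$ denotes the closed convex hull of $S$; $\mathrm{conv}\{K_t,\ t\in T\}$ is the closed convex hull of $\bigcup_{t\in T}K_t$, and $\mathrm{conv}\{X_1(t),\ldots,X_n(t),\ t\in T\}$ is the closed convex hull of $\{X_i(t): 1\le i\le n,\ t\in T\}$ (almost surely an element of $\mathcal{K}^d$). The convention $0^0=1$ is used. The process $X$ is Gaussian centered if all its finite-dimensional distributions are (jointly) Gaussian with mean zero. It is bounded if $\sup_{t\in T}|X(t)|<\infty$ almost surely. It is separable if there are a countable set $T_0\subset T$ and a null event outside of which, for every $t\in T$, there is a sequence $(t_k)$ in $T_0$ with $t_k\to t$ and $X(t_k)\to X(t)$. The copies $X_i$ are independent processes with the same law as $X$, and they are taken with the same path properties (separability and boundedness). $R_t$ is the covariance matrix of $X(t)$. The ellipsoid of concentration of $X(t)$ is $K_t=\{x\in\mathbb{R}^d: \langle R_t^{-1}x,x\rangle\le 1\}$ when $R_t$ is invertible; for general (possibly degenerate) $R_t$ it is $K_t=\{R_t^{1/2}y: y\in\mathbb{R}^d,\ |y|\le 1\}$, which agrees with the preceding formula in the invertible case. *)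

theory Defs
  imports "HOL-Probability.Probability"
begin

definition compact_convex_sets :: "(real^'d) set set" where
  "compact_convex_sets = {A. A \<noteq> {} \<and> compact A \<and> convex A}"

definition open_nbhd :: "real \<Rightarrow> 'a::metric_space set \<Rightarrow> 'a set" where
  "open_nbhd e A = (\<Union>a\<in>A. ball a e)"

definition hausdorff_dist :: "'a::metric_space set \<Rightarrow> 'a set \<Rightarrow> real" where
  "hausdorff_dist A B =
     max (Inf {e. e > 0 \<and> A \<subseteq> open_nbhd e B}) (Inf {e. e > 0 \<and> B \<subseteq> open_nbhd e A})"

definition hausdorff_continuous :: "((real^'d) set \<Rightarrow> real) \<Rightarrow> bool" where
  "hausdorff_continuous f \<longleftrightarrow>
     (\<forall>A\<in>compact_convex_sets. \<forall>e>0. \<exists>\<delta>>0. \<forall>B\<in>compact_convex_sets.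
        hausdorff_dist A B < \<delta> \<longrightarrow> \<bar>f B - f A\<bar> < e)"

definition closed_conv :: "(real^'d) set \<Rightarrow> (real^'d) set" where
  "closed_conv S = closure (convex hull S)"

text \<open>In the library \<open>0 powr 0 = 0\<close>; here the convention \<open>0\<^sup>0 = 1\<close> is needed.\<close>

definition power_conv :: "real \<Rightarrow> real \<Rightarrow> real" where
  "power_conv c p = (if c = 0 \<and> p = 0 then 1 else c powr p)"

text \<open>A process indexed by a set \<open>T\<close> is a function of the index and the sample point; only its
  values at indices in \<open>T\<close> matter.\<close>

text \<open>The point mass at 0 is the Gaussian law of variance 0.\<close>

definition centered_gaussian_law :: "real measure \<Rightarrow> bool" where
  "centered_gaussian_law \<mu> \<longleftrightarrow>
     \<mu> = return borel 0 \<or> (\<exists>\<sigma>>0. \<mu> = density lborel (\<lambda>x. ennreal (normal_density 0 \<sigma> x)))"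

text \<open>Finitely many random vectors are jointly Gaussian with mean zero if every linear
  combination of their coordinates is a centered, possibly degenerate, Gaussian variable.\<close>

definition centered_gaussian_process ::
    "'w measure \<Rightarrow> 't set \<Rightarrow> ('t \<Rightarrow> 'w \<Rightarrow> real^'d) \<Rightarrow> bool" where
  "centered_gaussian_process M T X \<longleftrightarrow>
     (\<forall>t\<in>T. X t \<in> borel_measurable M) \<and>
     (\<forall>F a. finite F \<and> F \<subseteq> T \<longrightarrow>
        centered_gaussian_law (distr M borel (\<lambda>\<omega>. \<Sum>t\<in>F. a t \<bullet> X t \<omega>)))"

definition separable_process ::
    "'w measure \<Rightarrow> 't::metric_space set \<Rightarrow> ('t \<Rightarrow> 'w \<Rightarrow> real^'d) \<Rightarrow> bool" where
  "separable_process M T X \<longleftrightarrow>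
     (\<exists>T0. countable T0 \<and> T0 \<subseteq> T \<and>
        (AE \<omega> in M. \<forall>t\<in>T. \<exists>s. (\<forall>k::nat. s k \<in> T0) \<and> s \<longlonglongrightarrow> t \<and>
           (\<lambda>k. X (s k) \<omega>) \<longlonglongrightarrow> X t \<omega>))"

definition bounded_process ::
    "'w measure \<Rightarrow> 't set \<Rightarrow> ('t \<Rightarrow> 'w \<Rightarrow> real^'d) \<Rightarrow> bool" where
  "bounded_process M T X \<longleftrightarrow> (AE \<omega> in M. bounded ((\<lambda>t. X t \<omega>) ` T))"

definition path_of :: "'t set \<Rightarrow> ('t \<Rightarrow> 'w \<Rightarrow> real^'d) \<Rightarrow> 'w \<Rightarrow> 't \<Rightarrow> real^'d" where
  "path_of T X \<omega> = (\<lambda>t\<in>T. X t \<omega>)"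

abbreviation path_space :: "'t set \<Rightarrow> ('t \<Rightarrow> real^'d) measure" where
  "path_space T \<equiv> PiM T (\<lambda>_. borel)"

text \<open>The copies may live on a probability space \<open>N\<close> other than that of \<open>X\<close>. They are indexed
  by the positive integers. Laws and independence refer to the product \<open>\<sigma>\<close>-algebra.\<close>

definition iid_copies ::
    "'v measure \<Rightarrow> (nat \<Rightarrow> 't \<Rightarrow> 'v \<Rightarrow> real^'d) \<Rightarrow> 'w measure \<Rightarrow> 't set \<Rightarrow> ('t \<Rightarrow> 'w \<Rightarrow> real^'d) \<Rightarrow> bool"
  where
  "iid_copies N Xs M T X \<longleftrightarrow>
     prob_space.indep_vars N (\<lambda>_. path_space T) (\<lambda>i. path_of T (Xs i)) {1..} \<and>
     (\<forall>i\<ge>1. distr N (path_space T) (path_of T (Xs i)) = distr M (path_space T) (path_of T X))"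

definition cov_matrix :: "'w measure \<Rightarrow> ('w \<Rightarrow> real^'d) \<Rightarrow> real^'d^'d" where
  "cov_matrix M Y =
     (\<chi> i j. \<integral>\<omega>. (Y \<omega> $ i - (\<integral>\<omega>'. Y \<omega>' $ i \<partial>M)) * (Y \<omega> $ j - (\<integral>\<omega>'. Y \<omega>' $ j \<partial>M)) \<partial>M)"

definition psd_matrix :: "real^'d^'d \<Rightarrow> bool" where
  "psd_matrix S \<longleftrightarrow> transpose S = S \<and> (\<forall>x. 0 \<le> (S *v x) \<bullet> x)"

text \<open>A positive semidefinite matrix has exactly one positive semidefinite square root.\<close>

definition matrix_sqrt :: "real^'d^'d \<Rightarrow> real^'d^'d" where
  "matrix_sqrt R = (THE S. psd_matrix S \<and> S ** S = R)"

definition concentration_ellipsoid :: "'w measure \<Rightarrow> ('w \<Rightarrow> real^'d) \<Rightarrow> (real^'d) set" where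
  "concentration_ellipsoid M Y = {matrix_sqrt (cov_matrix M Y) *v y | y. norm y \<le> 1}"

definition sample_hull ::
    "'t set \<Rightarrow> (nat \<Rightarrow> 't \<Rightarrow> 'v \<Rightarrow> real^'d) \<Rightarrow> nat \<Rightarrow> 'v \<Rightarrow> (real^'d) set" where
  "sample_hull T Xs n \<omega> = closed_conv {Xs i t \<omega> | i t. i \<in> {1..n} \<and> t \<in> T}"

definition limit_hull :: "'w measure \<Rightarrow> 't set \<Rightarrow> ('t \<Rightarrow> 'w \<Rightarrow> real^'d) \<Rightarrow> (real^'d) set" where
  "limit_hull M T X = closed_conv (\<Union>t\<in>T. concentration_ellipsoid M (X t))"

text \<open>The sample hull is compact, and equal to the hull over a countable index set, only almost
  surely, so a functional of it is a random variable in general only on the completion of the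
  underlying probability space. Expectations of such functionals are taken there.\<close>

definition scaled_functional ::
    "((real^'d) set \<Rightarrow> real) \<Rightarrow> 't set \<Rightarrow> (nat \<Rightarrow> 't \<Rightarrow> 'v \<Rightarrow> real^'d) \<Rightarrow> nat \<Rightarrow> 'v \<Rightarrow> real" where
  "scaled_functional f T Xs n \<omega> =
     f ((*\<^sub>R) (1 / sqrt (2 * ln (real n))) ` sample_hull T Xs n \<omega>)"

end

(*
  Let h be the support function of W, b the scale sqrt (2 ln n), and s(u, t)^2 the variance of <u, X t>;
  the support function of the ellipsoid K_t is s(., t), so that h(u) = sup_t s(u, t).

  The function x |-> max_t <v_t, x> is Lipschitz with constant max_t |v_t|. Gaussian concentration with
  the sharp constant (from the Prekopa-Leindler inequality on the line, which tensorizes) hence bounds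
  E exp (c sup_t <u, X t>) by exp (c^2 h(u)^2 / 2 + c m) for all c >= 0, where m depends on h(u) and a
  quantile of the supremum. Since n = exp (b^2 / 2), taking c proportional to b shows that
  max_{i <= n} sup_t <u, X_i t> exceeds (h(u) + e) b with probability tending to 0. A single t with
  s(u, t) > h(u) - e and the tail of the normal law give the matching lower bound. Applied to finitely
  many directions u, this yields convergence of the scaled hulls to W in probability for the Hausdorff
  distance.

  By monotonicity and homogeneity f^2 is dominated by an exponential of the support function in the
  coordinate directions, whose expectation is bounded by the same estimate; bounded second moments
  turn convergence in probability into convergence of the expectations.
*)
theory Submission
  imports Defs "HOL-Real_Asymp.Real_Asymp"
begin

subsection \<open>The Prekopa-Leindler inequality\<close>

text \<open>The theorem turns on the constant 1/2 in the exponent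
  \<open>c\<^sup>2 * \<sigma>\<^sup>2 / 2\<close>: it has to balance the number
  \<open>exp (b\<^sup>2 / 2)\<close> of copies, and a worse constant would only confine the scaled
  hulls to a larger set than W. Concentration is naturally around the mean, yet almost sure
  boundedness gives no moment of the supremum at the outset, only a quantile common to all finite
  subfamilies. The concentration inequality at the negative exponent -1 turns this quantile into a
  bound on the mean of a truncated maximum, whence the additive terms
  \<open>\<sigma>\<^sup>2 / 2 + ln 2\<close>. The other obstacle is that Gaussianity is given only
  through one-dimensional laws of linear combinations, over a possibly uncountable index set. Finite
  subfamilies are therefore identified in law with linear images of a standard normal vector;
  suprema are taken over a countable set that separates all copies at once, and what involves the
  full index set is argued pathwise outside a null event.\<close>

lemma borel_vimage:
  assumes "f \<in> borel_measurable borel" "S \<in> sets borel"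
  shows "f -` S \<in> sets borel"
  using measurable_sets[OF assms] by simp

text \<open>The translates \<open>A + b\<close> and \<open>a + B\<close>, with \<open>a\<close>
  almost maximal in \<open>A\<close> and \<open>b\<close> almost minimal in \<open>B\<close>, both
  lie in \<open>C\<close> and overlap in an interval of length at most \<open>e\<close>. The set
  \<open>C\<close> stands in for the sum set, which may fail to be Borel.\<close>

lemma brunn_minkowski_real_bounded:
  fixes A B C :: "real set"
  assumes [measurable]: "A \<in> sets borel" "B \<in> sets borel" "C \<in> sets borel"
    and ne: "A \<noteq> {}" "B \<noteq> {}" and bd: "bounded A" "bounded B"
    and sub: "\<And>a b. a \<in> A \<Longrightarrow> b \<in> B \<Longrightarrow> a + b \<in> C"
  shows "emeasure lborel A + emeasure lborel B \<le> emeasure lborel C"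
proof (rule ennreal_le_epsilon)
  fix e :: real assume e: "0 < e"
  have bA: "bdd_above A" and bB: "bdd_below B"
    using bd by (auto intro: bounded_imp_bdd_above bounded_imp_bdd_below)
  obtain a where a: "a \<in> A" "Sup A - e/2 < a"
    using less_cSup_iff[OF ne(1) bA, of "Sup A - e/2"] e by auto
  obtain b where b: "b \<in> B" "b < Inf B + e/2"
    using cInf_less_iff[OF ne(2) bB, of "Inf B + e/2"] e by auto
  have supA: "x \<le> Sup A" if "x \<in> A" for x using that bA by (rule cSup_upper)
  have infB: "Inf B \<le> x" if "x \<in> B" for x using that bB by (rule cInf_lower)
  \<comment> \<open>\<open>A'\<close> is \<open>A + b\<close> and \<open>B'\<close> is
    \<open>a + B\<close>, written as preimages so that they are visibly Borel.\<close>
  define A' where "A' = (\<lambda>x. x - b) -` A"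
  define B' where "B' = (\<lambda>x. x - a) -` B"
  have [measurable]: "A' \<in> sets borel" "B' \<in> sets borel"
    unfolding A'_def B'_def by (intro borel_vimage; measurable)+
  have eA: "emeasure lborel A' = emeasure lborel A"
  proof -
    have "emeasure lborel A = emeasure (distr lborel borel ((+) (-b))) A"
      by (subst lborel_distr_plus) simp
    also have "\<dots> = emeasure lborel ((+) (-b) -` A)" by (subst emeasure_distr) auto
    also have "(+) (-b) -` A = A'" by (auto simp: A'_def)
    finally show ?thesis by simp
  qed
  have eB: "emeasure lborel B' = emeasure lborel B"
  proof -
    have "emeasure lborel B = emeasure (distr lborel borel ((+) (-a))) B"
      by (subst lborel_distr_plus) simp
    also have "\<dots> = emeasure lborel ((+) (-a) -` B)" by (subst emeasure_distr) auto
    also have "(+) (-a) -` B = B'" by (auto simp: B'_def)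
    finally show ?thesis by simp
  qed
  have "A' \<union> B' \<subseteq> C"
  proof
    fix x assume "x \<in> A' \<union> B'"
    then consider "x - b \<in> A" | "x - a \<in> B" by (auto simp: A'_def B'_def)
    then show "x \<in> C" using sub[of "x - b" b] sub[of a "x - a"] a b by cases auto
  qed
  then have C: "emeasure lborel (A' \<union> B') \<le> emeasure lborel C" by (intro emeasure_mono) auto
  have "A' \<inter> B' \<subseteq> {a + Inf B .. Sup A + b}"
    using supA infB by (force simp: A'_def B'_def)
  then have "emeasure lborel (A' \<inter> B') \<le> emeasure lborel {a + Inf B .. Sup A + b}"
    by (intro emeasure_mono) auto
  also have "\<dots> \<le> ennreal e"
    using a b supA[OF a(1)] infB[OF b(1)] by (auto intro!: ennreal_leI)
  finally have int: "emeasure lborel (A' \<inter> B') \<le> ennreal e" .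
  have "emeasure lborel A' + emeasure lborel B'
      = emeasure lborel (A' \<union> B') + emeasure lborel (A' \<inter> B')"
    by (rule emeasure_Un_Int) auto
  then show "emeasure lborel A + emeasure lborel B \<le> emeasure lborel C + ennreal e"
    using add_mono[OF C int] eA eB by simp
qed

lemma brunn_minkowski_real:
  fixes A B C :: "real set"
  assumes m[measurable]: "A \<in> sets borel" "B \<in> sets borel" "C \<in> sets borel"
    and ne: "A \<noteq> {}" "B \<noteq> {}"
    and sub: "\<And>a b. a \<in> A \<Longrightarrow> b \<in> B \<Longrightarrow> a + b \<in> C"
  shows "emeasure lborel A + emeasure lborel B \<le> emeasure lborel C"
proof -
  obtain a b where ab: "a \<in> A" "b \<in> B" using ne by auto
  \<comment> \<open>With \<open>r\<close> added to the radius, the truncated sets contain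
    \<open>a\<close> and \<open>b\<close> already for \<open>n = 0\<close>, so the bounded case
    applies to every \<open>n\<close>.\<close>
  define r where "r = max \<bar>a\<bar> \<bar>b\<bar>"
  have lim: "(\<lambda>n. emeasure lborel (S \<inter> {-(r + real n) .. r + real n})) \<longlonglongrightarrow> emeasure lborel S"
    if [measurable]: "S \<in> sets borel" for S :: "real set"
  proof -
    have "(\<Union>n. S \<inter> {-(r + real n) .. r + real n}) = S"
    proof safe
      fix x assume "x \<in> S"
      obtain n where "\<bar>x\<bar> < real n" using reals_Archimedean2 by blast
      then show "x \<in> (\<Union>n. S \<inter> {-(r + real n) .. r + real n})"
        using \<open>x \<in> S\<close> by (auto intro!: exI[of _ n] simp: r_def)
    qed
    moreover have "(\<lambda>n. emeasure lborel (S \<inter> {-(r + real n) .. r + real n}))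
        \<longlonglongrightarrow> emeasure lborel (\<Union>n. S \<inter> {-(r + real n) .. r + real n})"
      by (rule Lim_emeasure_incseq) (auto simp: incseq_def)
    ultimately show ?thesis by simp
  qed
  show ?thesis
  proof (rule LIMSEQ_le_const2[OF tendsto_add[OF lim[OF m(1)] lim[OF m(2)]]], intro exI allI impI)
    fix n :: nat
    have "a \<in> A \<inter> {-(r + real n) .. r + real n}" "b \<in> B \<inter> {-(r + real n) .. r + real n}"
      using ab by (auto simp: r_def)
    then have "A \<inter> {-(r + real n) .. r + real n} \<noteq> {}" "B \<inter> {-(r + real n) .. r + real n} \<noteq> {}"
      by blast+
    then show "emeasure lborel (A \<inter> {-(r + real n) .. r + real n})
        + emeasure lborel (B \<inter> {-(r + real n) .. r + real n}) \<le> emeasure lborel C"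
      by (intro brunn_minkowski_real_bounded)
        (use sub in \<open>auto intro: bounded_Int\<close>)
  qed
qed

text \<open>On the line the measure of \<open>s * A\<close> is \<open>s\<close> times that of
  \<open>A\<close>, so the inequality for sums becomes an arithmetic mean, which is stronger than
  the geometric mean needed in the end.\<close>

lemma brunn_minkowski_real_convex:
  fixes A B C :: "real set"
  assumes m[measurable]: "A \<in> sets borel" "B \<in> sets borel" "C \<in> sets borel"
    and ne: "A \<noteq> {}" "B \<noteq> {}" and s: "0 < s" "s < 1"
    and sub: "\<And>a b. a \<in> A \<Longrightarrow> b \<in> B \<Longrightarrow> s * a + (1 - s) * b \<in> C"
  shows "ennreal s * emeasure lborel A + ennreal (1 - s) * emeasure lborel B \<le> emeasure lborel C"
proof -
  have scale: "ennreal c * emeasure lborel S = emeasure lborel ((\<lambda>x. x / c) -` S)"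
    if [measurable]: "S \<in> sets borel" and c: "0 < c" for S :: "real set" and c :: real
  proof -
    have "emeasure lborel ((\<lambda>x. x / c) -` S)
        = emeasure (density (distr lborel borel (\<lambda>x. 0 + c * x)) (\<lambda>_. ennreal \<bar>c\<bar>))
            ((\<lambda>x. x / c) -` S)"
      using lborel_real_affine[of c 0] c by simp
    also have "\<dots> = ennreal c * emeasure (distr lborel borel (\<lambda>x. 0 + c * x)) ((\<lambda>x. x / c) -` S)"
      using c by (subst emeasure_density_const) (auto intro!: borel_vimage)
    also have "emeasure (distr lborel borel (\<lambda>x. 0 + c * x)) ((\<lambda>x. x / c) -` S)
        = emeasure lborel ((\<lambda>x. 0 + c * x) -` ((\<lambda>x. x / c) -` S) \<inter> space lborel)"
      by (subst emeasure_distr) (auto intro!: borel_vimage)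
    also have "(\<lambda>x. 0 + c * x) -` ((\<lambda>x. x / c) -` S) \<inter> space lborel = S" using c by auto
    finally show ?thesis by simp
  qed
  have mv: "(\<lambda>x. x / c) -` S \<in> sets borel" if "S \<in> sets borel" for S :: "real set" and c
    using that by (auto intro!: borel_vimage)
  have "emeasure lborel ((\<lambda>x. x / s) -` A) + emeasure lborel ((\<lambda>x. x / (1 - s)) -` B)
      \<le> emeasure lborel C"
  proof (rule brunn_minkowski_real)
    obtain a b where "a \<in> A" "b \<in> B" using ne by auto
    then have "s * a \<in> (\<lambda>x. x / s) -` A" "(1 - s) * b \<in> (\<lambda>x. x / (1 - s)) -` B"
      using s by auto
    then show "(\<lambda>x. x / s) -` A \<noteq> {}" "(\<lambda>x. x / (1 - s)) -` B \<noteq> {}" by blast+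
    fix a b assume "a \<in> (\<lambda>x. x / s) -` A" "b \<in> (\<lambda>x. x / (1 - s)) -` B"
    then show "a + b \<in> C" using sub[of "a / s" "b / (1 - s)"] s by auto
  qed (auto intro: mv)
  then show ?thesis using s by (simp add: scale)
qed

section \<open>From level sets to integrals\<close>

lemma nn_integral_layer_cake:
  fixes f :: "real \<Rightarrow> real"
  assumes [measurable]: "f \<in> borel_measurable borel" and nn: "\<And>x. 0 \<le> f x"
  shows "(\<integral>\<^sup>+x. ennreal (f x) \<partial>lborel) =
    (\<integral>\<^sup>+l. indicator {0<..} l * emeasure lborel {x. l < f x} \<partial>lborel)"
proof -
  have "(\<integral>\<^sup>+x. ennreal (f x) \<partial>lborel)
      = (\<integral>\<^sup>+x. \<integral>\<^sup>+l. indicator {0<..} l * indicator {l. l < f x} l \<partial>lborel \<partial>lborel)"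
  proof (rule nn_integral_cong)
    fix x :: real
    have "(\<integral>\<^sup>+l. indicator {0<..} l * indicator {l. l < f x} l \<partial>lborel)
        = (\<integral>\<^sup>+l. indicator {0<..<f x} l \<partial>lborel)"
      by (intro nn_integral_cong) (auto split: split_indicator)
    then show "ennreal (f x) = (\<integral>\<^sup>+l. indicator {0<..} l * indicator {l. l < f x} l \<partial>lborel)"
      using nn[of x] by simp
  qed
  also have "\<dots> = (\<integral>\<^sup>+l. \<integral>\<^sup>+x. indicator {0<..} l * indicator {l. l < f x} l \<partial>lborel \<partial>lborel)"
    by (rule lborel_pair.Fubini') (simp add: split_beta)
  also have "\<dots> = (\<integral>\<^sup>+l. indicator {0<..} l * emeasure lborel {x. l < f x} \<partial>lborel)"
  proof (rule nn_integral_cong)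
    fix l :: real
    have "(\<integral>\<^sup>+x. indicator {0<..} l * indicator {l. l < f x} l \<partial>lborel)
       = (\<integral>\<^sup>+x. indicator {0<..} l * indicator {x. l < f x} x \<partial>lborel)"
      by (intro nn_integral_cong) (auto split: split_indicator)
    also have "\<dots> = indicator {0<..} l * emeasure lborel {x. l < f x}"
      by (subst nn_integral_cmult) auto
    finally show "(\<integral>\<^sup>+x. indicator {0<..} l * indicator {l. l < f x} l \<partial>lborel)
      = indicator {0<..} l * emeasure lborel {x. l < f x}" .
  qed
  finally show ?thesis .
qed

text \<open>The hypotheses on the suprema make all superlevel sets below 1 of \<^term>\<open>f\<close> and
  \<^term>\<open>g\<close> nonempty, which the Brunn-Minkowski inequality needs.\<close>

lemma prekopa_leindler_normalized:
  fixes f g h :: "real \<Rightarrow> real"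
  assumes [measurable]: "f \<in> borel_measurable borel" "g \<in> borel_measurable borel"
      "h \<in> borel_measurable borel"
    and pos: "\<And>x. 0 < f x" "\<And>x. 0 < g x" "\<And>x. 0 < h x"
    and sf: "\<And>x. f x \<le> 1" "\<And>l. l < 1 \<Longrightarrow> \<exists>x. l < f x"
    and sg: "\<And>x. g x \<le> 1" "\<And>l. l < 1 \<Longrightarrow> \<exists>x. l < g x"
    and s: "0 < s" "s < 1"
    and le: "\<And>x y. f x powr s * g y powr (1 - s) \<le> h (s * x + (1 - s) * y)"
  shows "ennreal s * (\<integral>\<^sup>+x. f x \<partial>lborel) + ennreal (1 - s) * (\<integral>\<^sup>+x. g x \<partial>lborel)
    \<le> (\<integral>\<^sup>+x. h x \<partial>lborel)"
proof -
  have nn: "0 \<le> f x" "0 \<le> g x" "0 \<le> h x" for x using pos less_imp_le by blast+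
  have level: "ennreal s * emeasure lborel {x. l < f x}
      + ennreal (1 - s) * emeasure lborel {x. l < g x} \<le> emeasure lborel {x. l < h x}"
    if l: "0 < l" for l
  proof (cases "l < 1")
    case True
    show ?thesis
    proof (rule brunn_minkowski_real_convex)
      fix a b assume ab: "a \<in> {x. l < f x}" "b \<in> {x. l < g x}"
      have "l = l powr s * l powr (1 - s)" using l by (simp add: powr_add[symmetric])
      also have "\<dots> < f a powr s * g b powr (1 - s)"
        using ab l s by (intro mult_strict_mono powr_less_mono2) auto
      also note le
      finally show "s * a + (1 - s) * b \<in> {x. l < h x}" by simp
    qed (use sf sg s True in auto)
  next
    case False
    then have "{x. l < f x} = {}" "{x. l < g x} = {}" using sf(1) sg(1) by (auto simp: not_less intro: order_trans)
    then show ?thesis by simp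
  qed
  have "ennreal s * (\<integral>\<^sup>+x. f x \<partial>lborel) + ennreal (1 - s) * (\<integral>\<^sup>+x. g x \<partial>lborel)
     = (\<integral>\<^sup>+l. indicator {0<..} l * (ennreal s * emeasure lborel {x. l < f x}
        + ennreal (1 - s) * emeasure lborel {x. l < g x}) \<partial>lborel)"
    unfolding nn_integral_layer_cake[of f, OF _ nn(1), simplified] nn_integral_layer_cake[of g, OF _ nn(2), simplified]
    by (subst (1 2) nn_integral_cmult[symmetric], measurable, subst nn_integral_add[symmetric])
      (auto intro!: nn_integral_cong split: split_indicator)
  also have "\<dots> \<le> (\<integral>\<^sup>+l. indicator {0<..} l * emeasure lborel {x. l < h x} \<partial>lborel)"
    by (intro nn_integral_mono) (auto split: split_indicator intro: level)
  also have "\<dots> = (\<integral>\<^sup>+x. h x \<partial>lborel)"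
    by (rule nn_integral_layer_cake[symmetric]) (auto intro: nn)
  finally show ?thesis .
qed

text \<open>Dividing by the suprema reduces to the normalized case, which yields an arithmetic mean
  of the integrals; Young's inequality replaces it by the geometric mean, and the normalizing
  factors cancel.\<close>

lemma prekopa_leindler_real:
  fixes f g h :: "real \<Rightarrow> real"
  assumes [measurable]: "f \<in> borel_measurable borel" "g \<in> borel_measurable borel"
      "h \<in> borel_measurable borel"
    and pos: "\<And>x. 0 < f x" "\<And>x. 0 < g x" "\<And>x. 0 < h x"
    and bd: "bdd_above (range f)" "bdd_above (range g)"
    and int: "integrable lborel f" "integrable lborel g" "integrable lborel h"
    and s: "0 < s" "s < 1"
    and le: "\<And>x y. f x powr s * g y powr (1 - s) \<le> h (s * x + (1 - s) * y)"
  shows "(\<integral>x. f x \<partial>lborel) powr s * (\<integral>x. g x \<partial>lborel) powr (1 - s) \<le> (\<integral>x. h x \<partial>lborel)"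
proof -
  define a b where "a = Sup (range f)" and "b = Sup (range g)"
  have fa: "f x \<le> a" and gb: "g x \<le> b" for x
    unfolding a_def b_def using bd by (auto intro: cSup_upper)
  have a: "0 < a" and b: "0 < b" using fa gb pos less_le_trans by blast+
  \<comment> \<open>Dividing \<open>h\<close> by this constant preserves the multiplicative
    hypothesis once \<open>f\<close> and \<open>g\<close> are divided by their suprema.\<close>
  define c where "c = a powr s * b powr (1 - s)"
  have c: "0 < c" using a b by (simp add: c_def)
  have "ennreal s * (\<integral>\<^sup>+x. f x / a \<partial>lborel) + ennreal (1 - s) * (\<integral>\<^sup>+x. g x / b \<partial>lborel)
    \<le> (\<integral>\<^sup>+x. h x / c \<partial>lborel)"
  proof (rule prekopa_leindler_normalized)
    fix l :: real assume l: "l < 1"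
    have "l * a < a" using a l by simp
    then obtain x where "l * a < f x"
      unfolding a_def using less_cSup_iff[of "range f"] bd by (auto simp: a_def)
    then show "\<exists>x. l < f x / a" using a by (auto simp: field_simps)
    have "l * b < b" using b l by simp
    then obtain x where "l * b < g x"
      unfolding b_def using less_cSup_iff[of "range g"] bd by (auto simp: b_def)
    then show "\<exists>x. l < g x / b" using b by (auto simp: field_simps)
  next
    fix x y
    have "(f x / a) powr s * (g y / b) powr (1 - s) = (f x powr s * g y powr (1 - s)) / c"
      using a b pos[of x] pos(2)[of y] by (simp add: powr_divide c_def less_imp_le)
    also have "\<dots> \<le> h (s * x + (1 - s) * y) / c" using c le by (simp add: divide_right_mono)
    finally show "(f x / a) powr s * (g y / b) powr (1 - s) \<le> h (s * x + (1 - s) * y) / c" .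
  qed (use a b c s pos fa gb in auto)
  moreover have nnf: "0 \<le> (\<integral>x. f x \<partial>lborel)" "0 \<le> (\<integral>x. g x \<partial>lborel)" "0 \<le> (\<integral>x. h x \<partial>lborel)"
    using pos by (auto intro!: integral_nonneg_AE simp: less_imp_le)
  moreover have "(\<integral>\<^sup>+x. f x / a \<partial>lborel) = ennreal ((\<integral>x. f x \<partial>lborel) / a)"
    "(\<integral>\<^sup>+x. g x / b \<partial>lborel) = ennreal ((\<integral>x. g x \<partial>lborel) / b)"
    "(\<integral>\<^sup>+x. h x / c \<partial>lborel) = ennreal ((\<integral>x. h x \<partial>lborel) / c)"
    using int pos a b c by (subst nn_integral_eq_integral; simp add: less_imp_le)+
  ultimately have "s * ((\<integral>x. f x \<partial>lborel) / a) + (1 - s) * ((\<integral>x. g x \<partial>lborel) / b) \<le> (\<integral>x. h x \<partial>lborel) / c"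
    using s a b c by (simp add: ennreal_mult[symmetric] ennreal_plus[symmetric] del: ennreal_plus)
  moreover have "((\<integral>x. f x \<partial>lborel) / a) powr s * ((\<integral>x. g x \<partial>lborel) / b) powr (1 - s)
     \<le> s * ((\<integral>x. f x \<partial>lborel) / a) + (1 - s) * ((\<integral>x. g x \<partial>lborel) / b)"
  proof (cases "(\<integral>x. f x \<partial>lborel) = 0 \<or> (\<integral>x. g x \<partial>lborel) = 0")
    case True then show ?thesis using nnf a b s by auto
  next
    case False
    then show ?thesis using nnf a b s by (intro Youngs_inequality_0) auto
  qed
  ultimately have "((\<integral>x. f x \<partial>lborel) / a) powr s * ((\<integral>x. g x \<partial>lborel) / b) powr (1 - s)
     \<le> (\<integral>x. h x \<partial>lborel) / c" by simp
  then show ?thesis using a b c nnf by (simp add: powr_divide c_def field_simps)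
qed

subsection \<open>Gaussian concentration\<close>

lemma bounded_exp_integral:
  fixes F :: "'a \<Rightarrow> real"
  assumes "prob_space M" "F \<in> borel_measurable M" "\<And>x. x \<in> space M \<Longrightarrow> \<bar>F x\<bar> \<le> K"
  shows "integrable M (\<lambda>x. exp (F x))" "exp (-K) \<le> (\<integral>x. exp (F x) \<partial>M)" "(\<integral>x. exp (F x) \<partial>M) \<le> exp K"
proof -
  interpret prob_space M by fact
  have *: "exp (-K) \<le> exp (F x)" "exp (F x) \<le> exp K" if "x \<in> space M" for x
    using assms(3)[OF that] by (auto simp: abs_le_iff)
  show int: "integrable M (\<lambda>x. exp (F x))"
    by (rule integrable_const_bound[where B="exp K"]) (use assms(2) * in auto)
  show "exp (-K) \<le> (\<integral>x. exp (F x) \<partial>M)"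
    using int by (rule integral_ge_const) (use * in auto)
  show "(\<integral>x. exp (F x) \<partial>M) \<le> exp K"
    using int by (rule integral_le_const) (use * in auto)
qed

text \<open>Prekopa-Leindler is applied to \<open>exp F\<close>, \<open>exp G\<close> and the
  constant \<open>exp c\<close>, each times the normal density. The convexity defect of the Gaussian
  exponent is exactly the quadratic cost that the hypothesis allows. The free constant
  \<open>c\<close> is where the tensorization puts the cost of the other coordinates.\<close>

lemma gaussian_prekopa_leindler_real:
  fixes F G :: "real \<Rightarrow> real"
  assumes [measurable]: "F \<in> borel_measurable borel" "G \<in> borel_measurable borel"
    and bd: "\<And>x. \<bar>F x\<bar> \<le> K" "\<And>x. \<bar>G x\<bar> \<le> K" and s: "0 < s" "s < 1"
    and le: "\<And>x y. s * F x + (1 - s) * G y \<le> s * (1 - s) / 2 * (x - y)\<^sup>2 + c"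
  shows "(\<integral>x. exp (F x) \<partial>std_normal_distribution) powr s
    * (\<integral>x. exp (G x) \<partial>std_normal_distribution) powr (1 - s) \<le> exp c"
proof -
  let ?\<phi> = "std_normal_density"
  have le1: "?\<phi> x \<le> 1" for x
  proof -
    have "exp (- x\<^sup>2 / 2) \<le> 1" by simp
    moreover have "1 / sqrt (2 * pi) \<le> 1" using pi_ge_two by (simp add: real_le_rsqrt)
    ultimately show ?thesis unfolding std_normal_density_def
      using mult_mono[of "1 / sqrt (2 * pi)" 1 "exp (- x\<^sup>2 / 2)" 1] by simp
  qed
  have expb: "exp (H x) * ?\<phi> x \<le> exp K" if "\<And>x. \<bar>H x\<bar> \<le> K" for H x
    using mult_mono[of "exp (H x)" "exp K" "?\<phi> x" 1] that[of x] le1[of x] by (auto simp: abs_le_iff)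
  have ints: "integrable lborel (\<lambda>x. exp (H x) * ?\<phi> x)"
      "(\<integral>x. exp (H x) \<partial>std_normal_distribution) = (\<integral>x. exp (H x) * ?\<phi> x \<partial>lborel)"
    if [measurable]: "H \<in> borel_measurable borel" and "\<And>x. \<bar>H x\<bar> \<le> K" for H
  proof -
    have "integrable std_normal_distribution (\<lambda>x. exp (H x))"
      using that by (intro bounded_exp_integral[where K=K] prob_space_normal_density) auto
    then show "integrable lborel (\<lambda>x. exp (H x) * ?\<phi> x)"
      by (subst (asm) integrable_density) (auto simp: mult.commute)
    show "(\<integral>x. exp (H x) \<partial>std_normal_distribution) = (\<integral>x. exp (H x) * ?\<phi> x \<partial>lborel)"
      by (subst integral_density) (auto simp: mult.commute)
  qed
  have "(\<integral>x. exp (F x) * ?\<phi> x \<partial>lborel) powr s * (\<integral>x. exp (G x) * ?\<phi> x \<partial>lborel) powr (1 - s)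
    \<le> (\<integral>x. exp c * ?\<phi> x \<partial>lborel)"
  proof (rule prekopa_leindler_real)
    fix x y
    have eq: "?\<phi> z = exp (- ln (sqrt (2 * pi)) - z\<^sup>2 / 2)" for z
    proof -
      have "exp (- ln (sqrt (2 * pi)) - z\<^sup>2 / 2) = exp (- ln (sqrt (2 * pi))) * exp (- z\<^sup>2 / 2)"
        by (simp add: exp_add[symmetric])
      also have "exp (- ln (sqrt (2 * pi))) = 1 / sqrt (2 * pi)" by (simp add: exp_minus divide_inverse)
      finally show ?thesis by (simp add: std_normal_density_def)
    qed
    let ?l = "ln (sqrt (2 * pi))"
    have "(exp (F x) * ?\<phi> x) powr s * (exp (G y) * ?\<phi> y) powr (1 - s)
      = exp (s * (F x + (- ?l - x\<^sup>2 / 2)) + (1 - s) * (G y + (- ?l - y\<^sup>2 / 2)))"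
      unfolding eq by (simp add: exp_add[symmetric] exp_powr_real mult.commute)
    also have "\<dots> \<le> exp (c + (- ?l - (s * x + (1 - s) * y)\<^sup>2 / 2))"
    proof -
      have "(s * x + (1 - s) * y)\<^sup>2 = s * x\<^sup>2 + (1 - s) * y\<^sup>2 - s * (1 - s) * (x - y)\<^sup>2"
        by (simp add: power2_eq_square algebra_simps)
      then show ?thesis using le[of x y] by (simp add: field_simps)
    qed
    also have "\<dots> = exp c * ?\<phi> (s * x + (1 - s) * y)" unfolding eq by (simp add: exp_add)
    finally show "(exp (F x) * ?\<phi> x) powr s * (exp (G y) * ?\<phi> y) powr (1 - s)
      \<le> exp c * ?\<phi> (s * x + (1 - s) * y)" .
  next
    show "bdd_above (range (\<lambda>x. exp (F x) * ?\<phi> x))" "bdd_above (range (\<lambda>x. exp (G x) * ?\<phi> x))"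
      using expb bd by (auto intro!: bdd_aboveI2)
  qed (use s ints bd in \<open>auto simp: integrable_normal_density normal_density_pos\<close>)
  then show ?thesis using ints bd by (simp add: integral_normal_density)
qed

text \<open>Integrating out one coordinate replaces \<open>F\<close> by the logarithm of a partial
  integral of \<open>exp F\<close>. The one-dimensional inequality says that the new pair satisfies
  the same hypothesis in the remaining coordinates, with the same \<open>c\<close>.\<close>

lemma gaussian_prekopa_leindler_PiM:
  fixes F G :: "('i \<Rightarrow> real) \<Rightarrow> real"
  assumes "finite I"
    and "F \<in> borel_measurable (PiM I (\<lambda>_. std_normal_distribution))"
    and "G \<in> borel_measurable (PiM I (\<lambda>_. std_normal_distribution))"
    and bd: "\<And>x. x \<in> extensional I \<Longrightarrow> \<bar>F x\<bar> \<le> K" "\<And>x. x \<in> extensional I \<Longrightarrow> \<bar>G x\<bar> \<le> K"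
    and s: "0 < s" "s < 1"
    and le: "\<And>x y. x \<in> extensional I \<Longrightarrow> y \<in> extensional I \<Longrightarrow>
      s * F x + (1 - s) * G y \<le> s * (1 - s) / 2 * (\<Sum>i\<in>I. (x i - y i)\<^sup>2) + c"
  shows "(\<integral>x. exp (F x) \<partial>(PiM I (\<lambda>_. std_normal_distribution))) powr s
    * (\<integral>x. exp (G x) \<partial>(PiM I (\<lambda>_. std_normal_distribution))) powr (1 - s) \<le> exp c"
  using assms(1-5) le
proof (induction I arbitrary: F G)
  case empty
  let ?u = "(\<lambda>_. undefined) :: 'i \<Rightarrow> real"
  have "exp (F ?u) powr s * exp (G ?u) powr (1 - s) = exp (s * F ?u + (1 - s) * G ?u)"
    by (simp add: exp_powr_real exp_add mult.commute)
  also have "\<dots> \<le> exp c" using empty.prems(5)[of ?u ?u] by simp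
  finally show ?case by (simp add: PiM_empty lebesgue_integral_count_space_finite)
next
  case (insert i I)
  let ?\<gamma> = "std_normal_distribution"
  interpret \<gamma>: prob_space ?\<gamma> by (rule prob_space_normal_density) simp
  interpret P: product_prob_space "\<lambda>_. ?\<gamma>" ..
  interpret PI: prob_space "PiM I (\<lambda>_. ?\<gamma>)" by (rule prob_space_PiM) unfold_locales
  interpret PI': prob_space "PiM (insert i I) (\<lambda>_. ?\<gamma>)" by (rule prob_space_PiM) unfold_locales
  note [measurable] = insert.prems(1,2)
  have ext: "x(i := t) \<in> extensional (insert i I)" if "x \<in> extensional I" for x :: "'i \<Rightarrow> real" and t
    using that by (auto simp: extensional_def)
  have sp: "space (PiM J (\<lambda>_. ?\<gamma>)) = extensional J" for J :: "'i set" by (auto simp: space_PiM PiE_def)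
  \<comment> \<open>The logarithm keeps the form \<open>exp\<close> of a function bounded by the
    same \<open>K\<close>, which the induction hypothesis asks for.\<close>
  define Q where "Q H x = ln (\<integral>t. exp (H (x(i := t))) \<partial>?\<gamma>)" for H :: "('i \<Rightarrow> real) \<Rightarrow> real" and x
  have Q: "Q H \<in> borel_measurable (PiM I (\<lambda>_. ?\<gamma>))"
      "\<And>x. x \<in> extensional I \<Longrightarrow> \<bar>Q H x\<bar> \<le> K"
      "\<And>x. x \<in> extensional I \<Longrightarrow> exp (Q H x) = (\<integral>t. exp (H (x(i := t))) \<partial>?\<gamma>)"
      "\<And>x. x \<in> extensional I \<Longrightarrow> (\<lambda>t. H (x(i := t))) \<in> borel_measurable borel"
      "(\<integral>x. exp (H x) \<partial>(PiM (insert i I) (\<lambda>_. ?\<gamma>))) = (\<integral>x. exp (Q H x) \<partial>(PiM I (\<lambda>_. ?\<gamma>)))"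
    if [measurable]: "H \<in> borel_measurable (PiM (insert i I) (\<lambda>_. ?\<gamma>))"
      and b: "\<And>x. x \<in> extensional (insert i I) \<Longrightarrow> \<bar>H x\<bar> \<le> K" for H
  proof -
    have up: "(\<lambda>(x, t). x(i := t)) \<in> measurable (PiM I (\<lambda>_. ?\<gamma>) \<Otimes>\<^sub>M ?\<gamma>) (PiM (insert i I) (\<lambda>_. ?\<gamma>))"
      using measurable_add_dim[of i I "\<lambda>_. ?\<gamma>"] by simp
    have HH[measurable]: "(\<lambda>(x, t). H (x(i := t))) \<in> borel_measurable (PiM I (\<lambda>_. ?\<gamma>) \<Otimes>\<^sub>M ?\<gamma>)"
      using measurable_compose[OF up that(1)] by (simp add: split_beta')
    show m: "\<And>x. x \<in> extensional I \<Longrightarrow> (\<lambda>t. H (x(i := t))) \<in> borel_measurable borel"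
      using measurable_Pair2[OF HH] by (simp add: sp)
    have pos: "exp (- K) \<le> (\<integral>t. exp (H (x(i := t))) \<partial>?\<gamma>)" "(\<integral>t. exp (H (x(i := t))) \<partial>?\<gamma>) \<le> exp K"
      if "x \<in> extensional I" for x
      using that b ext m by (intro bounded_exp_integral(2,3) \<gamma>.prob_space_axioms; simp)+
    have gt: "0 < (\<integral>t. exp (H (x(i := t))) \<partial>?\<gamma>)" if "x \<in> extensional I" for x
      using pos(1)[OF that] exp_gt_zero[of "-K"] by linarith
    show "Q H \<in> borel_measurable (PiM I (\<lambda>_. ?\<gamma>))" unfolding Q_def by measurable
    show e: "\<And>x. x \<in> extensional I \<Longrightarrow> exp (Q H x) = (\<integral>t. exp (H (x(i := t))) \<partial>?\<gamma>)"
      unfolding Q_def using gt by simp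
    show "\<And>x. x \<in> extensional I \<Longrightarrow> \<bar>Q H x\<bar> \<le> K"
      using pos e by (simp add: abs_le_iff) (smt (verit) exp_le_cancel_iff)
    have "integrable (PiM (insert i I) (\<lambda>_. ?\<gamma>)) (\<lambda>x. exp (H x))"
      using b by (intro bounded_exp_integral(1) PI'.prob_space_axioms) (auto simp: sp)
    then show "(\<integral>x. exp (H x) \<partial>(PiM (insert i I) (\<lambda>_. ?\<gamma>))) = (\<integral>x. exp (Q H x) \<partial>(PiM I (\<lambda>_. ?\<gamma>)))"
      using insert.hyps by (subst P.product_integral_insert) (auto intro!: Bochner_Integration.integral_cong simp: sp e)
  qed
  have "(\<integral>x. exp (Q F x) \<partial>(PiM I (\<lambda>_. ?\<gamma>))) powr s
    * (\<integral>x. exp (Q G x) \<partial>(PiM I (\<lambda>_. ?\<gamma>))) powr (1 - s) \<le> exp c"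
  proof (rule insert.IH)
    fix x y :: "'i \<Rightarrow> real" assume xy: "x \<in> extensional I" "y \<in> extensional I"
    have "(\<integral>t. exp (F (x(i := t))) \<partial>?\<gamma>) powr s * (\<integral>t. exp (G (y(i := t))) \<partial>?\<gamma>) powr (1 - s)
       \<le> exp (s * (1 - s) / 2 * (\<Sum>i\<in>I. (x i - y i)\<^sup>2) + c)"
    proof (rule gaussian_prekopa_leindler_real)
      fix t u
      have "(\<Sum>j\<in>I. ((x(i:=t)) j - (y(i:=u)) j)\<^sup>2) = (\<Sum>j\<in>I. (x j - y j)\<^sup>2)"
        using insert.hyps by (intro sum.cong) auto
      then show "s * F (x(i := t)) + (1 - s) * G (y(i := u))
        \<le> s * (1 - s) / 2 * (t - u)\<^sup>2 + (s * (1 - s) / 2 * (\<Sum>i\<in>I. (x i - y i)\<^sup>2) + c)"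
        using insert.prems(5)[OF ext[OF xy(1), of t] ext[OF xy(2), of u]] insert.hyps
        by (simp add: distrib_left fun_upd_def)
    qed (use s insert.prems ext xy Q(4) in auto)
    then have "exp (Q F x) powr s * exp (Q G y) powr (1 - s) \<le> exp (s * (1 - s) / 2 * (\<Sum>i\<in>I. (x i - y i)\<^sup>2) + c)"
      using Q(3)[of F x] Q(3)[of G y] insert.prems xy by simp
    moreover have "exp (Q F x) powr s * exp (Q G y) powr (1 - s) = exp (s * Q F x + (1 - s) * Q G y)"
      by (simp add: exp_powr_real exp_add mult.commute)
    ultimately have "exp (s * Q F x + (1 - s) * Q G y) \<le> exp (s * (1 - s) / 2 * (\<Sum>i\<in>I. (x i - y i)\<^sup>2) + c)"
      by (simp only:)
    then show "s * Q F x + (1 - s) * Q G y \<le> s * (1 - s) / 2 * (\<Sum>i\<in>I. (x i - y i)\<^sup>2) + c" by simp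
  qed (use Q insert.prems in auto)
  then show ?case using Q(5) insert.prems by simp
qed

text \<open>Jensen's inequality, from the tangent to \<open>exp\<close> at the mean of
  \<open>F\<close>.\<close>

lemma exp_integral_le_integral_exp:
  fixes F :: "'a \<Rightarrow> real"
  assumes "prob_space M" "F \<in> borel_measurable M" "\<And>x. x \<in> space M \<Longrightarrow> \<bar>F x\<bar> \<le> K"
  shows "exp (\<integral>x. F x \<partial>M) \<le> (\<integral>x. exp (F x) \<partial>M)"
proof -
  interpret prob_space M by fact
  have int: "integrable M F" using assms by (intro integrable_const_bound[where B=K]) auto
  let ?m = "\<integral>x. F x \<partial>M"
  have "exp ?m = (\<integral>x. exp ?m * (1 + (F x - ?m)) \<partial>M)" using int by (simp add: prob_space)
  also have "\<dots> \<le> (\<integral>x. exp (F x) \<partial>M)"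
  proof (rule integral_mono)
    show "integrable M (\<lambda>x. exp (F x))" using assms by (rule bounded_exp_integral)
    fix x
    have "exp ?m * (1 + (F x - ?m)) \<le> exp ?m * exp (F x - ?m)" by (intro mult_left_mono exp_ge_add_one_self) auto
    then show "exp ?m * (1 + (F x - ?m)) \<le> exp (F x)" by (simp add: exp_add[symmetric])
  qed (use int in auto)
  finally show ?thesis .
qed

text \<open>The infimum-convolution inequality is applied to \<open>c F\<close> and \<open>- s / (1 - s) c F\<close>; the
  second factor is bounded below by Jensen's inequality, and \<open>s\<close> tends to 0.\<close>

lemma gaussian_concentration_Lipschitz_bounded:
  fixes F :: "('i \<Rightarrow> real) \<Rightarrow> real"
  assumes "finite I" and [measurable]: "F \<in> borel_measurable (PiM I (\<lambda>_. std_normal_distribution))"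
    and bd: "\<And>x. x \<in> extensional I \<Longrightarrow> \<bar>F x\<bar> \<le> K"
    and lip: "\<And>x y. x \<in> extensional I \<Longrightarrow> y \<in> extensional I \<Longrightarrow>
      \<bar>F x - F y\<bar> \<le> \<sigma> * sqrt (\<Sum>i\<in>I. (x i - y i)\<^sup>2)"
  shows "(\<integral>x. exp (c * F x) \<partial>(PiM I (\<lambda>_. std_normal_distribution)))
    \<le> exp (c\<^sup>2 * \<sigma>\<^sup>2 / 2 + c * (\<integral>x. F x \<partial>(PiM I (\<lambda>_. std_normal_distribution))))"
proof -
  let ?P = "PiM I (\<lambda>_. std_normal_distribution)"
  have prob: "prob_space ?P" by (intro prob_space_PiM prob_space_normal_density) simp
  interpret prob_space ?P by (fact prob)
  have sp: "space (PiM J (\<lambda>_. std_normal_distribution)) = extensional J" for J :: "'i set"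
    by (auto simp: space_PiM PiE_def)
  define m where "m = (\<integral>x. F x \<partial>?P)"
  define A where "A = (\<integral>x. exp (c * F x) \<partial>?P)"
  have K: "0 \<le> K" using bd[of "\<lambda>_. undefined"] by (auto simp: extensional_def)
  have cF: "\<bar>d * F x\<bar> \<le> \<bar>d\<bar> * K" if "x \<in> extensional I" for x d
    using bd[OF that] by (simp add: abs_mult mult_left_mono)
  have A: "0 < A"
    unfolding A_def
    by (rule less_le_trans[OF exp_gt_zero bounded_exp_integral(2)[OF prob, of _ "\<bar>c\<bar> * K"]])
      (use cF in \<open>auto simp: sp\<close>)
  have step: "ln A \<le> c * m + c\<^sup>2 * \<sigma>\<^sup>2 / (2 * (1 - s))" if s: "0 < s" "s < 1" for s
  proof -
    \<comment> \<open>This \<open>d\<close> solves \<open>s * c + (1 - s) * d = 0\<close>, so the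
      weighted sum depends on \<open>F x - F y\<close> alone, which the Lipschitz condition
      controls.\<close>
    define d where "d = - (s / (1 - s)) * c"
    define B where "B = (\<integral>x. exp (d * F x) \<partial>?P)"
    have sd: "(1 - s) * d = - s * c" using s by (simp add: d_def)
    have B: "exp (d * m) \<le> B"
      using exp_integral_le_integral_exp[OF prob, of "\<lambda>x. d * F x" "\<bar>d\<bar> * K"] cF
      by (simp add: B_def m_def sp)
    have "A powr s * B powr (1 - s) \<le> exp (s * c\<^sup>2 * \<sigma>\<^sup>2 / (2 * (1 - s)))"
      unfolding A_def B_def
    proof (rule gaussian_prekopa_leindler_PiM[where K = "max (\<bar>c\<bar> * K) (\<bar>d\<bar> * K)"])
      fix x y :: "'i \<Rightarrow> real" assume xy: "x \<in> extensional I" "y \<in> extensional I"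
      define D where "D = sqrt (\<Sum>i\<in>I. (x i - y i)\<^sup>2)"
      have D: "(\<Sum>i\<in>I. (x i - y i)\<^sup>2) = D\<^sup>2" unfolding D_def by (simp add: sum_nonneg)
      have "s * (c * F x) + (1 - s) * (d * F y) = s * (c * F x) + ((1 - s) * d) * F y" by simp
      also have "\<dots> = s * (c * (F x - F y))" unfolding sd by (simp add: algebra_simps)
      also have "\<dots> \<le> s * (\<bar>c\<bar> * (\<sigma> * D))"
      proof -
        have "c * (F x - F y) \<le> \<bar>c\<bar> * \<bar>F x - F y\<bar>" by (metis abs_ge_self abs_mult)
        also have "\<dots> \<le> \<bar>c\<bar> * (\<sigma> * D)" using lip[OF xy] by (simp add: D_def mult_left_mono)
        finally show ?thesis using s by simp
      qed
      \<comment> \<open>The added constant is the maximum over \<open>D\<close> of \<open>s *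
        \<bar>c\<bar> * \<sigma> * D - s * (1 - s) / 2 * D\<^sup>2\<close>; completing the square
        shows it.\<close>
      also have "\<dots> \<le> s * (1 - s) / 2 * D\<^sup>2 + s * c\<^sup>2 * \<sigma>\<^sup>2 / (2 * (1 - s))"
      proof -
        have "0 \<le> s / (2 * (1 - s)) * ((1 - s) * D - \<bar>c\<bar> * \<sigma>)\<^sup>2" using s by simp
        also have "((1 - s) * D - \<bar>c\<bar> * \<sigma>)\<^sup>2 = (1 - s)\<^sup>2 * D\<^sup>2 + c\<^sup>2 * \<sigma>\<^sup>2 - 2 * (1 - s) * (\<bar>c\<bar> * \<sigma> * D)"
          by (simp add: power2_diff power_mult_distrib)
        also have "s / (2 * (1 - s)) * \<dots>
            = s * (1 - s) / 2 * D\<^sup>2 + s * c\<^sup>2 * \<sigma>\<^sup>2 / (2 * (1 - s)) - s * (\<bar>c\<bar> * (\<sigma> * D))"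
          using s by (simp add: divide_simps power2_eq_square) (simp add: algebra_simps)
        finally show ?thesis by simp
      qed
      finally show "s * (c * F x) + (1 - s) * (d * F y)
        \<le> s * (1 - s) / 2 * (\<Sum>i\<in>I. (x i - y i)\<^sup>2) + s * c\<^sup>2 * \<sigma>\<^sup>2 / (2 * (1 - s))" by (simp add: D)
    qed (use s assms(1) in \<open>auto simp del: abs_mult intro: order_trans[OF cF max.cobounded1] order_trans[OF cF max.cobounded2]\<close>)
    moreover have "A powr s * exp (d * m) powr (1 - s) \<le> A powr s * B powr (1 - s)"
      using B s by (intro mult_left_mono powr_mono2) auto
    ultimately have "A powr s * exp (d * m) powr (1 - s) \<le> exp (s * c\<^sup>2 * \<sigma>\<^sup>2 / (2 * (1 - s)))" by simp
    then have "exp (s * ln A + (1 - s) * d * m) \<le> exp (s * c\<^sup>2 * \<sigma>\<^sup>2 / (2 * (1 - s)))"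
      using A by (simp add: powr_def exp_add mult_ac)
    then have "s * ln A \<le> s * (c * m + c\<^sup>2 * \<sigma>\<^sup>2 / (2 * (1 - s)))"
      unfolding sd using s by (simp add: algebra_simps)
    then show ?thesis using s by simp
  qed
  \<comment> \<open>As \<open>s\<close> tends to 0 the factor \<open>1 / (1 - s)\<close> tends to 1,
    which leaves the sharp exponent.\<close>
  have "((\<lambda>s. c * m + c\<^sup>2 * \<sigma>\<^sup>2 / (2 * (1 - s))) \<longlongrightarrow> c * m + c\<^sup>2 * \<sigma>\<^sup>2 / (2 * (1 - 0))) (at_right 0)"
    by (intro tendsto_intros) auto
  then have "ln A \<le> c * m + c\<^sup>2 * \<sigma>\<^sup>2 / (2 * (1 - 0))"
  proof (rule tendsto_lowerbound)
    show "\<forall>\<^sub>F s in at_right 0. ln A \<le> c * m + c\<^sup>2 * \<sigma>\<^sup>2 / (2 * (1 - s))"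
      using eventually_at_right_real[OF zero_less_one] by (rule eventually_mono) (rule step; simp)
  qed simp
  then have "A \<le> exp (c * m + c\<^sup>2 * \<sigma>\<^sup>2 / 2)" using A by (metis exp_le_cancel_iff exp_ln diff_zero mult_2_right mult.right_neutral)
  then show ?thesis by (simp add: A_def m_def add.commute)
qed

text \<open>Truncation at level \<open>L\<close> preserves the Lipschitz constant and gives access
  to the bounded case; the mean there is estimated by the quantile, uniformly in \<open>L\<close>,
  and Fatou's lemma removes the truncation.\<close>

theorem gaussian_concentration_Lipschitz:
  fixes F :: "('i \<Rightarrow> real) \<Rightarrow> real"
  assumes "finite I" and [measurable]: "F \<in> borel_measurable (PiM I (\<lambda>_. std_normal_distribution))"
    and lip: "\<And>x y. x \<in> extensional I \<Longrightarrow> y \<in> extensional I \<Longrightarrow>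
      \<bar>F x - F y\<bar> \<le> \<sigma> * sqrt (\<Sum>i\<in>I. (x i - y i)\<^sup>2)"
    and med: "1/2 \<le> measure (PiM I (\<lambda>_. std_normal_distribution))
      {x \<in> space (PiM I (\<lambda>_. std_normal_distribution)). F x \<le> k}"
    and c: "0 \<le> c"
  shows "(\<integral>\<^sup>+x. ennreal (exp (c * F x)) \<partial>(PiM I (\<lambda>_. std_normal_distribution)))
    \<le> ennreal (exp (c\<^sup>2 * \<sigma>\<^sup>2 / 2 + c * (k + \<sigma>\<^sup>2 / 2 + ln 2)))"
proof -
  let ?P = "PiM I (\<lambda>_. std_normal_distribution)"
  have prob: "prob_space ?P" by (intro prob_space_PiM prob_space_normal_density) simp
  interpret prob_space ?P by (fact prob)
  define C where "C L x = max (-L) (min L (F x))" for L x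
  have C[measurable]: "C L \<in> borel_measurable ?P" for L unfolding C_def by measurable
  have Cb: "\<bar>C L x\<bar> \<le> L" if "0 \<le> L" for L x using that by (auto simp: C_def)
  have Cl: "\<bar>C L x - C L y\<bar> \<le> \<sigma> * sqrt (\<Sum>i\<in>I. (x i - y i)\<^sup>2)"
    if "x \<in> extensional I" "y \<in> extensional I" "0 \<le> L" for L x y
    using lip[OF that(1,2)] that(3) by (auto simp: C_def max_def min_def)
  have conc: "(\<integral>x. exp (d * C L x) \<partial>?P) \<le> exp (d\<^sup>2 * \<sigma>\<^sup>2 / 2 + d * (\<integral>x. C L x \<partial>?P))" if "0 \<le> L" for d L
    by (rule gaussian_concentration_Lipschitz_bounded[where K=L]) (use assms(1) Cb Cl that in auto)
  have ei: "integrable ?P (\<lambda>x. exp (d * C L x))" if "0 \<le> L" for d L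
    using Cb[OF that] by (intro bounded_exp_integral(1)[OF prob, where K="\<bar>d\<bar> * L"]) (auto simp: abs_mult mult_left_mono)
  \<comment> \<open>The exponent -1 is used here. On an event of probability at least 1/2 the
    truncated function is at most \<open>k\<close>, so \<open>exp (-k) / 2\<close> bounds the
    integral of its negative exponential from below, whereas concentration bounds that integral by
    \<open>exp (\<sigma>\<^sup>2 / 2)\<close> divided by the exponential of the mean. The condition
    on \<open>L\<close> keeps the lower cutoff \<open>-L\<close> from exceeding
    \<open>k\<close>.\<close>
  have mean: "(\<integral>x. C L x \<partial>?P) \<le> k + \<sigma>\<^sup>2 / 2 + ln 2" if L: "\<bar>k\<bar> \<le> L" for L
  proof -
    have L0: "0 \<le> L" using L by linarith
    let ?S = "{x \<in> space ?P. F x \<le> k}"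
    have "integrable ?P (indicat_real ?S)" by (intro integrable_real_indicator) (auto simp: less_top[symmetric])
    note [simp] = this
    have "exp (-k) * (1/2) \<le> exp (-k) * measure ?P ?S" using med by simp
    also have "\<dots> = (\<integral>x. exp (-k) * indicator ?S x \<partial>?P)" by simp
    also have "\<dots> \<le> (\<integral>x. exp (-1 * C L x) \<partial>?P)"
      by (rule integral_mono) (use ei[OF L0, of "-1"] L in \<open>auto simp: C_def split: split_indicator\<close>)
    also have "\<dots> \<le> exp (\<sigma>\<^sup>2 / 2 - (\<integral>x. C L x \<partial>?P))" using conc[OF L0, of "-1"] by simp
    finally have "exp (- k - ln 2) \<le> exp (\<sigma>\<^sup>2 / 2 - (\<integral>x. C L x \<partial>?P))" by (simp add: exp_diff)
    then show ?thesis by simp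
  qed
  define B where "B = exp (c\<^sup>2 * \<sigma>\<^sup>2 / 2 + c * (k + \<sigma>\<^sup>2 / 2 + ln 2))"
  have bound: "(\<integral>\<^sup>+x. ennreal (exp (c * C L x)) \<partial>?P) \<le> ennreal B" if L: "\<bar>k\<bar> \<le> L" for L
  proof -
    have L0: "0 \<le> L" using L by linarith
    have "(\<integral>\<^sup>+x. ennreal (exp (c * C L x)) \<partial>?P) = ennreal (\<integral>x. exp (c * C L x) \<partial>?P)"
      using ei[OF L0] by (intro nn_integral_eq_integral) auto
    also have "\<dots> \<le> ennreal B"
      using order_trans[OF conc[OF L0, of c]] mult_left_mono[OF mean[OF L] c]
      by (auto intro!: ennreal_leI simp: B_def)
    finally show ?thesis .
  qed
  have "(\<integral>\<^sup>+x. ennreal (exp (c * F x)) \<partial>?P) = (\<integral>\<^sup>+x. liminf (\<lambda>n. ennreal (exp (c * C (real n) x))) \<partial>?P)"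
  proof (rule nn_integral_cong)
    fix x
    obtain n0 :: nat where n0: "\<bar>F x\<bar> < real n0" using reals_Archimedean2 by blast
    have "(\<lambda>n. ennreal (exp (c * C (real n) x))) \<longlonglongrightarrow> ennreal (exp (c * F x))"
      by (rule tendsto_eventually, rule eventually_sequentiallyI[of n0]) (use n0 in \<open>auto simp: C_def max_def min_def\<close>)
    from lim_imp_Liminf[OF sequentially_bot this]
    show "ennreal (exp (c * F x)) = liminf (\<lambda>n. ennreal (exp (c * C (real n) x)))" by simp
  qed
  also have "\<dots> \<le> liminf (\<lambda>n. \<integral>\<^sup>+x. ennreal (exp (c * C (real n) x)) \<partial>?P)"
    by (rule nn_integral_liminf) measurable
  also have "\<dots> \<le> ennreal B"
  proof (rule Liminf_le)
    obtain n0 :: nat where n0: "\<bar>k\<bar> < real n0" using reals_Archimedean2 by blast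
    show "\<forall>\<^sub>F n in sequentially. (\<integral>\<^sup>+x. ennreal (exp (c * C (real n) x)) \<partial>?P) \<le> ennreal B"
      by (rule eventually_sequentiallyI[of n0], rule bound) (use n0 in auto)
  qed simp
  finally show ?thesis by (simp add: B_def)
qed

subsection \<open>Uniqueness of joint laws\<close>

lemma integrable_bounded_complex:
  fixes f :: "'a \<Rightarrow> complex"
  assumes "finite_measure M" "f \<in> borel_measurable M" "\<And>x. norm (f x) \<le> B"
  shows "integrable M f"
proof -
  interpret finite_measure M by fact
  show ?thesis using assms by (intro integrable_const_bound[where B=B]) auto
qed

text \<open>A weight \<open>v\<close> of total mass \<open>c\<close> becomes the probability density
  \<open>v / c\<close>; weighted Fourier integrals are then characteristic functions, to which
  Levy's uniqueness theorem applies.\<close>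

lemma char_distr_density_scaled:
  fixes v :: "'a \<Rightarrow> real" and Y :: "'a \<Rightarrow> real"
  assumes N: "prob_space N" and [measurable]: "v \<in> borel_measurable N" "Y \<in> borel_measurable N"
    and v: "\<And>x. 0 \<le> v x" and vc: "(\<integral>x. v x \<partial>N) = c" and c: "0 < c" and iv: "integrable N v"
    and [measurable]: "B \<in> sets borel"
  shows "real_distribution (distr (density N (\<lambda>x. ennreal (v x / c))) borel Y)"
    "char (distr (density N (\<lambda>x. ennreal (v x / c))) borel Y) t
      = (\<integral>x. of_real (v x) * iexp (t * Y x) \<partial>N) / c"
    "measure (distr (density N (\<lambda>x. ennreal (v x / c))) borel Y) B
      = (\<integral>x. v x * indicator B (Y x) \<partial>N) / c"
proof -
  interpret N: prob_space N by (fact N)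
  have "emeasure (density N (\<lambda>x. ennreal (v x / c))) (space (density N (\<lambda>x. ennreal (v x / c))))
      = (\<integral>\<^sup>+x. ennreal (v x / c) \<partial>N)" by (auto simp: emeasure_density intro!: nn_integral_cong)
  also have "\<dots> = ennreal (\<integral>x. v x / c \<partial>N)" using iv v c by (intro nn_integral_eq_integral) auto
  also have "\<dots> = 1" using vc c by simp
  finally have "prob_space (density N (\<lambda>x. ennreal (v x / c)))" by (rule prob_spaceI)
  then show rd: "real_distribution (distr (density N (\<lambda>x. ennreal (v x / c))) borel Y)"
    by (intro prob_space.real_distribution_distr) auto
  have "char (distr (density N (\<lambda>x. ennreal (v x / c))) borel Y) t
      = (\<integral>x. (v x / c) *\<^sub>R iexp (t * Y x) \<partial>N)"
    unfolding char_def using v c by (subst integral_distr, simp, simp, subst integral_density) auto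
  also have "\<dots> = (\<integral>x. of_real (v x) * iexp (t * Y x) / c \<partial>N)"
    by (simp add: scaleR_conv_of_real)
  finally show "char (distr (density N (\<lambda>x. ennreal (v x / c))) borel Y) t
      = (\<integral>x. of_real (v x) * iexp (t * Y x) \<partial>N) / c" by simp
  interpret R: real_distribution "distr (density N (\<lambda>x. ennreal (v x / c))) borel Y" by (rule rd)
  have "measure (distr (density N (\<lambda>x. ennreal (v x / c))) borel Y) B
      = (\<integral>x. indicator B x \<partial>distr (density N (\<lambda>x. ennreal (v x / c))) borel Y)" by simp
  also have "\<dots> = (\<integral>x. (v x / c) *\<^sub>R indicator B (Y x) \<partial>N)"
    using v c by (subst integral_distr, simp, simp, subst integral_density) auto
  also have "\<dots> = (\<integral>x. v x * indicator B (Y x) / c \<partial>N)" by simp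
  finally show "measure (distr (density N (\<lambda>x. ennreal (v x / c))) borel Y) B
      = (\<integral>x. v x * indicator B (Y x) \<partial>N) / c" by simp
qed

lemma weighted_char_uniqueness:
  fixes w :: "'a \<Rightarrow> real" and w' :: "'b \<Rightarrow> real"
  assumes M: "prob_space M" and M': "prob_space M'"
    and m[measurable]: "w \<in> borel_measurable M" "w' \<in> borel_measurable M'"
      "X \<in> borel_measurable M" "X' \<in> borel_measurable M'"
    and w: "\<And>x. 0 \<le> w x" "\<And>x. w x \<le> K" and w': "\<And>x. 0 \<le> w' x" "\<And>x. w' x \<le> K"
    and eq: "\<And>t. (\<integral>x. of_real (w x) * iexp (t * X x) \<partial>M) = (\<integral>x. of_real (w' x) * iexp (t * X' x) \<partial>M')"
    and B[measurable]: "B \<in> sets borel"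
  shows "(\<integral>x. w x * indicator B (X x) \<partial>M) = (\<integral>x. w' x * indicator B (X' x) \<partial>M')"
proof -
  interpret M: prob_space M by fact
  interpret M': prob_space M' by fact
  have i: "integrable M w" "integrable M' w'"
    using w w' by (auto intro!: M.integrable_const_bound[where B=K] M'.integrable_const_bound[where B=K])
  define c where "c = (\<integral>x. w x \<partial>M)"
  \<comment> \<open>Frequency 0 shows that the two weights have the same total mass, so one
    normalization serves both.\<close>
  have c': "c = (\<integral>x. w' x \<partial>M')"
    using eq[of 0] i unfolding c_def by (simp del: of_real_mult add: integral_complex_of_real)
  have c0: "0 \<le> c" using w by (auto simp: c_def)
  show ?thesis
  proof (cases "c = 0")
    case True
    have "AE x in M. w x = 0" using True i w unfolding c_def by (subst (asm) integral_nonneg_eq_0_iff_AE) auto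
    moreover have "AE x in M'. w' x = 0" using True i w' unfolding c' by (subst (asm) integral_nonneg_eq_0_iff_AE) auto
    ultimately have "(\<integral>x. w x * indicator B (X x) \<partial>M) = 0" "(\<integral>x. w' x * indicator B (X' x) \<partial>M') = 0"
      by (auto intro!: integral_eq_zero_AE)
    then show ?thesis by simp
  next
    case False
    with c0 have c: "0 < c" by simp
    note l = char_distr_density_scaled[OF M m(1,3) w(1) c_def[symmetric] c i(1) B]
    note l' = char_distr_density_scaled[OF M' m(2,4) w'(1) c'[symmetric] c i(2) B]
    have "distr (density M (\<lambda>x. ennreal (w x / c))) borel X
        = distr (density M' (\<lambda>x. ennreal (w' x / c))) borel X'"
      using l(1) l'(1) by (rule Levy_uniqueness) (use eq in \<open>simp add: fun_eq_iff l(2) l'(2)\<close>)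
    then show ?thesis using l(3) l'(3) c by simp
  qed
qed

lemma integral_real_weight_iexp:
  fixes u a :: "'a \<Rightarrow> real"
  assumes "prob_space M" and [measurable]: "u \<in> borel_measurable M" "a \<in> borel_measurable M"
    and u: "\<And>x. \<bar>u x\<bar> \<le> 1"
  shows "(\<integral>x. of_real (u x) * iexp (a x) \<partial>M)
    = of_real (\<integral>x. u x * cos (a x) \<partial>M) + \<i> * of_real (\<integral>x. u x * sin (a x) \<partial>M)"
proof -
  interpret prob_space M by fact
  have i: "integrable M (\<lambda>x. u x * cos (a x))" "integrable M (\<lambda>x. u x * sin (a x))"
    using u by (auto intro!: integrable_const_bound[where B=1] simp: abs_mult mult_le_one)
  have "(\<integral>x. of_real (u x) * iexp (a x) \<partial>M)
    = (\<integral>x. of_real (u x * cos (a x)) + \<i> * of_real (u x * sin (a x)) \<partial>M)"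
    by (intro Bochner_Integration.integral_cong) (simp_all add: exp_Euler distrib_left flip: cos_of_real sin_of_real)
  also have "\<dots> = of_real (\<integral>x. u x * cos (a x) \<partial>M) + \<i> * of_real (\<integral>x. u x * sin (a x) \<partial>M)"
    using i by (simp del: of_real_mult add: integral_complex_of_real integrable_of_real)
  finally show ?thesis .
qed

text \<open>The weights \<open>w (1 + cos \<theta>)\<close> and \<open>w (1 + sin \<theta>)\<close> are nonnegative, which reduces complex
  weights \<open>w exp (i \<theta>)\<close> to Levy's uniqueness theorem for measures.\<close>

lemma complex_weighted_char_uniqueness:
  fixes w :: "'a \<Rightarrow> real" and w' :: "'b \<Rightarrow> real"
  assumes M: "prob_space M" and M': "prob_space M'"
    and m[measurable]: "w \<in> borel_measurable M" "w' \<in> borel_measurable M'"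
      "X \<in> borel_measurable M" "X' \<in> borel_measurable M'"
      "\<theta> \<in> borel_measurable M" "\<theta>' \<in> borel_measurable M'"
    and w: "\<And>x. 0 \<le> w x" "\<And>x. w x \<le> 1" and w': "\<And>x. 0 \<le> w' x" "\<And>x. w' x \<le> 1"
    and eq: "\<And>k t. (\<integral>x. of_real (w x) * iexp (k * \<theta> x + t * X x) \<partial>M)
      = (\<integral>x. of_real (w' x) * iexp (k * \<theta>' x + t * X' x) \<partial>M')"
    and B[measurable]: "B \<in> sets borel"
  shows "(\<integral>x. of_real (w x * indicator B (X x)) * iexp (\<theta> x) \<partial>M)
    = (\<integral>x. of_real (w' x * indicator B (X' x)) * iexp (\<theta>' x) \<partial>M')"
proof -
  \<comment> \<open>The factors \<open>1 + cos\<close> and \<open>1 + sin\<close> are combinations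
    of the multiples 0, 1 and -1 of the phase; the hypothesis ranges over all multiples
    \<open>k\<close> in order to provide them.\<close>
  have trig: "of_real (v * (1 + cos a)) * iexp u
        = of_real v * iexp (0 * a + u) + (of_real v * iexp (1 * a + u) + of_real v * iexp (-1 * a + u)) / 2"
      "of_real (v * (1 + sin a)) * iexp u
        = of_real v * iexp (0 * a + u) + (of_real v * iexp (1 * a + u) - of_real v * iexp (-1 * a + u)) / (2 * \<i>)"
    for v a u :: real
  proof -
    have "iexp (1 * a + u) = iexp a * iexp u" "iexp (-1 * a + u) = iexp (- a) * iexp u"
      by (simp_all add: exp_add[symmetric] distrib_left right_diff_distrib)
    moreover have "iexp a = of_real (cos a) + \<i> * of_real (sin a)" "iexp (- a) = of_real (cos a) - \<i> * of_real (sin a)"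
      using exp_Euler[of "of_real a"] exp_Euler[of "- of_real a"] by (simp_all flip: cos_of_real sin_of_real)
    ultimately show "of_real (v * (1 + cos a)) * iexp u
        = of_real v * iexp (0 * a + u) + (of_real v * iexp (1 * a + u) + of_real v * iexp (-1 * a + u)) / 2"
      "of_real (v * (1 + sin a)) * iexp u
        = of_real v * iexp (0 * a + u) + (of_real v * iexp (1 * a + u) - of_real v * iexp (-1 * a + u)) / (2 * \<i>)"
      by (simp_all only: of_real_mult of_real_add of_real_1) (simp_all add: field_simps)
  qed
  define D where "D k t x = of_real (w x) * iexp (k * \<theta> x + t * X x)" for k t x
  define D' where "D' k t x = of_real (w' x) * iexp (k * \<theta>' x + t * X' x)" for k t x
  have int: "integrable M (D k t)" "integrable M' (D' k t)" for k t
    unfolding D_def D'_def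
    using w w' M M' by (auto intro!: integrable_bounded_complex[where B=1] prob_space.finite_measure simp: norm_mult)
  have eqD: "integral\<^sup>L M (D k t) = integral\<^sup>L M' (D' k t)" for k t unfolding D_def D'_def by (rule eq)
  have 1: "(\<integral>x. of_real (w x * (1 + cos (\<theta> x))) * iexp (t * X x) \<partial>M)
     = (\<integral>x. of_real (w' x * (1 + cos (\<theta>' x))) * iexp (t * X' x) \<partial>M')" for t
    unfolding trig D_def[symmetric] D'_def[symmetric] using int eqD by simp
  have 2: "(\<integral>x. of_real (w x * (1 + sin (\<theta> x))) * iexp (t * X x) \<partial>M)
     = (\<integral>x. of_real (w' x * (1 + sin (\<theta>' x))) * iexp (t * X' x) \<partial>M')" for t
    unfolding trig D_def[symmetric] D'_def[symmetric] using int eqD by simp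
  have 0: "(\<integral>x. of_real (w x) * iexp (t * X x) \<partial>M) = (\<integral>x. of_real (w' x) * iexp (t * X' x) \<partial>M')" for t
    using eq[of 0 t] by simp
  have b: "0 \<le> v * (1 + cos a)" "0 \<le> v * (1 + sin a)" "v * (1 + cos a) \<le> 2" "v * (1 + sin a) \<le> 2"
    if "0 \<le> v" "v \<le> 1" for v a :: real
  proof -
    have "0 \<le> 1 + cos a" "0 \<le> 1 + sin a" "1 + cos a \<le> 2" "1 + sin a \<le> 2"
      using cos_ge_minus_one[of a] sin_ge_minus_one[of a] cos_le_one[of a] sin_le_one[of a] by linarith+
    then show "0 \<le> v * (1 + cos a)" "0 \<le> v * (1 + sin a)" "v * (1 + cos a) \<le> 2" "v * (1 + sin a) \<le> 2"
      using that mult_mono[of v 1 "1 + cos a" 2] mult_mono[of v 1 "1 + sin a" 2] by auto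
  qed
  note r0 = weighted_char_uniqueness[OF M M' m(1-4) w w' 0 B]
  note r1 = weighted_char_uniqueness[OF M M' _ _ m(3,4) b(1)[OF w] b(3)[OF w] b(1)[OF w'] b(3)[OF w'] 1 B]
  note r2 = weighted_char_uniqueness[OF M M' _ _ m(3,4) b(2)[OF w] b(4)[OF w] b(2)[OF w'] b(4)[OF w'] 2 B]
  \<comment> \<open>Subtracting the identity for the bare weight isolates the cosine or the sine
    part.\<close>
  have d: "(\<integral>x. w x * indicator B (X x) * h (\<theta> x) \<partial>M) = (\<integral>x. w' x * indicator B (X' x) * h (\<theta>' x) \<partial>M')"
    if h: "h \<in> borel_measurable borel" "\<And>a. \<bar>h a\<bar> \<le> 1"
      and r: "(\<integral>x. w x * (1 + h (\<theta> x)) * indicator B (X x) \<partial>M)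
        = (\<integral>x. w' x * (1 + h (\<theta>' x)) * indicator B (X' x) \<partial>M')" for h :: "real \<Rightarrow> real"
  proof -
    note [measurable] = h(1)
    interpret M: prob_space M by fact
    interpret M': prob_space M' by fact
    have "integrable M (\<lambda>x. w x * indicator B (X x))" "integrable M (\<lambda>x. w x * indicator B (X x) * h (\<theta> x))"
      using w h(2) by (auto intro!: M.integrable_const_bound[where B=1] simp: abs_mult mult_le_one split: split_indicator)
    moreover have "integrable M' (\<lambda>x. w' x * indicator B (X' x))" "integrable M' (\<lambda>x. w' x * indicator B (X' x) * h (\<theta>' x))"
      using w' h(2) by (auto intro!: M'.integrable_const_bound[where B=1] simp: abs_mult mult_le_one split: split_indicator)
    moreover have "v * (1 + a) * i = v * i + v * i * a" for v a i :: real by (simp add: algebra_simps)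
    ultimately show ?thesis using r r0 by simp
  qed
  have "(\<integral>x. w x * (1 + cos (\<theta> x)) * indicator B (X x) \<partial>M)
      = (\<integral>x. w' x * (1 + cos (\<theta>' x)) * indicator B (X' x) \<partial>M')"
    by (rule r1) measurable
  from d[OF _ abs_cos_le_one this]
  have dc: "(\<integral>x. w x * indicator B (X x) * cos (\<theta> x) \<partial>M) = (\<integral>x. w' x * indicator B (X' x) * cos (\<theta>' x) \<partial>M')"
    by simp
  have "(\<integral>x. w x * (1 + sin (\<theta> x)) * indicator B (X x) \<partial>M)
      = (\<integral>x. w' x * (1 + sin (\<theta>' x)) * indicator B (X' x) \<partial>M')"
    by (rule r2) measurable
  from d[OF _ abs_sin_le_one this]
  have ds: "(\<integral>x. w x * indicator B (X x) * sin (\<theta> x) \<partial>M) = (\<integral>x. w' x * indicator B (X' x) * sin (\<theta>' x) \<partial>M')"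
    by simp
  have "\<bar>w x * indicator B (X x)\<bar> \<le> 1" "\<bar>w' y * indicator B (X' y)\<bar> \<le> 1" for x y
    using w w' by (auto split: split_indicator)
  then show ?thesis
    using dc ds by (subst (1 2) integral_real_weight_iexp) (auto intro: M M')
qed

text \<open>The sum over \<open>I - I\<close> is empty; it is written out so that the right-hand
  side is literally the last stage \<open>J = I\<close> of the claim inside
  \<open>distr_PiM_eq_char\<close>.\<close>

lemma measure_distr_PiM_box:
  fixes f :: "'i \<Rightarrow> 'a \<Rightarrow> real" and B :: "'i \<Rightarrow> real set"
  assumes N: "prob_space N" and I: "finite I" and [measurable]: "\<And>i. i \<in> I \<Longrightarrow> f i \<in> borel_measurable N"
    and B: "\<And>i. B i \<in> sets borel"
  shows "of_real (measure (distr N (PiM I (\<lambda>_. borel)) (\<lambda>x. \<lambda>i\<in>I. f i x)) (Pi\<^sub>E I B))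
    = (\<integral>x. of_real (\<Prod>j\<in>I. indicator (B j) (f j x)) * iexp (\<Sum>i\<in>I - I. a i * f i x) \<partial>N)"
proof -
  have m: "(\<lambda>x. \<lambda>i\<in>I. f i x) \<in> measurable N (PiM I (\<lambda>_. borel))" by measurable
  interpret N: prob_space N by fact
  have PB: "Pi\<^sub>E I B \<in> sets (PiM I (\<lambda>_. borel))" using B I by (intro sets_PiM_I_finite) auto
  let ?S = "(\<lambda>x. \<lambda>i\<in>I. f i x) -` Pi\<^sub>E I B \<inter> space N"
  have "(\<Prod>j\<in>I. indicator (B j) (f j x)) = indicat_real ?S x" if "x \<in> space N" for x
  proof (cases "\<forall>j\<in>I. f j x \<in> B j")
    case True then show ?thesis using that by (auto simp: indicator_def)
  next
    case False then show ?thesis using I that by (auto simp: indicator_def prod_zero_iff PiE_iff)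
  qed
  then have "(\<integral>x. of_real (\<Prod>j\<in>I. indicator (B j) (f j x)) * iexp (\<Sum>i\<in>I - I. a i * f i x) \<partial>N)
      = (\<integral>x. complex_of_real (indicat_real ?S x) \<partial>N)"
    by (intro Bochner_Integration.integral_cong) (auto simp del: of_real_prod)
  also have "\<dots> = of_real (measure N ?S)" by (subst integral_complex_of_real) simp
  finally show ?thesis using PB by (simp add: measure_distr[OF m])
qed

text \<open>Exponentials are exchanged for indicators one coordinate at a time, each exchange
  resting on one-dimensional uniqueness with a complex weight. \<open>J\<close> holds the
  coordinates already exchanged: for empty \<open>J\<close> the claim is the hypothesis, for
  \<open>J = I\<close> it is equality on boxes, which determine the law.\<close>

theorem distr_PiM_eq_char:
  fixes g :: "'i \<Rightarrow> 'a \<Rightarrow> real" and g' :: "'i \<Rightarrow> 'b \<Rightarrow> real"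
  assumes M: "prob_space M" and M': "prob_space M'" and I: "finite I"
    and m: "\<And>i. i \<in> I \<Longrightarrow> g i \<in> borel_measurable M" "\<And>i. i \<in> I \<Longrightarrow> g' i \<in> borel_measurable M'"
    and eq: "\<And>a. (\<integral>x. iexp (\<Sum>i\<in>I. a i * g i x) \<partial>M) = (\<integral>x. iexp (\<Sum>i\<in>I. a i * g' i x) \<partial>M')"
  shows "distr M (PiM I (\<lambda>_. borel)) (\<lambda>x. \<lambda>i\<in>I. g i x) = distr M' (PiM I (\<lambda>_. borel)) (\<lambda>x. \<lambda>i\<in>I. g' i x)"
proof -
  interpret M: prob_space M by fact
  interpret M': prob_space M' by fact
  note m[measurable]
  have claim: "(\<integral>x. of_real (\<Prod>j\<in>J. indicator (B j) (g j x)) * iexp (\<Sum>i\<in>I - J. a i * g i x) \<partial>M)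
      = (\<integral>x. of_real (\<Prod>j\<in>J. indicator (B j) (g' j x)) * iexp (\<Sum>i\<in>I - J. a i * g' i x) \<partial>M')"
    if "finite J" "J \<subseteq> I" "\<And>i. B i \<in> sets borel" for J a and B :: "'i \<Rightarrow> real set"
    using that(1,2)
  proof (induction J arbitrary: a)
    case empty
    then show ?case using eq by simp
  next
    case (insert j J)
    note [measurable] = that(3)
    have I_eq: "I - J = insert j (I - insert j J)" using insert by auto
    have jI: "j \<in> I" and JI: "J \<subseteq> I" using insert by auto
    have "(\<integral>x. of_real ((\<Prod>j\<in>J. indicator (B j) (g j x)) * indicator (B j) (g j x)) * iexp (\<Sum>i\<in>I - insert j J. a i * g i x) \<partial>M)
      = (\<integral>x. of_real ((\<Prod>j\<in>J. indicator (B j) (g' j x)) * indicator (B j) (g' j x)) * iexp (\<Sum>i\<in>I - insert j J. a i * g' i x) \<partial>M')"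
    proof (rule complex_weighted_char_uniqueness[OF M M'])
      fix k t
      \<comment> \<open>The multiple \<open>k\<close> scales the remaining frequencies and
        \<open>t\<close> is the frequency of the coordinate being exchanged, so the induction
        hypothesis is used for a whole family of frequency vectors.\<close>
      have s: "(\<Sum>i\<in>I - J. (if i = j then t else k * a i) * h i) = k * (\<Sum>i\<in>I - insert j J. a i * h i) + t * h j" for h
      proof -
        have "(\<Sum>i\<in>I - insert j J. (if i = j then t else k * a i) * h i) = k * (\<Sum>i\<in>I - insert j J. a i * h i)"
          unfolding sum_distrib_left by (intro sum.cong) auto
        then show ?thesis unfolding I_eq using I by (subst sum.insert) auto
      qed
      show "(\<integral>x. of_real (\<Prod>j\<in>J. indicator (B j) (g j x)) * iexp (k * (\<Sum>i\<in>I - insert j J. a i * g i x) + t * g j x) \<partial>M)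
        = (\<integral>x. of_real (\<Prod>j\<in>J. indicator (B j) (g' j x)) * iexp (k * (\<Sum>i\<in>I - insert j J. a i * g' i x) + t * g' j x) \<partial>M')"
        using insert.IH[OF JI, of "\<lambda>i. if i = j then t else k * a i"] unfolding s .
    next
      show "(\<lambda>x. \<Prod>j\<in>J. indicat_real (B j) (g j x)) \<in> borel_measurable M"
        "(\<lambda>x. \<Prod>j\<in>J. indicat_real (B j) (g' j x)) \<in> borel_measurable M'"
        using JI by (auto intro!: borel_measurable_prod measurable_compose[OF m(1) borel_measurable_indicator]
            measurable_compose[OF m(2) borel_measurable_indicator] that(3))
      show "(\<lambda>x. \<Sum>i\<in>I - insert j J. a i * g i x) \<in> borel_measurable M"
        "(\<lambda>x. \<Sum>i\<in>I - insert j J. a i * g' i x) \<in> borel_measurable M'"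
        by (auto intro!: borel_measurable_sum borel_measurable_times m)
    qed (use jI m that(3) in \<open>auto intro!: prod_nonneg prod_le_1\<close>)
    then show ?case using insert by (simp add: mult.commute)
  qed
  have mR: "(\<lambda>x. \<lambda>i\<in>I. g i x) \<in> measurable M (PiM I (\<lambda>_. borel))"
      "(\<lambda>x. \<lambda>i\<in>I. g' i x) \<in> measurable M' (PiM I (\<lambda>_. borel))" by measurable
  show ?thesis
  proof (rule measure_eqI_PiM_finite[OF I, where A = "\<lambda>_. space (PiM I (\<lambda>_. borel))"])
    fix A :: "'i \<Rightarrow> real set" assume A: "\<And>i. i \<in> I \<Longrightarrow> A i \<in> sets borel"
    \<comment> \<open>The claim asks for Borel sets at all indices, whereas \<open>A\<close> is
      known to be Borel only on \<open>I\<close>; the empty set fills in outside.\<close>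
    define B where "B i = (if i \<in> I then A i else {})" for i
    have B: "B i \<in> sets borel" for i using A by (auto simp: B_def)
    have AB: "Pi\<^sub>E I A = Pi\<^sub>E I B" by (auto simp: B_def PiE_iff)
    show "emeasure (distr M (PiM I (\<lambda>_. borel)) (\<lambda>x. \<lambda>i\<in>I. g i x)) (Pi\<^sub>E I A)
      = emeasure (distr M' (PiM I (\<lambda>_. borel)) (\<lambda>x. \<lambda>i\<in>I. g' i x)) (Pi\<^sub>E I A)"
    proof -
      interpret P: prob_space "distr M (PiM I (\<lambda>_. borel)) (\<lambda>x. \<lambda>i\<in>I. g i x)" by (rule M.prob_space_distr[OF mR(1)])
      interpret P': prob_space "distr M' (PiM I (\<lambda>_. borel)) (\<lambda>x. \<lambda>i\<in>I. g' i x)" by (rule M'.prob_space_distr[OF mR(2)])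
      have "complex_of_real (measure (distr M (PiM I (\<lambda>_. borel)) (\<lambda>x. \<lambda>i\<in>I. g i x)) (Pi\<^sub>E I B))
        = of_real (measure (distr M' (PiM I (\<lambda>_. borel)) (\<lambda>x. \<lambda>i\<in>I. g' i x)) (Pi\<^sub>E I B))"
        by (rule trans[OF _ trans[OF claim[OF I order_refl, of B "\<lambda>_. 0", OF B]]];
            (subst measure_distr_PiM_box[OF _ I _ B, where a = "\<lambda>_. 0"])?) (auto intro: M M' m)
      then show ?thesis unfolding AB by (simp add: P.emeasure_eq_measure P'.emeasure_eq_measure)
    qed
  next
    interpret P: prob_space "distr M (PiM I (\<lambda>_. borel)) (\<lambda>x. \<lambda>i\<in>I. g i x)" by (rule M.prob_space_distr[OF mR(1)])
    show "emeasure (distr M (PiM I (\<lambda>_. borel)) (\<lambda>x. \<lambda>i\<in>I. g i x)) (space (PiM I (\<lambda>_. borel))) \<noteq> \<infinity>" by simp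
    show "range (\<lambda>_. space (PiM I (\<lambda>_. borel))) \<subseteq> prod_algebra I (\<lambda>_. borel)"
      using space_in_prod_algebra[of I "\<lambda>_. borel"] by (auto simp: space_PiM)
  qed auto
qed

subsection \<open>Gaussian families\<close>

text \<open>Scaling a standard normal variable covers the point mass too, with factor 0, so the
  later arguments need no case distinction.\<close>

lemma centered_gaussian_law_scaled_normal:
  assumes "centered_gaussian_law \<mu>"
  obtains \<sigma> where "0 \<le> \<sigma>" "\<mu> = distr std_normal_distribution borel (\<lambda>x. \<sigma> * x)"
proof -
  interpret prob_space std_normal_distribution by (rule prob_space_normal_density) simp
  from assms[unfolded centered_gaussian_law_def] show ?thesis
  proof (elim disjE exE conjE)
    assume "\<mu> = return borel 0"
    moreover have "distr std_normal_distribution borel (\<lambda>x. 0 * x) = return borel (0::real)"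
      using distr_const[of 0 borel] by simp
    ultimately show ?thesis by (intro that[of 0]) auto
  next
    fix \<sigma> assume s: "0 < \<sigma>" "\<mu> = density lborel (\<lambda>x. ennreal (normal_density 0 \<sigma> x))"
    have "distributed std_normal_distribution lborel (\<lambda>x. x) (\<lambda>x. ennreal (std_normal_density x))"
      by (auto simp: distributed_def intro!: measure_eqI simp: emeasure_distr)
    from normal_density_affine[OF this, of \<sigma> 0] s
    have "distr std_normal_distribution lborel (\<lambda>x. \<sigma> * x) = \<mu>"
      by (auto simp: distributed_def)
    moreover have "distr std_normal_distribution lborel (\<lambda>x. \<sigma> * x) = distr std_normal_distribution borel (\<lambda>x. \<sigma> * x)"
      by (rule distr_cong) auto
    ultimately show ?thesis using s by (intro that[of \<sigma>]) auto
  qed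
qed

lemma std_normal_second_moment:
  "integrable std_normal_distribution (\<lambda>x. x\<^sup>2)" "(\<integral>x. x\<^sup>2 \<partial>std_normal_distribution) = 1"
  using std_normal_distribution_even_moments[of 1] by simp_all

text \<open>All facts are read off from a scaled standard normal variable, whose factor is the root
  of the second moment. The Fourier integral is recorded at frequency 1 only, because frequencies
  can be put into the linear combination that plays the role of \<open>Y\<close>.\<close>

lemma centered_gaussian_var:
  assumes "centered_gaussian_law (distr M borel Y)" "Y \<in> borel_measurable M"
  shows "integrable M (\<lambda>x. (Y x)\<^sup>2)" "integrable M Y" "(\<integral>x. Y x \<partial>M) = 0"
    "(\<integral>x. iexp (Y x) \<partial>M) = of_real (exp (- (\<integral>x. (Y x)\<^sup>2 \<partial>M) / 2))"
    "distr M borel Y = distr std_normal_distribution borel (\<lambda>x. sqrt (\<integral>x. (Y x)\<^sup>2 \<partial>M) * x)"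
proof -
  note [measurable] = assms(2)
  obtain \<sigma> where s: "0 \<le> \<sigma>" "distr M borel Y = distr std_normal_distribution borel (\<lambda>x. \<sigma> * x)"
    using centered_gaussian_law_scaled_normal[OF assms(1)] .
  have int: "integrable M (\<lambda>x. h (Y x)) \<longleftrightarrow> integrable std_normal_distribution (\<lambda>x. h (\<sigma> * x))"
    if [measurable]: "h \<in> borel_measurable borel" for h :: "real \<Rightarrow> real"
  proof -
    have "integrable M (\<lambda>x. h (Y x)) \<longleftrightarrow> integrable (distr M borel Y) h" by (subst integrable_distr_eq) auto
    also have "\<dots> \<longleftrightarrow> integrable std_normal_distribution (\<lambda>x. h (\<sigma> * x))"
      unfolding s(2) by (subst integrable_distr_eq) auto
    finally show ?thesis .
  qed
  have tr: "(\<integral>x. h (Y x) \<partial>M) = (\<integral>x. h (\<sigma> * x) \<partial>std_normal_distribution)"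
    if [measurable]: "h \<in> borel_measurable borel" for h :: "real \<Rightarrow> real"
  proof -
    have "(\<integral>x. h (Y x) \<partial>M) = integral\<^sup>L (distr M borel Y) h" by (subst integral_distr) auto
    also have "\<dots> = (\<integral>x. h (\<sigma> * x) \<partial>std_normal_distribution)"
      unfolding s(2) by (subst integral_distr) auto
    finally show ?thesis .
  qed
  have i1: "integrable std_normal_distribution (\<lambda>x. x)" "(\<integral>x. x \<partial>std_normal_distribution) = 0"
    using integrable_std_normal_distribution_moment[of 1] integral_std_normal_distribution_moment_odd[of 1] by simp_all
  have "integrable std_normal_distribution (\<lambda>x. \<sigma>\<^sup>2 * x\<^sup>2)"
    by (intro integrable_mult_right std_normal_second_moment)
  then show "integrable M (\<lambda>x. (Y x)\<^sup>2)"
    by (subst int[of "\<lambda>x. x\<^sup>2"]) (simp_all add: power_mult_distrib)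
  have "integrable std_normal_distribution (\<lambda>x. \<sigma> * x)" by (intro integrable_mult_right i1)
  then show "integrable M Y" by (subst int[of "\<lambda>x. x"]) simp_all
  have "(\<integral>x. \<sigma> * x \<partial>std_normal_distribution) = 0" by (subst Bochner_Integration.integral_mult_right_zero) (simp add: i1)
  then show "(\<integral>x. Y x \<partial>M) = 0" by (subst tr[of "\<lambda>x. x"]) simp_all
  have "(\<integral>x. \<sigma>\<^sup>2 * x\<^sup>2 \<partial>std_normal_distribution) = \<sigma>\<^sup>2"
    by (subst Bochner_Integration.integral_mult_right_zero) (simp add: std_normal_second_moment)
  then have v: "(\<integral>x. (Y x)\<^sup>2 \<partial>M) = \<sigma>\<^sup>2"
    by (subst tr[of "\<lambda>x. x\<^sup>2"]) (simp_all add: power_mult_distrib)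
  have "(\<integral>x. iexp (Y x) \<partial>M) = integral\<^sup>L (distr M borel Y) iexp" by (subst integral_distr) auto
  also have "\<dots> = char std_normal_distribution \<sigma>"
    unfolding s(2) char_def by (subst integral_distr) auto
  finally show "(\<integral>x. iexp (Y x) \<partial>M) = of_real (exp (- (\<integral>x. (Y x)\<^sup>2 \<partial>M) / 2))"
    unfolding v char_std_normal_distribution .
  show "distr M borel Y = distr std_normal_distribution borel (\<lambda>x. sqrt (\<integral>x. (Y x)\<^sup>2 \<partial>M) * x)"
    unfolding v s(2) using s(1) by simp
qed

text \<open>The Cholesky factorization, with a step of Gaussian elimination as the induction step.\<close>

lemma positive_semidefinite_kernel_factor:
  fixes k :: "'t \<Rightarrow> 't \<Rightarrow> real"
  assumes "finite F" "\<And>s t. k s t = k t s"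
    and "\<And>a. 0 \<le> (\<Sum>s\<in>F. \<Sum>t\<in>F. a s * a t * k s t)"
  shows "\<exists>v. \<forall>s\<in>F. \<forall>t\<in>F. (\<Sum>j\<in>F. v s j * v t j) = k s t"
  using assms
proof (induction F arbitrary: k)
  case empty
  then show ?case by simp
next
  case (insert r F)
  have exp: "(\<Sum>s\<in>insert r F. \<Sum>t\<in>insert r F. a s * a t * k s t)
      = a r * a r * k r r + 2 * a r * (\<Sum>s\<in>F. a s * k s r) + (\<Sum>s\<in>F. \<Sum>t\<in>F. a s * a t * k s t)" for a
  proof -
    have "(\<Sum>t\<in>F. a r * a t * k r t) = a r * (\<Sum>s\<in>F. a s * k s r)"
      "(\<Sum>s\<in>F. a s * a r * k s r) = a r * (\<Sum>s\<in>F. a s * k s r)"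
      unfolding sum_distrib_left insert.prems(1)[of r] by (intro sum.cong refl; simp)+
    then show ?thesis using insert.hyps by (simp add: sum.distrib)
  qed
  have psd: "0 \<le> x * x * k r r + 2 * x * (\<Sum>s\<in>F. a s * k s r) + (\<Sum>s\<in>F. \<Sum>t\<in>F. a s * a t * k s t)" for x a
  proof -
    have "(\<Sum>s\<in>F. (a(r := x)) s * k s r) = (\<Sum>s\<in>F. a s * k s r)"
      "(\<Sum>s\<in>F. \<Sum>t\<in>F. (a(r := x)) s * (a(r := x)) t * k s t) = (\<Sum>s\<in>F. \<Sum>t\<in>F. a s * a t * k s t)"
      using insert.hyps by (intro sum.cong; auto)+
    then show ?thesis using insert.prems(2)[of "a(r := x)"] unfolding exp by (simp del: fun_upd_apply) simp
  qed
  have krr: "0 \<le> k r r" using psd[of 1 "\<lambda>_. 0"] by simp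
  \<comment> \<open>A zero pivot forces its row to vanish: otherwise the form would be affine in
    \<open>x\<close> with nonzero slope and take negative values.\<close>
  have zero: "k s r = 0" if "s \<in> F" "k r r = 0" for s
  proof (rule ccontr)
    assume nz: "k s r \<noteq> 0"
    have e: "(\<Sum>t\<in>F. (if t = s then 1 else 0) * k t r) = k s r"
      "(\<Sum>u\<in>F. \<Sum>t\<in>F. (if u = s then 1 else 0) * (if t = s then 1 else 0) * k u t) = k s s"
    proof -
      have "(\<Sum>t\<in>F. (if t = s then 1 else 0) * k t r) = (\<Sum>t\<in>F. if t = s then k s r else 0)"
        by (intro sum.cong) auto
      then show "(\<Sum>t\<in>F. (if t = s then 1 else 0) * k t r) = k s r" using insert.hyps that by simp
      have "(\<Sum>t\<in>F. (if u = s then 1 else 0) * (if t = s then 1 else 0) * k u t) = (if u = s then k s s else 0)" for u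
      proof -
        have "(\<Sum>t\<in>F. (if u = s then 1 else 0) * (if t = s then 1 else 0) * k u t)
            = (\<Sum>t\<in>F. if t = s then (if u = s then k s s else 0) else 0)" by (intro sum.cong) auto
        then show ?thesis using insert.hyps that by simp
      qed
      then show "(\<Sum>u\<in>F. \<Sum>t\<in>F. (if u = s then 1 else 0) * (if t = s then 1 else 0) * k u t) = k s s"
        using insert.hyps that by simp
    qed
    have "0 \<le> 2 * x * k s r + k s s" for x using psd[of x "\<lambda>t. if t = s then 1 else 0"] that unfolding e by simp
    \<comment> \<open>At this point the affine function equals -1.\<close>
    from this[of "- (k s s + 1) / (2 * k s r)"]
    have "0 \<le> - (k s s + 1) / (2 * k s r) * (2 * k s r) + k s s" by (simp only: mult_ac)
    also have "- (k s s + 1) / (2 * k s r) * (2 * k s r) = - (k s s + 1)" using nz by simp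
    finally show False by simp
  qed
  \<comment> \<open>The Schur complement of the pivot. For a zero pivot the quotient is 0 by the
    convention for division, which agrees with the vanishing of the row.\<close>
  define k' where "k' s t = k s t - k s r * k t r / k r r" for s t
  have "\<exists>v. \<forall>s\<in>F. \<forall>t\<in>F. (\<Sum>j\<in>F. v s j * v t j) = k' s t"
  proof (rule insert.IH)
    show "k' s t = k' t s" for s t using insert.prems(1) by (simp add: k'_def)
    fix a
    let ?b = "\<Sum>s\<in>F. a s * k s r"
    have "a s * a t * k' s t = a s * a t * k s t - (a s * k s r) * (a t * k t r) / k r r" for s t
      by (simp add: k'_def right_diff_distrib mult_ac)
    then have split: "(\<Sum>s\<in>F. \<Sum>t\<in>F. a s * a t * k' s t) = (\<Sum>s\<in>F. \<Sum>t\<in>F. a s * a t * k s t) - ?b * ?b / k r r"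
      by (simp only: sum_subtractf sum_divide_distrib[symmetric] sum_product)
    \<comment> \<open>For nonzero \<open>y\<close> this \<open>x\<close> minimizes the quadratic, so
      positivity of the full form passes to the Schur complement; for \<open>y = 0\<close> both
      sides are 0.\<close>
    have "x * x * y + 2 * x * b = - (b * b / y)" if "x = - b / y" for x y b :: real
      unfolding that by (cases "y = 0") (simp_all add: field_simps)
    then show "0 \<le> (\<Sum>s\<in>F. \<Sum>t\<in>F. a s * a t * k' s t)"
      unfolding split using psd[of "- ?b / k r r" a] by (simp only: refl)
  qed
  then obtain v where v: "\<And>s t. s \<in> F \<Longrightarrow> t \<in> F \<Longrightarrow> (\<Sum>j\<in>F. v s j * v t j) = k' s t" by blast
  \<comment> \<open>Column \<open>r\<close> carries the eliminated part, and row \<open>r\<close>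
    has no other entry.\<close>
  define w where "w s j = (if j = r then k s r / sqrt (k r r) else if s = r then 0 else v s j)" for s j
  have "(\<Sum>j\<in>insert r F. w s j * w t j) = k s t" if st: "s \<in> insert r F" "t \<in> insert r F" for s t
  proof -
    have r: "(\<Sum>j\<in>insert r F. w s j * w t j) = k s r * k t r / k r r + (if s = r \<or> t = r then 0 else k' s t)"
    proof -
      have "(\<Sum>j\<in>F. w s j * w t j) = (\<Sum>j\<in>F. if s = r \<or> t = r then 0 else v s j * v t j)"
        using insert.hyps by (intro sum.cong) (auto simp: w_def)
      moreover have "w s r * w t r = k s r * k t r / k r r" using krr by (simp add: w_def)
      ultimately show ?thesis using insert.hyps v st by auto
    qed
    consider "s = r" "t = r" | "s = r" "t \<in> F" | "s \<in> F" "t = r" | "s \<in> F" "t \<in> F" "s \<noteq> r" "t \<noteq> r"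
      using st insert.hyps by auto
    then show ?thesis
    proof cases
      case 1 then show ?thesis unfolding r by (cases "k r r = 0") auto
    next
      case 2 then show ?thesis unfolding r using zero[of t] insert.prems(1)[of r t] by (cases "k r r = 0") auto
    next
      case 3 then show ?thesis unfolding r using zero[of s] by (cases "k r r = 0") auto
    next
      case 4 then show ?thesis unfolding r by (simp add: k'_def)
    qed
  qed
  then show ?case by (intro exI[of _ w] ballI)
qed

lemma integral_iexp_std_normal_PiM:
  assumes "finite I"
  shows "(\<integral>x. iexp (\<Sum>j\<in>I. b j * x j) \<partial>PiM I (\<lambda>_. std_normal_distribution))
    = of_real (exp (- (\<Sum>j\<in>I. (b j)\<^sup>2) / 2))"
proof -
  interpret \<gamma>: prob_space std_normal_distribution by (rule prob_space_normal_density) simp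
  interpret P: product_prob_space "\<lambda>_. std_normal_distribution" ..
  have "(\<integral>x. iexp (\<Sum>j\<in>I. b j * x j) \<partial>PiM I (\<lambda>_. std_normal_distribution))
      = (\<integral>x. (\<Prod>j\<in>I. iexp (b j * x j)) \<partial>PiM I (\<lambda>_. std_normal_distribution))"
    by (simp only: of_real_sum sum_distrib_left exp_sum[OF assms])
  also have "\<dots> = (\<Prod>j\<in>I. \<integral>x. iexp (b j * x) \<partial>std_normal_distribution)"
    using assms by (intro P.product_integral_prod integrable_bounded_complex[where B=1] \<gamma>.finite_measure) auto
  also have "\<dots> = (\<Prod>j\<in>I. of_real (exp (- (b j)\<^sup>2 / 2)))"
  proof (rule prod.cong[OF refl])
    fix j
    show "(\<integral>x. iexp (b j * x) \<partial>std_normal_distribution) = of_real (exp (- (b j)\<^sup>2 / 2))"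
      using fun_cong[OF char_std_normal_distribution, of "b j"] unfolding char_def .
  qed
  also have "\<dots> = of_real (exp (- (\<Sum>j\<in>I. (b j)\<^sup>2) / 2))"
    by (simp only: of_real_prod[symmetric] exp_sum[OF assms, symmetric]) (simp add: sum_negf sum_divide_distrib)
  finally show ?thesis .
qed

lemma square_integrable_mult:
  fixes f g :: "'a \<Rightarrow> real"
  assumes "integrable M (\<lambda>x. (f x)\<^sup>2)" "integrable M (\<lambda>x. (g x)\<^sup>2)"
    and [measurable]: "f \<in> borel_measurable M" "g \<in> borel_measurable M"
  shows "integrable M (\<lambda>x. f x * g x)"
proof (rule Bochner_Integration.integrable_bound)
  show "integrable M (\<lambda>x. (f x)\<^sup>2 + (g x)\<^sup>2)" using assms(1,2) by simp
  show "AE x in M. norm (f x * g x) \<le> norm ((f x)\<^sup>2 + (g x)\<^sup>2)"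
  proof (rule AE_I2)
    fix x
    have "2 * (\<bar>f x\<bar> * \<bar>g x\<bar>) \<le> (f x)\<^sup>2 + (g x)\<^sup>2"
      using sum_squares_bound[of "\<bar>f x\<bar>" "\<bar>g x\<bar>"] by simp
    moreover have "0 \<le> \<bar>f x\<bar> * \<bar>g x\<bar>" by simp
    ultimately have "\<bar>f x\<bar> * \<bar>g x\<bar> \<le> (f x)\<^sup>2 + (g x)\<^sup>2" by linarith
    then show "norm (f x * g x) \<le> norm ((f x)\<^sup>2 + (g x)\<^sup>2)" by (simp add: abs_mult)
  qed
qed measurable

text \<open>The covariance kernel is an inner product of vectors \<open>v t\<close>, so
  \<open>Y\<close> and the linear image of a standard normal vector have equal Fourier integrals: on
  both sides the exponent is minus half the variance of the linear combination.\<close>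

lemma gaussian_family_distr:
  fixes Y :: "'t \<Rightarrow> 'w \<Rightarrow> real"
  assumes M: "prob_space M" and F: "finite F"
    and m: "\<And>t. t \<in> F \<Longrightarrow> Y t \<in> borel_measurable M"
    and g: "\<And>a. centered_gaussian_law (distr M borel (\<lambda>\<omega>. \<Sum>t\<in>F. a t * Y t \<omega>))"
  obtains v :: "'t \<Rightarrow> 't \<Rightarrow> real" where
    "\<And>t. t \<in> F \<Longrightarrow> (\<Sum>j\<in>F. (v t j)\<^sup>2) = (\<integral>\<omega>. (Y t \<omega>)\<^sup>2 \<partial>M)"
    "distr M (PiM F (\<lambda>_. borel)) (\<lambda>\<omega>. \<lambda>t\<in>F. Y t \<omega>)
      = distr (PiM F (\<lambda>_. std_normal_distribution)) (PiM F (\<lambda>_. borel)) (\<lambda>x. \<lambda>t\<in>F. \<Sum>j\<in>F. v t j * x j)"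
proof -
  interpret prob_space M by fact
  note m[measurable]
  have sq: "integrable M (\<lambda>\<omega>. (Y t \<omega>)\<^sup>2)" if "t \<in> F" for t
  proof -
    have "(\<Sum>s\<in>F. (if s = t then 1 else 0) * Y s \<omega>) = Y t \<omega>" for \<omega>
    proof -
      have "(\<Sum>s\<in>F. (if s = t then 1 else 0) * Y s \<omega>) = (\<Sum>s\<in>F. if s = t then Y t \<omega> else 0)"
        by (intro sum.cong) auto
      then show ?thesis using F that by simp
    qed
    then show ?thesis using centered_gaussian_var(1)[OF g[of "\<lambda>s. if s = t then 1 else 0"]] m that by simp
  qed
  have pr: "integrable M (\<lambda>\<omega>. Y s \<omega> * Y t \<omega>)" if "s \<in> F" "t \<in> F" for s t
    using that by (intro square_integrable_mult sq m)
  define k where "k s t = (\<integral>\<omega>. Y s \<omega> * Y t \<omega> \<partial>M)" for s t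
  have quad: "(\<Sum>s\<in>F. \<Sum>t\<in>F. a s * a t * k s t) = (\<integral>\<omega>. (\<Sum>t\<in>F. a t * Y t \<omega>)\<^sup>2 \<partial>M)" for a
  proof -
    have "(\<Sum>t\<in>F. a t * Y t \<omega>)\<^sup>2 = (\<Sum>s\<in>F. \<Sum>t\<in>F. a s * a t * (Y s \<omega> * Y t \<omega>))" for \<omega>
      by (simp add: power2_eq_square sum_product mult_ac)
    then have "(\<integral>\<omega>. (\<Sum>t\<in>F. a t * Y t \<omega>)\<^sup>2 \<partial>M) = (\<integral>\<omega>. (\<Sum>s\<in>F. \<Sum>t\<in>F. a s * a t * (Y s \<omega> * Y t \<omega>)) \<partial>M)"
      by simp
    also have "\<dots> = (\<Sum>s\<in>F. \<Sum>t\<in>F. a s * a t * k s t)"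
    proof -
      have i: "integrable M (\<lambda>\<omega>. a s * a t * (Y s \<omega> * Y t \<omega>))" if "s \<in> F" "t \<in> F" for s t
        using pr[OF that] by (rule integrable_mult_right)
      have "(\<integral>\<omega>. (\<Sum>s\<in>F. \<Sum>t\<in>F. a s * a t * (Y s \<omega> * Y t \<omega>)) \<partial>M)
          = (\<Sum>s\<in>F. \<integral>\<omega>. (\<Sum>t\<in>F. a s * a t * (Y s \<omega> * Y t \<omega>)) \<partial>M)"
        using i by (intro Bochner_Integration.integral_sum Bochner_Integration.integrable_sum)
      also have "\<dots> = (\<Sum>s\<in>F. \<Sum>t\<in>F. \<integral>\<omega>. a s * a t * (Y s \<omega> * Y t \<omega>) \<partial>M)"
        using i by (intro sum.cong refl Bochner_Integration.integral_sum)
      finally show ?thesis by (simp add: k_def)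
    qed
    finally show ?thesis by simp
  qed
  have "\<exists>v. \<forall>s\<in>F. \<forall>t\<in>F. (\<Sum>j\<in>F. v s j * v t j) = k s t"
  proof (rule positive_semidefinite_kernel_factor[OF F])
    show "k s t = k t s" for s t unfolding k_def by (simp only: mult.commute)
    show "0 \<le> (\<Sum>s\<in>F. \<Sum>t\<in>F. a s * a t * k s t)" for a unfolding quad by (rule integral_nonneg_AE) simp
  qed
  then obtain v where v: "\<And>s t. s \<in> F \<Longrightarrow> t \<in> F \<Longrightarrow> (\<Sum>j\<in>F. v s j * v t j) = k s t" by blast
  show thesis
  proof (rule that[of v])
    show "(\<Sum>j\<in>F. (v t j)\<^sup>2) = (\<integral>\<omega>. (Y t \<omega>)\<^sup>2 \<partial>M)" if "t \<in> F" for t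
      using v[OF that that] by (simp add: k_def power2_eq_square)
    show "distr M (PiM F (\<lambda>_. borel)) (\<lambda>\<omega>. \<lambda>t\<in>F. Y t \<omega>)
      = distr (PiM F (\<lambda>_. std_normal_distribution)) (PiM F (\<lambda>_. borel)) (\<lambda>x. \<lambda>t\<in>F. \<Sum>j\<in>F. v t j * x j)"
    proof (rule distr_PiM_eq_char[OF M _ F])
      show "prob_space (PiM F (\<lambda>_. std_normal_distribution))"
        by (intro prob_space_PiM prob_space_normal_density) simp
      fix a
      have "(\<integral>x. iexp (\<Sum>t\<in>F. a t * (\<Sum>j\<in>F. v t j * x j)) \<partial>PiM F (\<lambda>_. std_normal_distribution))
          = (\<integral>x. iexp (\<Sum>j\<in>F. (\<Sum>t\<in>F. a t * v t j) * x j) \<partial>PiM F (\<lambda>_. std_normal_distribution))"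
      proof -
        have "(\<Sum>t\<in>F. a t * (\<Sum>j\<in>F. v t j * x j)) = (\<Sum>j\<in>F. (\<Sum>t\<in>F. a t * v t j) * x j)" for x
          by (simp only: sum_distrib_left sum_distrib_right mult.assoc) (rule sum.swap)
        then show ?thesis by (simp only:)
      qed
      also have "\<dots> = of_real (exp (- (\<Sum>j\<in>F. (\<Sum>t\<in>F. a t * v t j)\<^sup>2) / 2))"
        by (rule integral_iexp_std_normal_PiM[OF F])
      also have "(\<Sum>j\<in>F. (\<Sum>t\<in>F. a t * v t j)\<^sup>2) = (\<Sum>s\<in>F. \<Sum>t\<in>F. a s * a t * k s t)"
      proof -
        have "(\<Sum>j\<in>F. (\<Sum>t\<in>F. a t * v t j)\<^sup>2) = (\<Sum>j\<in>F. \<Sum>s\<in>F. \<Sum>t\<in>F. a s * a t * (v s j * v t j))"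
          by (simp add: power2_eq_square sum_product mult_ac)
        also have "\<dots> = (\<Sum>s\<in>F. \<Sum>j\<in>F. \<Sum>t\<in>F. a s * a t * (v s j * v t j))" by (rule sum.swap)
        also have "\<dots> = (\<Sum>s\<in>F. \<Sum>t\<in>F. \<Sum>j\<in>F. a s * a t * (v s j * v t j))"
          by (rule sum.cong[OF refl], rule sum.swap)
        also have "\<dots> = (\<Sum>s\<in>F. \<Sum>t\<in>F. a s * a t * k s t)"
          by (intro sum.cong refl) (simp add: sum_distrib_left[symmetric] v)
        finally show ?thesis .
      qed
      also have "of_real (exp (- \<dots> / 2)) = (\<integral>\<omega>. iexp (\<Sum>t\<in>F. a t * Y t \<omega>) \<partial>M)"
        unfolding quad by (subst centered_gaussian_var(4)[OF g]) (auto intro!: borel_measurable_sum m)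
      finally show "(\<integral>\<omega>. iexp (\<Sum>t\<in>F. a t * Y t \<omega>) \<partial>M)
        = (\<integral>x. iexp (\<Sum>t\<in>F. a t * (\<Sum>j\<in>F. v t j * x j)) \<partial>PiM F (\<lambda>_. std_normal_distribution))" by simp
    qed (auto intro!: m borel_measurable_sum borel_measurable_times)
  qed
qed

section \<open>Maxima of finitely many Gaussian variables\<close>

lemma Max_Lipschitz:
  fixes f g :: "'t \<Rightarrow> real"
  assumes "finite F" "F \<noteq> {}" "\<And>t. t \<in> F \<Longrightarrow> \<bar>f t - g t\<bar> \<le> c"
  shows "\<bar>Max (f ` F) - Max (g ` F)\<bar> \<le> c"
proof -
  have *: "Max (f ` F) \<le> Max (g ` F) + c" if "\<And>t. t \<in> F \<Longrightarrow> f t \<le> g t + c" for f g :: "'t \<Rightarrow> real"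
  proof (subst Max_le_iff)
    show "\<forall>a\<in>f ` F. a \<le> Max (g ` F) + c"
      using that assms(1) by (auto intro!: order_trans[OF that] Max_ge)
  qed (use assms in auto)
  have "f t \<le> g t + c" "g t \<le> f t + c" if "t \<in> F" for t using assms(3)[OF that] by linarith+
  from *[of f g, OF this(1)] *[of g f, OF this(2)] show ?thesis by linarith
qed

lemma gaussian_max_mgf:
  fixes Y :: "'t \<Rightarrow> 'w \<Rightarrow> real"
  assumes M: "prob_space M" and F: "finite F" "F \<noteq> {}"
    and m: "\<And>t. t \<in> F \<Longrightarrow> Y t \<in> borel_measurable M"
    and g: "\<And>a. centered_gaussian_law (distr M borel (\<lambda>\<omega>. \<Sum>t\<in>F. a t * Y t \<omega>))"
    and var: "\<And>t. t \<in> F \<Longrightarrow> (\<integral>\<omega>. (Y t \<omega>)\<^sup>2 \<partial>M) \<le> \<sigma>\<^sup>2" and \<sigma>: "0 \<le> \<sigma>"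
    and med: "1/2 \<le> measure M {\<omega> \<in> space M. \<forall>t\<in>F. Y t \<omega> \<le> k}" and c: "0 \<le> c"
  shows "(\<integral>\<^sup>+\<omega>. ennreal (exp (c * Max ((\<lambda>t. Y t \<omega>) ` F))) \<partial>M)
    \<le> ennreal (exp (c\<^sup>2 * \<sigma>\<^sup>2 / 2 + c * (k + \<sigma>\<^sup>2 / 2 + ln 2)))"
proof -
  interpret prob_space M by fact
  note m[measurable] F(1)[simp]
  obtain v where v: "\<And>t. t \<in> F \<Longrightarrow> (\<Sum>j\<in>F. (v t j)\<^sup>2) = (\<integral>\<omega>. (Y t \<omega>)\<^sup>2 \<partial>M)"
    and law: "distr M (PiM F (\<lambda>_. borel)) (\<lambda>\<omega>. \<lambda>t\<in>F. Y t \<omega>)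
      = distr (PiM F (\<lambda>_. std_normal_distribution)) (PiM F (\<lambda>_. borel)) (\<lambda>x. \<lambda>t\<in>F. \<Sum>j\<in>F. v t j * x j)"
    using gaussian_family_distr[OF M F(1) m g] by blast
  let ?P = "PiM F (\<lambda>_. std_normal_distribution)"
  define G where "G x = Max ((\<lambda>t. \<Sum>j\<in>F. v t j * x j) ` F)" for x :: "'t \<Rightarrow> real"
  define \<Phi> where "\<Phi> y = Max (y ` F)" for y :: "'t \<Rightarrow> real"
  have \<Phi>[measurable]: "\<Phi> \<in> borel_measurable (PiM F (\<lambda>_. borel))"
    unfolding \<Phi>_def using borel_measurable_Max[of F "\<lambda>t y. y t" "PiM F (\<lambda>_. borel)"] by simp
  have lin[measurable]: "(\<lambda>x. \<lambda>t\<in>F. \<Sum>j\<in>F. v t j * x j) \<in> measurable ?P (PiM F (\<lambda>_. borel))"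
    by (auto intro!: measurable_restrict borel_measurable_sum borel_measurable_times)
  have Ym[measurable]: "(\<lambda>\<omega>. \<lambda>t\<in>F. Y t \<omega>) \<in> measurable M (PiM F (\<lambda>_. borel))" by measurable
  have \<Phi>G: "\<Phi> (\<lambda>t\<in>F. \<Sum>j\<in>F. v t j * x j) = G x" for x
    unfolding \<Phi>_def G_def by (intro arg_cong[where f=Max] image_cong) auto
  have \<Phi>Y: "\<Phi> (\<lambda>t\<in>F. Y t \<omega>) = Max ((\<lambda>t. Y t \<omega>) ` F)" for \<omega>
    unfolding \<Phi>_def by (intro arg_cong[where f=Max] image_cong) auto
  have Gm[measurable]: "G \<in> borel_measurable ?P"
    using measurable_compose[OF lin \<Phi>] by (simp add: \<Phi>G)
  \<comment> \<open>The quantile hypothesis and the exponential moment are both integrals of a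
    function of the maximum, so one transfer to the standard normal vector serves for both.\<close>
  have transfer: "(\<integral>\<^sup>+\<omega>. h (Max ((\<lambda>t. Y t \<omega>) ` F)) \<partial>M) = (\<integral>\<^sup>+x. h (G x) \<partial>?P)"
    if [measurable]: "h \<in> borel_measurable borel" for h :: "real \<Rightarrow> ennreal"
  proof -
    have "(\<integral>\<^sup>+\<omega>. h (Max ((\<lambda>t. Y t \<omega>) ` F)) \<partial>M)
        = (\<integral>\<^sup>+y. h (\<Phi> y) \<partial>distr M (PiM F (\<lambda>_. borel)) (\<lambda>\<omega>. \<lambda>t\<in>F. Y t \<omega>))"
      by (subst nn_integral_distr) (auto simp: \<Phi>Y)
    also have "\<dots> = (\<integral>\<^sup>+x. h (G x) \<partial>?P)"
      unfolding law by (subst nn_integral_distr) (auto simp: \<Phi>G)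
    finally show ?thesis .
  qed
  show ?thesis
  proof (subst transfer, simp, rule gaussian_concentration_Lipschitz[OF F(1) Gm _ _ c])
    fix x y :: "'t \<Rightarrow> real"
    show "\<bar>G x - G y\<bar> \<le> \<sigma> * sqrt (\<Sum>i\<in>F. (x i - y i)\<^sup>2)"
      unfolding G_def
    proof (rule Max_Lipschitz[OF F])
      fix t assume t: "t \<in> F"
      have "\<bar>(\<Sum>j\<in>F. v t j * x j) - (\<Sum>j\<in>F. v t j * y j)\<bar> = \<bar>\<Sum>j\<in>F. v t j * (x j - y j)\<bar>"
        by (simp add: sum_subtractf right_diff_distrib)
      also have "\<dots> \<le> (\<Sum>j\<in>F. \<bar>v t j\<bar> * \<bar>x j - y j\<bar>)"
        by (rule order_trans[OF sum_abs]) (simp add: abs_mult)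
      also have "\<dots> \<le> L2_set (v t) F * L2_set (\<lambda>j. x j - y j) F" by (rule L2_set_mult_ineq)
      also have "\<dots> \<le> \<sigma> * L2_set (\<lambda>j. x j - y j) F"
      proof (intro mult_right_mono L2_set_nonneg)
        show "L2_set (v t) F \<le> \<sigma>" unfolding L2_set_def v[OF t]
          using var[OF t] \<sigma> by (simp add: real_le_lsqrt)
      qed
      finally show "\<bar>(\<Sum>j\<in>F. v t j * x j) - (\<Sum>j\<in>F. v t j * y j)\<bar> \<le> \<sigma> * sqrt (\<Sum>i\<in>F. (x i - y i)\<^sup>2)"
        by (simp add: L2_set_def)
    qed
  next
    interpret P: prob_space ?P by (intro prob_space_PiM prob_space_normal_density) simp
    let ?S = "{\<omega> \<in> space M. \<forall>t\<in>F. Y t \<omega> \<le> k}" and ?S' = "{x \<in> space ?P. G x \<le> k}"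
    have "?S \<in> sets M" by measurable
    then have "emeasure M ?S = (\<integral>\<^sup>+\<omega>. indicator ?S \<omega> \<partial>M)" by (rule nn_integral_indicator[symmetric])
    also have "\<dots> = (\<integral>\<^sup>+\<omega>. indicator {..k} (Max ((\<lambda>t. Y t \<omega>) ` F)) \<partial>M)"
      using F by (intro nn_integral_cong) (simp add: indicator_def Max_le_iff)
    also have "\<dots> = (\<integral>\<^sup>+x. indicator {..k} (G x) \<partial>?P)" by (rule transfer) simp
    also have "\<dots> = (\<integral>\<^sup>+x. indicator ?S' x \<partial>?P)" by (intro nn_integral_cong) (simp add: indicator_def)
    also have "\<dots> = emeasure ?P ?S'" by (intro nn_integral_indicator) measurable
    finally show "1/2 \<le> measure ?P {x \<in> space ?P. G x \<le> k}"
      using med by (simp add: emeasure_eq_measure P.emeasure_eq_measure)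
  qed
qed

subsection \<open>Square roots of positive semidefinite matrices\<close>

lemma symmetric_matrix_inner:
  fixes A :: "real^'d^'d"
  assumes "transpose A = A"
  shows "(A *v x) \<bullet> y = x \<bullet> (A *v y)"
  using assms by (metis dot_lmul_matrix transpose_matrix_vector)

lemma transpose_eq_self_iff:
  fixes A :: "real^'d^'d"
  shows "transpose A = A \<longleftrightarrow> (\<forall>x y. (A *v x) \<bullet> y = x \<bullet> (A *v y))"
proof
  assume *: "\<forall>x y. (A *v x) \<bullet> y = x \<bullet> (A *v y)"
  have "transpose A *v x = A *v x" for x
  proof -
    have "(transpose A *v x) \<bullet> y = (A *v x) \<bullet> y" for y
      using * by (metis dot_lmul_matrix transpose_matrix_vector)
    then show ?thesis using vector_eq_rdot by blast
  qed
  then show "transpose A = A" by (simp add: matrix_eq)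
qed (simp add: symmetric_matrix_inner)

text \<open>At a zero \<open>v\<close> a semidefinite form is minimal, so its gradient, a multiple
  of \<open>B *v v\<close>, vanishes. The invariant subspace \<open>V\<close> makes this usable on
  orthogonal complements of eigenvectors.\<close>

lemma semidefinite_form_zero:
  fixes B :: "real^'d^'d"
  assumes sym: "transpose B = B" and V: "subspace V" "\<And>x. x \<in> V \<Longrightarrow> B *v x \<in> V"
    and psd: "\<And>x. x \<in> V \<Longrightarrow> 0 \<le> (B *v x) \<bullet> x" and v: "v \<in> V" "(B *v v) \<bullet> v = 0"
  shows "B *v v = 0"
proof (rule ccontr)
  assume nz: "B *v v \<noteq> 0"
  define y where "y = B *v v"
  define q where "q = y \<bullet> y"
  define c where "c = (B *v y) \<bullet> y"
  have y: "y \<in> V" using V(2) v(1) by (simp add: y_def)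
  have q: "0 < q" using nz by (simp add: q_def y_def)
  have c: "0 \<le> c" using psd[OF y] by (simp add: c_def)
  \<comment> \<open>The step \<open>- q / d\<close> along the gradient gives the value
    \<open>(q\<^sup>2 / d) * (c / d - 2)\<close>. The summand 1 keeps \<open>d\<close> positive when
    \<open>c = 0\<close>, and \<open>c / d \<le> 1\<close> makes the value negative.\<close>
  define d where "d = c + 1"
  have d: "0 < d" "c \<le> d" using c by (auto simp: d_def)
  define t where "t = - q / d"
  have "v + t *\<^sub>R y \<in> V" using V(1) v(1) y by (simp add: subspace_add subspace_scale)
  then have "0 \<le> (B *v (v + t *\<^sub>R y)) \<bullet> (v + t *\<^sub>R y)" by (rule psd)
  also have "\<dots> = (B *v v) \<bullet> v + t * ((B *v v) \<bullet> y) + t * ((B *v y) \<bullet> v) + t * t * ((B *v y) \<bullet> y)"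
    by (simp add: matrix_vector_right_distrib matrix_vector_mult_scaleR inner_add_left inner_add_right algebra_simps)
  also have "(B *v y) \<bullet> v = y \<bullet> y" using symmetric_matrix_inner[OF sym, of y v] by (simp add: y_def)
  finally have "0 \<le> 2 * t * q + t * t * c" using v(2) by (simp add: q_def c_def y_def[symmetric])
  also have "\<dots> = (q\<^sup>2 / d) * (c / d - 2)"
    using d by (simp add: t_def power2_eq_square field_simps)
  also have "\<dots> < 0"
  proof (rule mult_pos_neg)
    have "c / d \<le> 1" using d by simp
    then show "c / d - 2 < 0" by linarith
  qed (use q d in auto)
  finally show False by simp
qed

text \<open>Let \<open>v\<close> maximize the form on the unit sphere of \<open>V\<close>, with
  maximum \<open>l\<close>. Then \<open>l *\<^sub>R mat 1 - A\<close> is semidefinite on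
  \<open>V\<close> with a zero at \<open>v\<close>, so \<open>v\<close> lies in its kernel.\<close>

lemma symmetric_matrix_eigenvector:
  fixes A :: "real^'d^'d"
  assumes sym: "transpose A = A" and V: "subspace V" "\<And>x. x \<in> V \<Longrightarrow> A *v x \<in> V" "V \<noteq> {0}"
  obtains v l where "v \<in> V" "norm v = 1" "A *v v = l *\<^sub>R v"
proof -
  obtain w where w: "w \<in> V" "w \<noteq> 0" using V(1,3) subspace_0 by blast
  have "compact (V \<inter> sphere 0 1)" using V(1) by (intro closed_Int_compact closed_subspace compact_sphere)
  moreover have "(1 / norm w) *\<^sub>R w \<in> V \<inter> sphere 0 1" using w V(1) by (simp add: subspace_scale)
  moreover have "continuous_on (V \<inter> sphere 0 1) (\<lambda>x. (A *v x) \<bullet> x)"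
    by (intro continuous_intros matrix_vector_mult_linear_continuous_on)
  ultimately obtain v where v: "v \<in> V \<inter> sphere 0 1"
    and max: "\<And>x. x \<in> V \<inter> sphere 0 1 \<Longrightarrow> (A *v x) \<bullet> x \<le> (A *v v) \<bullet> v"
    using continuous_attains_sup[of "V \<inter> sphere 0 1" "\<lambda>x. (A *v x) \<bullet> x"] by blast
  define l where "l = (A *v v) \<bullet> v"
  define B where "B = l *\<^sub>R mat 1 - A"
  have Bv: "B *v x = l *\<^sub>R x - A *v x" for x
    by (simp add: B_def matrix_vector_mult_diff_rdistrib scaleR_matrix_vector_assoc[symmetric])
  have "B *v v = 0"
  proof (rule semidefinite_form_zero[where V = V])
    show "transpose B = B"
      unfolding transpose_eq_self_iff Bv using symmetric_matrix_inner[OF sym]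
      by (simp add: inner_diff_left inner_diff_right)
    show "B *v x \<in> V" if "x \<in> V" for x using that V unfolding Bv by (simp add: subspace_diff subspace_scale)
    show "0 \<le> (B *v x) \<bullet> x" if x: "x \<in> V" for x
    proof (cases "x = 0")
      case False
      define z where "z = (1 / norm x) *\<^sub>R x"
      have z: "z \<in> V \<inter> sphere 0 1" using x False V(1) by (simp add: z_def subspace_scale)
      have xz: "x = norm x *\<^sub>R z" using False by (simp add: z_def)
      have "(A *v x) \<bullet> x = norm x * norm x * ((A *v z) \<bullet> z)"
        by (subst (1 2) xz) (simp add: matrix_vector_mult_scaleR)
      also have "\<dots> \<le> norm x * norm x * l" using max[OF z] by (intro mult_left_mono) (auto simp: l_def)
      also have "norm x * norm x = x \<bullet> x" by (simp add: norm_eq_sqrt_inner)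
      finally show ?thesis by (simp add: Bv inner_diff_left mult.commute)
    qed simp
    show "(B *v v) \<bullet> v = 0" using v by (simp add: Bv inner_diff_left l_def dot_square_norm)
  qed (use v V in auto)
  then have "A *v v = l *\<^sub>R v" by (simp add: Bv)
  then show thesis using v that by auto
qed

text \<open>Spanning is encoded by the expansion formula, which gives the coordinates at once;
  orthonormality is stated by inner products so that double sums collapse.\<close>

definition orthonormal_eigenbasis :: "real^'d^'d \<Rightarrow> (real^'d) set \<Rightarrow> (real^'d \<Rightarrow> real) \<Rightarrow> bool" where
  "orthonormal_eigenbasis A B l \<longleftrightarrow> finite B \<and> (\<forall>b\<in>B. A *v b = l b *\<^sub>R b) \<and>
    (\<forall>x. x = (\<Sum>b\<in>B. (b \<bullet> x) *\<^sub>R b)) \<and> (\<forall>b\<in>B. \<forall>c\<in>B. b \<bullet> c = (if b = c then 1 else 0))"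

lemma orthonormal_eigenbasisD:
  assumes "orthonormal_eigenbasis A B l"
  shows "finite B" "\<And>b. b \<in> B \<Longrightarrow> A *v b = l b *\<^sub>R b" "\<And>b. b \<in> B \<Longrightarrow> b \<bullet> b = 1"
    "\<And>x. x = (\<Sum>b\<in>B. (b \<bullet> x) *\<^sub>R b)" "\<And>b c. b \<in> B \<Longrightarrow> c \<in> B \<Longrightarrow> b \<bullet> c = (if b = c then 1 else 0)"
proof -
  note * = assms[unfolded orthonormal_eigenbasis_def, THEN conjunct1]
    assms[unfolded orthonormal_eigenbasis_def, THEN conjunct2, THEN conjunct1]
    assms[unfolded orthonormal_eigenbasis_def, THEN conjunct2, THEN conjunct2, THEN conjunct1]
    assms[unfolded orthonormal_eigenbasis_def, THEN conjunct2, THEN conjunct2, THEN conjunct2]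
  show "finite B" by (rule *(1))
  show "\<And>b. b \<in> B \<Longrightarrow> A *v b = l b *\<^sub>R b" using *(2) by blast
  show on: "\<And>b c. b \<in> B \<Longrightarrow> c \<in> B \<Longrightarrow> b \<bullet> c = (if b = c then 1 else 0)" using *(4) by blast
  show "\<And>b. b \<in> B \<Longrightarrow> b \<bullet> b = 1" by (simp add: on)
  show "\<And>x. x = (\<Sum>b\<in>B. (b \<bullet> x) *\<^sub>R b)" by (rule *(3)[THEN spec])
qed

text \<open>An orthonormal set of eigenvectors of maximal size must span: its orthogonal complement
  is invariant under \<open>A\<close>, so if nonzero it would contain a further eigenvector.\<close>

lemma symmetric_matrix_eigenbasis:
  fixes A :: "real^'d^'d"
  assumes sym: "transpose A = A"
  obtains B l where "orthonormal_eigenbasis A B l"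
proof -
  define P where "P B \<longleftrightarrow> pairwise orthogonal B \<and> (\<forall>b\<in>B. norm b = 1 \<and> (\<exists>l. A *v b = l *\<^sub>R b))" for B :: "(real^'d) set"
  have fin: "finite B \<and> card B \<le> DIM(real^'d)" if "P B" for B
  proof -
    have "independent B" using that by (intro pairwise_orthogonal_independent) (auto simp: P_def)
    then show ?thesis using independent_bound[of B] by auto
  qed
  have "\<exists>B. P B \<and> (\<forall>C. P C \<longrightarrow> card C \<le> card B)"
    by (rule ex_has_greatest_nat[where b = "DIM(real^'d) + 1" and k = "{}"]) (use fin in \<open>auto simp: P_def less_Suc_eq_le\<close>)
  then obtain B where B: "P B" "\<And>C. P C \<Longrightarrow> card C \<le> card B" by blast
  have on: "b \<bullet> c = (if b = c then 1 else 0)" if "b \<in> B" "c \<in> B" for b c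
    using B(1) that by (auto simp: P_def pairwise_def orthogonal_def dot_square_norm)
  define V where "V = {x. \<forall>b\<in>B. b \<bullet> x = 0}"
  have sV: "subspace V" by (auto simp: V_def subspace_def inner_add_right)
  have "V = {0}"
  proof (rule ccontr)
    assume ne: "V \<noteq> {0}"
    have inv: "A *v x \<in> V" if "x \<in> V" for x
    proof -
      have "b \<bullet> (A *v x) = 0" if b: "b \<in> B" for b
      proof -
        obtain l where "A *v b = l *\<^sub>R b" using B(1) b by (auto simp: P_def)
        then show ?thesis using symmetric_matrix_inner[OF sym, of b x] \<open>x \<in> V\<close> b by (simp add: V_def)
      qed
      then show ?thesis by (simp add: V_def)
    qed
    obtain v l where v: "v \<in> V" "norm v = 1" "A *v v = l *\<^sub>R v"
      using symmetric_matrix_eigenvector[OF sym sV inv ne] .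
    have "v \<notin> B"
    proof
      assume "v \<in> B" then have "v \<bullet> v = 0" using v(1) by (auto simp: V_def)
      then show False using v(2) by simp
    qed
    moreover have "P (insert v B)"
      using B(1) v by (auto simp: P_def pairwise_insert orthogonal_def V_def inner_commute)
    ultimately show False using B(2)[of "insert v B"] fin[OF B(1)] by simp
  qed
  have exp: "x = (\<Sum>b\<in>B. (b \<bullet> x) *\<^sub>R b)" for x
  proof -
    have "x - (\<Sum>b\<in>B. (b \<bullet> x) *\<^sub>R b) \<in> V"
    proof -
      have "c \<bullet> (\<Sum>b\<in>B. (b \<bullet> x) *\<^sub>R b) = c \<bullet> x" if c: "c \<in> B" for c
      proof -
        have "c \<bullet> (\<Sum>b\<in>B. (b \<bullet> x) *\<^sub>R b) = (\<Sum>b\<in>B. if b = c then c \<bullet> x else 0)"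
          unfolding inner_sum_right by (intro sum.cong refl) (use on c in auto)
        then show ?thesis using c fin[OF B(1)] by simp
      qed
      then show ?thesis by (simp add: V_def inner_diff_right)
    qed
    then show ?thesis using \<open>V = {0}\<close> by simp
  qed
  have "\<exists>l. \<forall>b\<in>B. A *v b = l b *\<^sub>R b" using B(1) unfolding P_def by (intro bchoice) auto
  then obtain l where "\<And>b. b \<in> B \<Longrightarrow> A *v b = l b *\<^sub>R b" by blast
  then have "orthonormal_eigenbasis A B l"
    unfolding orthonormal_eigenbasis_def using fin[OF B(1)] on by (intro conjI ballI allI exp) simp_all
  then show thesis by (rule that)
qed

lemma matrix_vector_mult_sum_right:
  fixes A :: "real^'d^'d"
  shows "A *v (\<Sum>b\<in>B. f b) = (\<Sum>b\<in>B. A *v f b)"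
  by (rule linear_sum[OF matrix_vector_mul_linear])

lemma psd_matrix_sqrt_exists:
  fixes R :: "real^'d^'d"
  assumes R: "psd_matrix R"
  shows "\<exists>S. psd_matrix S \<and> S ** S = R"
proof -
  have symR: "transpose R = R" using R by (simp add: psd_matrix_def)
  obtain B l where "orthonormal_eigenbasis R B l"
    using symmetric_matrix_eigenbasis[OF symR] .
  note B = orthonormal_eigenbasisD[OF this]
  have l: "0 \<le> l b" if "b \<in> B" for b
  proof -
    have "0 \<le> (R *v b) \<bullet> b" using R by (simp add: psd_matrix_def)
    then show ?thesis using that B(2,3) by simp
  qed
  define S where "S = matrix (\<lambda>x. \<Sum>b\<in>B. (sqrt (l b) * (b \<bullet> x)) *\<^sub>R b)"
  have "linear (\<lambda>x. \<Sum>b\<in>B. (sqrt (l b) * (b \<bullet> x)) *\<^sub>R b)"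
    by (intro linearI) (simp_all add: inner_add_right scaleR_left_distrib distrib_left sum.distrib scaleR_sum_right mult_ac)
  then have S: "S *v x = (\<Sum>b\<in>B. (sqrt (l b) * (b \<bullet> x)) *\<^sub>R b)" for x
    unfolding S_def by (intro matrix_works) (simp add: linear_def scalar_mult_eq_scaleR[abs_def])
  have form: "(S *v x) \<bullet> y = (\<Sum>b\<in>B. sqrt (l b) * (b \<bullet> x) * (b \<bullet> y))" for x y
    by (simp add: S inner_sum_left)
  have "transpose S = S"
    unfolding transpose_eq_self_iff by (simp add: form inner_commute[of _ "S *v _"] mult_ac)
  moreover have "0 \<le> (S *v x) \<bullet> x" for x
    unfolding form by (intro sum_nonneg) (simp add: l mult.assoc)
  moreover have "S ** S = R"
  proof -
    have "(S ** S) *v x = R *v x" for x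
    proof -
      have Sb: "S *v b = sqrt (l b) *\<^sub>R b" if "b \<in> B" for b
      proof -
        have "S *v b = (\<Sum>c\<in>B. if c = b then sqrt (l b) *\<^sub>R b else 0)"
          unfolding S by (intro sum.cong refl) (use B(5) that in auto)
        then show ?thesis using that B(1) by simp
      qed
      have "(S ** S) *v x = (\<Sum>b\<in>B. (b \<bullet> x) *\<^sub>R (S *v (S *v b)))"
        by (subst B(4)[of x]) (simp add: matrix_vector_mul_assoc[symmetric] matrix_vector_mult_sum_right matrix_vector_mult_scaleR)
      also have "\<dots> = (\<Sum>b\<in>B. (b \<bullet> x) *\<^sub>R (R *v b))"
        by (intro sum.cong refl) (simp add: Sb matrix_vector_mult_scaleR B(2) l)
      also have "\<dots> = R *v x"
        by (subst (2) B(4)[of x]) (simp add: matrix_vector_mult_sum_right matrix_vector_mult_scaleR)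
      finally show ?thesis .
    qed
    then show ?thesis by (simp add: matrix_eq)
  qed
  ultimately show ?thesis by (auto simp: psd_matrix_def)
qed

text \<open>Let \<open>b\<close> be an eigenvector of \<open>S - Q\<close> with nonzero eigenvalue.
  Equal squares give \<open>S *v b\<close> and \<open>Q *v b\<close> the same norm, so their
  difference, a multiple of \<open>b\<close>, is orthogonal to their sum. Both forms being
  nonnegative, each vanishes at \<open>b\<close>, and then so do the two vectors.\<close>

lemma psd_matrix_sqrt_unique:
  fixes S Q :: "real^'d^'d"
  assumes S: "psd_matrix S" and Q: "psd_matrix Q" and eq: "S ** S = Q ** Q"
  shows "S = Q"
proof -
  have symS: "transpose S = S" and symQ: "transpose Q = Q" using S Q by (auto simp: psd_matrix_def)
  have symD: "transpose (S - Q) = S - Q"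
    unfolding transpose_eq_self_iff matrix_vector_mult_diff_rdistrib
    by (simp add: inner_diff_left inner_diff_right symmetric_matrix_inner symS symQ)
  obtain B l where "orthonormal_eigenbasis (S - Q) B l"
    using symmetric_matrix_eigenbasis[OF symD] .
  note B = orthonormal_eigenbasisD[OF this]
  have zero: "(S - Q) *v b = 0" if b: "b \<in> B" for b
  proof (cases "l b = 0")
    case False
    have d: "S *v b - Q *v b = l b *\<^sub>R b" using B(2)[OF b] by (simp add: matrix_vector_mult_diff_rdistrib)
    have "(S *v b) \<bullet> (S *v b) = b \<bullet> (S *v (S *v b))" by (rule symmetric_matrix_inner[OF symS])
    also have "S *v (S *v b) = Q *v (Q *v b)" using eq by (simp add: matrix_vector_mul_assoc)
    also have "b \<bullet> \<dots> = (Q *v b) \<bullet> (Q *v b)" by (rule symmetric_matrix_inner[OF symQ, symmetric])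
    finally have "(S *v b - Q *v b) \<bullet> (S *v b + Q *v b) = 0"
      by (simp add: inner_diff_left inner_add_right inner_commute[of "Q *v b" "S *v b"])
    then have "b \<bullet> (S *v b) + b \<bullet> (Q *v b) = 0" using False unfolding d
      by (simp add: inner_add_right distrib_left[symmetric] del: distrib_left_numeral)
    moreover have "0 \<le> b \<bullet> (S *v b)" "0 \<le> b \<bullet> (Q *v b)" using S Q by (auto simp: psd_matrix_def inner_commute)
    ultimately have "(S *v b) \<bullet> b = 0" "(Q *v b) \<bullet> b = 0" by (auto simp: inner_commute)
    then have "S *v b = 0" "Q *v b = 0"
      using S Q by (auto intro!: semidefinite_form_zero[where V = UNIV] simp: psd_matrix_def)
    then show ?thesis by (simp add: matrix_vector_mult_diff_rdistrib)
  qed (simp add: B(2)[OF b])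
  have "(S - Q) *v x = 0" for x
    by (subst B(4)[of x]) (simp add: matrix_vector_mult_sum_right matrix_vector_mult_scaleR zero)
  then show ?thesis by (simp add: matrix_eq matrix_vector_mult_diff_rdistrib)
qed

lemma matrix_sqrt:
  fixes R :: "real^'d^'d"
  assumes "psd_matrix R"
  shows "psd_matrix (matrix_sqrt R)" "matrix_sqrt R ** matrix_sqrt R = R"
proof -
  have "\<exists>!S. psd_matrix S \<and> S ** S = R"
    using psd_matrix_sqrt_exists[OF assms] psd_matrix_sqrt_unique by blast
  from theI'[OF this] show "psd_matrix (matrix_sqrt R)" "matrix_sqrt R ** matrix_sqrt R = R"
    by (auto simp: matrix_sqrt_def)
qed

section \<open>Covariance forms and the ellipsoid of concentration\<close>

lemma cov_matrix_centered:
  fixes Y :: "'w \<Rightarrow> real^'d"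
  assumes "prob_space M" and [measurable]: "Y \<in> borel_measurable M"
    and mean: "\<And>i. (\<integral>\<omega>. Y \<omega> $ i \<partial>M) = 0" and sq: "\<And>i. integrable M (\<lambda>\<omega>. (Y \<omega> $ i)\<^sup>2)"
  shows "psd_matrix (cov_matrix M Y)" "(cov_matrix M Y *v u) \<bullet> u = (\<integral>\<omega>. (u \<bullet> Y \<omega>)\<^sup>2 \<partial>M)"
proof -
  have m[measurable]: "(\<lambda>\<omega>. Y \<omega> $ i) \<in> borel_measurable M" for i
  proof -
    have "(\<lambda>\<omega>. Y \<omega> \<bullet> axis i 1) \<in> borel_measurable M" by measurable
    then show ?thesis by (simp add: inner_axis)
  qed
  have pr: "integrable M (\<lambda>\<omega>. Y \<omega> $ i * Y \<omega> $ j)" for i j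
    by (intro square_integrable_mult sq m)
  let ?R = "cov_matrix M Y"
  have R: "?R $ i $ j = (\<integral>\<omega>. Y \<omega> $ i * Y \<omega> $ j \<partial>M)" for i j by (simp add: cov_matrix_def mean)
  show form: "(?R *v u) \<bullet> u = (\<integral>\<omega>. (u \<bullet> Y \<omega>)\<^sup>2 \<partial>M)" for u
  proof -
    have "(u \<bullet> Y \<omega>)\<^sup>2 = (\<Sum>i\<in>UNIV. \<Sum>j\<in>UNIV. u $ i * u $ j * (Y \<omega> $ i * Y \<omega> $ j))" for \<omega>
      by (simp add: inner_vec_def power2_eq_square sum_product mult_ac)
    then have "(\<integral>\<omega>. (u \<bullet> Y \<omega>)\<^sup>2 \<partial>M) = (\<integral>\<omega>. (\<Sum>i\<in>UNIV. \<Sum>j\<in>UNIV. u $ i * u $ j * (Y \<omega> $ i * Y \<omega> $ j)) \<partial>M)"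
      by (simp only:)
    also have "\<dots> = (\<Sum>i\<in>UNIV. \<integral>\<omega>. (\<Sum>j\<in>UNIV. u $ i * u $ j * (Y \<omega> $ i * Y \<omega> $ j)) \<partial>M)"
      by (intro Bochner_Integration.integral_sum Bochner_Integration.integrable_sum integrable_mult_right pr)
    also have "\<dots> = (\<Sum>i\<in>UNIV. \<Sum>j\<in>UNIV. u $ i * u $ j * ?R $ i $ j)"
      by (intro sum.cong refl, subst Bochner_Integration.integral_sum) (auto intro!: integrable_mult_right pr simp: R)
    also have "\<dots> = (?R *v u) \<bullet> u"
      by (simp add: inner_vec_def matrix_vector_mult_def sum_distrib_right sum_distrib_left mult_ac)
    finally show ?thesis by simp
  qed
  show "psd_matrix ?R"
    unfolding psd_matrix_def form by (auto simp: transpose_def vec_eq_iff R mult.commute intro!: integral_nonneg_AE)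
qed

text \<open>Since the root \<open>S\<close> is symmetric, \<open>u\<close> pairs with
  \<open>S *v y\<close> as \<open>S *v u\<close> pairs with \<open>y\<close>; over the unit ball
  this is maximal in the direction of \<open>S *v u\<close>, with value its norm.\<close>

lemma concentration_ellipsoid_support:
  fixes Y :: "'w \<Rightarrow> real^'d"
  assumes R: "psd_matrix (cov_matrix M Y)"
  shows "x \<in> concentration_ellipsoid M Y \<Longrightarrow> u \<bullet> x \<le> sqrt ((cov_matrix M Y *v u) \<bullet> u)"
    "\<exists>x\<in>concentration_ellipsoid M Y. u \<bullet> x = sqrt ((cov_matrix M Y *v u) \<bullet> u)"
proof -
  define S where "S = matrix_sqrt (cov_matrix M Y)"
  have sym: "transpose S = S" and SS: "S ** S = cov_matrix M Y"
    using matrix_sqrt[OF R] by (auto simp: S_def psd_matrix_def)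
  have n: "norm (S *v u) = sqrt ((cov_matrix M Y *v u) \<bullet> u)"
  proof -
    have "(S *v u) \<bullet> (S *v u) = u \<bullet> (S *v (S *v u))" by (rule symmetric_matrix_inner[OF sym])
    also have "\<dots> = (cov_matrix M Y *v u) \<bullet> u" by (simp add: matrix_vector_mul_assoc SS inner_commute)
    finally show ?thesis by (simp add: norm_eq_sqrt_inner)
  qed
  have ux: "u \<bullet> (S *v y) = (S *v u) \<bullet> y" for y using symmetric_matrix_inner[OF sym, of u y] by simp
  have K: "concentration_ellipsoid M Y = {S *v y |y. norm y \<le> 1}" by (simp add: concentration_ellipsoid_def S_def)
  {
    assume "x \<in> concentration_ellipsoid M Y"
    then obtain y where y: "x = S *v y" "norm y \<le> 1" by (auto simp: K)
    have "u \<bullet> x \<le> norm (S *v u) * norm y" unfolding y(1) ux by (rule norm_cauchy_schwarz)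
    also have "\<dots> \<le> norm (S *v u) * 1" using y(2) by (intro mult_left_mono) auto
    finally show "u \<bullet> x \<le> sqrt ((cov_matrix M Y *v u) \<bullet> u)" by (simp add: n)
  }
  show "\<exists>x\<in>concentration_ellipsoid M Y. u \<bullet> x = sqrt ((cov_matrix M Y *v u) \<bullet> u)"
  proof (cases "S *v u = 0")
    case True
    then show ?thesis unfolding n[symmetric] K by (intro bexI[of _ "S *v 0"]) (auto intro!: exI[of _ 0] simp: ux simp del: matrix_vector_mult_0_right)
  next
    case False
    define y where "y = (1 / norm (S *v u)) *\<^sub>R (S *v u)"
    have "(S *v u) \<bullet> y = norm (S *v u)" using False by (simp add: y_def dot_square_norm power2_eq_square)
    moreover have "norm y \<le> 1" using False by (simp add: y_def)
    ultimately show ?thesis unfolding n[symmetric] K using ux by auto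
  qed
qed

subsection \<open>Hausdorff distance and support functions\<close>

lemma hausdorff_dist_le:
  assumes "0 < e" "A \<subseteq> open_nbhd e B" "B \<subseteq> open_nbhd e A"
  shows "hausdorff_dist A B \<le> e"
  unfolding hausdorff_dist_def
  using assms by (auto intro!: cInf_lower bdd_belowI[of _ 0])

lemma mem_open_nbhd: "x \<in> open_nbhd e A \<longleftrightarrow> (\<exists>a\<in>A. dist a x < e)"
  by (auto simp: open_nbhd_def)

lemma convex_open_nbhd:
  fixes A :: "'a::real_normed_vector set"
  assumes "convex A"
  shows "convex (open_nbhd e A)"
proof -
  have "open_nbhd e A = (\<Union>x\<in>A. \<Union>y\<in>ball 0 e. {x + y})"
  proof (rule set_eqI, rule iffI)
    fix x assume "x \<in> open_nbhd e A"
    then obtain a where "a \<in> A" "dist a x < e" by (auto simp: mem_open_nbhd)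
    then have "a \<in> A" "x - a \<in> ball 0 e" "x \<in> {a + (x - a)}" by (simp_all add: dist_norm norm_minus_commute)
    then show "x \<in> (\<Union>x\<in>A. \<Union>y\<in>ball 0 e. {x + y})" by blast
  next
    fix x assume "x \<in> (\<Union>x\<in>A. \<Union>y\<in>ball 0 e. {x + y})"
    then obtain a y where "a \<in> A" "norm y < e" "x = a + y" by auto
    then show "x \<in> open_nbhd e A" unfolding mem_open_nbhd by (intro bexI[of _ a]) (simp_all add: dist_norm)
  qed
  then show ?thesis using convex_sums[OF assms convex_ball[of 0 e]] by simp
qed

text \<open>The unit vector points from the closest point \<open>z\<close> of \<open>B\<close>
  towards \<open>x\<close>. These are at least \<open>d\<close> apart, and \<open>B\<close> lies
  behind the hyperplane through \<open>z\<close>.\<close>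

lemma point_outside_open_nbhd_separated:
  fixes B :: "'a::euclidean_space set"
  assumes B: "B \<noteq> {}" "closed B" "convex B" and x: "x \<notin> open_nbhd d B" and d: "0 < d"
  obtains u where "norm u = 1" "\<And>y. y \<in> B \<Longrightarrow> u \<bullet> y \<le> u \<bullet> x - d"
proof -
  define z where "z = closest_point B x"
  have z: "z \<in> B" using B by (simp add: z_def closest_point_in_set)
  define r where "r = norm (x - z)"
  have r: "d \<le> r" using x z by (auto simp: mem_open_nbhd not_less r_def dist_norm norm_minus_commute)
  define u where "u = (1 / r) *\<^sub>R (x - z)"
  have nu: "norm u = 1" using r d by (simp add: u_def r_def[symmetric])
  have xz: "x - z = r *\<^sub>R u" using r d by (simp add: u_def)
  have "u \<bullet> y \<le> u \<bullet> x - d" if "y \<in> B" for y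
  proof -
    have "(x - z) \<bullet> (y - z) \<le> 0" unfolding z_def by (rule closest_point_dot[OF B(3,2) that])
    then have "u \<bullet> (y - z) \<le> 0" using r d unfolding xz by (simp add: mult_le_0_iff)
    moreover have "u \<bullet> (x - z) = r" unfolding xz using nu by (simp add: dot_square_norm)
    ultimately show ?thesis using r by (simp add: inner_diff_right)
  qed
  with nu show thesis by (rule that)
qed

definition support_fun :: "'a::real_inner set \<Rightarrow> 'a \<Rightarrow> real" where
  "support_fun W u = (SUP w\<in>W. u \<bullet> w)"

lemma support_fun:
  fixes W :: "'a::euclidean_space set"
  assumes "compact W" "W \<noteq> {}"
  shows "w \<in> W \<Longrightarrow> u \<bullet> w \<le> support_fun W u" "(\<And>w. w \<in> W \<Longrightarrow> u \<bullet> w \<le> c) \<Longrightarrow> support_fun W u \<le> c"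
proof -
  have "compact ((\<bullet>) u ` W)" by (intro compact_continuous_image continuous_intros assms)
  then have "bdd_above ((\<bullet>) u ` W)" by (intro bounded_imp_bdd_above compact_imp_bounded)
  then show "w \<in> W \<Longrightarrow> u \<bullet> w \<le> support_fun W u" unfolding support_fun_def by (intro cSUP_upper)
  show "(\<And>w. w \<in> W \<Longrightarrow> u \<bullet> w \<le> c) \<Longrightarrow> support_fun W u \<le> c"
    unfolding support_fun_def using assms(2) by (rule cSUP_least)
qed

lemma support_fun_Lipschitz:
  fixes W :: "'a::euclidean_space set"
  assumes "compact W" "W \<noteq> {}" "\<And>w. w \<in> W \<Longrightarrow> norm w \<le> R"
  shows "support_fun W u \<le> support_fun W v + norm (u - v) * R"
proof (rule support_fun(2)[OF assms(1,2)])
  fix w assume w: "w \<in> W"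
  have "u \<bullet> w = v \<bullet> w + (u - v) \<bullet> w" by (simp add: inner_diff_left)
  also have "(u - v) \<bullet> w \<le> norm (u - v) * norm w" by (rule norm_cauchy_schwarz)
  also have "\<dots> \<le> norm (u - v) * R" using assms(3)[OF w] by (intro mult_left_mono) auto
  finally show "u \<bullet> w \<le> support_fun W v + norm (u - v) * R"
    using support_fun(1)[OF assms(1,2) w, of v] by simp
qed

text \<open>Bounds on finitely many linear functionals thereby bound the norm; this is how estimates
  for single directions control a whole random hull.\<close>

lemma norm_le_DIM_max_coordinate:
  fixes x :: "'a::euclidean_space"
  obtains e where "e \<in> Basis \<union> uminus ` Basis" "norm x \<le> DIM('a) * (e \<bullet> x)"
proof -
  obtain b where b: "b \<in> Basis" "\<And>c. c \<in> Basis \<Longrightarrow> \<bar>x \<bullet> c\<bar> \<le> \<bar>x \<bullet> b\<bar>"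
  proof -
    have "Max ((\<lambda>c. \<bar>x \<bullet> c\<bar>) ` Basis) \<in> (\<lambda>c. \<bar>x \<bullet> c\<bar>) ` (Basis :: 'a set)" by (intro Max_in) auto
    then obtain b where b: "b \<in> Basis" "Max ((\<lambda>c. \<bar>x \<bullet> c\<bar>) ` (Basis :: 'a set)) = \<bar>x \<bullet> b\<bar>" by blast
    have "\<bar>x \<bullet> c\<bar> \<le> \<bar>x \<bullet> b\<bar>" if "c \<in> Basis" for c
      unfolding b(2)[symmetric] using that by (intro Max_ge) auto
    with b(1) show thesis by (rule that)
  qed
  have n: "norm x \<le> DIM('a) * \<bar>x \<bullet> b\<bar>"
    using norm_le_l1[of x] sum_bounded_above[of Basis "\<lambda>c. \<bar>x \<bullet> c\<bar>" "\<bar>x \<bullet> b\<bar>"] b(2) by simp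
  show thesis
  proof (cases "0 \<le> x \<bullet> b")
    case True
    then show thesis using n b by (intro that[of b]) (auto simp: inner_commute)
  next
    case False
    then show thesis using n b by (intro that[of "- b"]) (auto simp: inner_commute)
  qed
qed

lemma sphere_finite_net:
  fixes e :: real
  assumes "0 < e"
  obtains k :: "'a::euclidean_space set" where "finite k" "k \<subseteq> sphere 0 1"
    "\<And>u. norm u = 1 \<Longrightarrow> \<exists>v\<in>k. norm (u - v) < e"
proof -
  have "sphere (0::'a) 1 \<subseteq> (\<Union>x\<in>sphere 0 1. ball x e)" using assms by auto
  then obtain k where k: "k \<subseteq> sphere 0 1" "finite k" "sphere (0::'a) 1 \<subseteq> (\<Union>x\<in>k. ball x e)"
    by (rule compactE_image[OF compact_sphere, rotated]) auto
  show thesis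
  proof (rule that[OF k(2,1)])
    fix u :: 'a assume "norm u = 1"
    then have "u \<in> (\<Union>x\<in>k. ball x e)" using k(3) by (auto simp: subset_iff)
    then show "\<exists>v\<in>k. norm (u - v) < e" by (auto simp: dist_norm norm_minus_commute)
  qed
qed

text \<open>The coordinate directions in the finite set bound all admissible \<open>A\<close> uniformly, which makes
  their support functions equi-Lipschitz, so that a net of directions decides.\<close>

lemma hausdorff_dist_finite_directions:
  fixes W :: "(real^'d) set"
  assumes W: "W \<in> compact_convex_sets" and \<delta>: "0 < \<delta>"
  obtains U \<epsilon> where "finite U" "U \<subseteq> sphere 0 1" "0 < \<epsilon>"
    "\<And>A. A \<in> compact_convex_sets \<Longrightarrow>
      (\<And>u x. u \<in> U \<Longrightarrow> x \<in> A \<Longrightarrow> u \<bullet> x \<le> support_fun W u + \<epsilon>) \<Longrightarrow>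
      (\<And>u. u \<in> U \<Longrightarrow> \<exists>x\<in>A. support_fun W u - \<epsilon> \<le> u \<bullet> x) \<Longrightarrow> hausdorff_dist A W < \<delta>"
proof -
  have Wc: "compact W" "W \<noteq> {}" "convex W" using W by (auto simp: compact_convex_sets_def)
  obtain R0 where R0: "0 < R0" "\<And>w. w \<in> W \<Longrightarrow> norm w \<le> R0"
    using compact_imp_bounded[OF Wc(1)] by (auto simp: bounded_pos)
  \<comment> \<open>Once \<open>A\<close> obeys the upper bounds in the signed coordinate directions
    with \<open>\<epsilon> \<le> 1\<close>, all its coordinates are at most \<open>R0 + 1\<close> in
    absolute value, so \<open>A\<close> lies in the ball of radius \<open>R\<close>, as does
    \<open>W\<close>.\<close>
  define R where "R = real DIM(real^'d) * (R0 + 1)"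
  have R: "0 < R" "R0 \<le> R"
  proof -
    have "1 * (R0 + 1) \<le> real DIM(real^'d) * (R0 + 1)"
      using R0(1) DIM_positive[where 'a="real^'d"] by (intro mult_right_mono) linarith+
    then have "R0 + 1 \<le> R" by (simp only: R_def mult_1)
    then show "0 < R" "R0 \<le> R" using R0(1) by simp_all
  qed
  \<comment> \<open>Replacing a direction by one of the net within \<open>\<eta>\<close> changes
    either support function by at most \<open>\<eta> * R = \<delta> / 8\<close>.\<close>
  define \<eta> where "\<eta> = \<delta> / (8 * R)"
  have \<eta>: "0 < \<eta>" "\<eta> * R = \<delta> / 8" using \<delta> R(1) by (simp_all add: \<eta>_def)
  obtain k :: "(real^'d) set" where k: "finite k" "k \<subseteq> sphere 0 1" "\<And>u. norm u = 1 \<Longrightarrow> \<exists>v\<in>k. norm (u - v) < \<eta>"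
    using sphere_finite_net[OF \<eta>(1)] by blast
  define \<epsilon> where "\<epsilon> = min 1 (\<delta> / 8)"
  have \<epsilon>: "0 < \<epsilon>" "\<epsilon> \<le> 1" "\<epsilon> \<le> \<delta> / 8" using \<delta> by (auto simp: \<epsilon>_def)
  let ?U = "k \<union> (Basis \<union> uminus ` Basis)"
  have lipW: "support_fun W u \<le> support_fun W v + \<delta> / 8" if "norm (u - v) < \<eta>" for u v
  proof -
    have "norm (u - v) * R \<le> \<eta> * R" using that R by (intro mult_right_mono) auto
    then show ?thesis using support_fun_Lipschitz[OF Wc(1,2), of R u v] R0(2) R(2) \<eta>(2) by fastforce
  qed
  show thesis
  proof (rule that[of ?U \<epsilon>])
    fix A :: "(real^'d) set" assume A: "A \<in> compact_convex_sets"
      and up: "\<And>u x. u \<in> ?U \<Longrightarrow> x \<in> A \<Longrightarrow> u \<bullet> x \<le> support_fun W u + \<epsilon>"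
      and lo: "\<And>u. u \<in> ?U \<Longrightarrow> \<exists>x\<in>A. support_fun W u - \<epsilon> \<le> u \<bullet> x"
    have Ac: "compact A" "A \<noteq> {}" "convex A" using A by (auto simp: compact_convex_sets_def)
    have AR: "norm x \<le> R" if x: "x \<in> A" for x
    proof -
      obtain e where e: "e \<in> Basis \<union> uminus ` Basis" "norm x \<le> DIM(real^'d) * (e \<bullet> x)"
        using norm_le_DIM_max_coordinate .
      have ne: "norm e = 1" using e(1) by auto
      have "support_fun W e \<le> R0"
      proof (rule support_fun(2)[OF Wc(1,2)])
        fix w assume "w \<in> W"
        then show "e \<bullet> w \<le> R0" using norm_cauchy_schwarz[of e w] R0(2)[of w] ne by simp
      qed
      then have "e \<bullet> x \<le> R0 + 1" using up[of e x] e(1) x \<epsilon>(2) by fastforce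
      then have "DIM(real^'d) * (e \<bullet> x) \<le> R" unfolding R_def by (intro mult_left_mono) auto
      then show ?thesis using e(2) by linarith
    qed
    have lipA: "u \<bullet> x \<le> v \<bullet> x + \<delta> / 8" if "norm (u - v) < \<eta>" "x \<in> A" for u v x
    proof -
      have "u \<bullet> x = v \<bullet> x + (u - v) \<bullet> x" by (simp add: inner_diff_left)
      also have "(u - v) \<bullet> x \<le> norm (u - v) * norm x" by (rule norm_cauchy_schwarz)
      also have "\<dots> \<le> \<eta> * R" using that AR R \<eta>(1) by (intro mult_mono) auto
      finally show ?thesis using \<eta>(2) by simp
    qed
    have "A \<subseteq> open_nbhd (\<delta> / 2) W"
    proof
      fix x assume x: "x \<in> A"
      show "x \<in> open_nbhd (\<delta> / 2) W"
      proof (rule ccontr)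
        assume "x \<notin> open_nbhd (\<delta> / 2) W"
        then obtain u where u: "norm u = 1" "\<And>y. y \<in> W \<Longrightarrow> u \<bullet> y \<le> u \<bullet> x - \<delta> / 2"
          using point_outside_open_nbhd_separated[of W x "\<delta> / 2"] Wc \<delta> by (auto simp: compact_imp_closed)
        have "support_fun W u \<le> u \<bullet> x - \<delta> / 2" using u(2) by (rule support_fun(2)[OF Wc(1,2)])
        moreover obtain v where v: "v \<in> k" "norm (u - v) < \<eta>" using k(3)[OF u(1)] by blast
        moreover have "u \<bullet> x \<le> v \<bullet> x + \<delta> / 8" using v x by (intro lipA)
        moreover have "v \<bullet> x \<le> support_fun W v + \<epsilon>" using v x by (intro up) auto
        moreover have "support_fun W v \<le> support_fun W u + \<delta> / 8" using v by (intro lipW) (simp add: norm_minus_commute)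
        \<comment> \<open>The separating gap \<open>\<delta> / 2\<close> exceeds the total loss
          \<open>3 * \<delta> / 8\<close>, made up of two changes of direction and one
          \<open>\<epsilon>\<close>.\<close>
        ultimately show False using \<epsilon> \<delta> by linarith
      qed
    qed
    moreover have "W \<subseteq> open_nbhd (\<delta> / 2) A"
    proof
      fix x assume x: "x \<in> W"
      show "x \<in> open_nbhd (\<delta> / 2) A"
      proof (rule ccontr)
        assume "x \<notin> open_nbhd (\<delta> / 2) A"
        then obtain u where u: "norm u = 1" "\<And>y. y \<in> A \<Longrightarrow> u \<bullet> y \<le> u \<bullet> x - \<delta> / 2"
          using point_outside_open_nbhd_separated[of A x "\<delta> / 2"] Ac \<delta> by (auto simp: compact_imp_closed)
        obtain v where v: "v \<in> k" "norm (u - v) < \<eta>" using k(3)[OF u(1)] by blast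
        obtain y where y: "y \<in> A" "support_fun W v - \<epsilon> \<le> v \<bullet> y" using lo[of v] v(1) by blast
        have "u \<bullet> y \<le> u \<bullet> x - \<delta> / 2" using u(2) y(1) .
        moreover have "u \<bullet> x \<le> support_fun W u" by (rule support_fun(1)[OF Wc(1,2) x])
        moreover have "v \<bullet> y \<le> u \<bullet> y + \<delta> / 8" using v y by (intro lipA) (simp_all add: norm_minus_commute)
        moreover have "support_fun W u \<le> support_fun W v + \<delta> / 8" using v by (intro lipW)
        ultimately show False using \<epsilon> \<delta> y(2) by linarith
      qed
    qed
    ultimately have "hausdorff_dist A W \<le> \<delta> / 2" using \<delta> by (intro hausdorff_dist_le) auto
    then show "hausdorff_dist A W < \<delta>" using \<delta> by simp
  qed (use k \<epsilon> in auto)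
qed

lemma hausdorff_continuous_tendsto:
  fixes f :: "(real^'d) set \<Rightarrow> real" and A :: "nat \<Rightarrow> (real^'d) set"
  assumes f: "hausdorff_continuous f" and A: "\<And>n. A n \<in> compact_convex_sets" and B: "B \<in> compact_convex_sets"
    and ev: "\<And>e. 0 < e \<Longrightarrow> \<forall>\<^sub>F n in sequentially. A n \<subseteq> open_nbhd e B \<and> B \<subseteq> open_nbhd e (A n)"
  shows "(\<lambda>n. f (A n)) \<longlonglongrightarrow> f B"
proof (rule LIMSEQ_I)
  fix r :: real assume "0 < r"
  then obtain \<delta> where \<delta>: "0 < \<delta>" "\<And>C. C \<in> compact_convex_sets \<Longrightarrow> hausdorff_dist B C < \<delta> \<Longrightarrow> \<bar>f C - f B\<bar> < r"
    using f B unfolding hausdorff_continuous_def by blast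
  from ev[of "\<delta> / 2"] \<delta>(1) obtain n0 where n0: "\<And>n. n \<ge> n0 \<Longrightarrow> A n \<subseteq> open_nbhd (\<delta>/2) B \<and> B \<subseteq> open_nbhd (\<delta>/2) (A n)"
    by (auto simp: eventually_sequentially)
  have "\<bar>f (A n) - f B\<bar> < r" if "n \<ge> n0" for n
  proof (rule \<delta>(2)[OF A])
    have "hausdorff_dist B (A n) \<le> \<delta> / 2" using n0[OF that] \<delta>(1) by (intro hausdorff_dist_le) auto
    then show "hausdorff_dist B (A n) < \<delta>" using \<delta>(1) by simp
  qed
  then show "\<exists>no. \<forall>n\<ge>no. norm (f (A n) - f B) < r" by auto
qed

section \<open>Continuous functionals of hulls of random points\<close>

lemma finite_hull_compact_convex:
  "finite S \<Longrightarrow> S \<noteq> {} \<Longrightarrow> convex hull S \<in> compact_convex_sets" for S :: "(real^'d) set"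
  by (simp add: compact_convex_sets_def finite_imp_compact_convex_hull)

lemma closed_conv_compact_convex:
  fixes S :: "(real^'d) set"
  assumes "bounded S" "S \<noteq> {}"
  shows "closed_conv S \<in> compact_convex_sets"
  using assms by (simp add: compact_convex_sets_def closed_conv_def convex_closure bounded_convex_hull)

lemma closed_conv_minimal: "S \<subseteq> C \<Longrightarrow> closed C \<Longrightarrow> convex C \<Longrightarrow> closed_conv S \<subseteq> C"
  unfolding closed_conv_def by (intro closure_minimal hull_minimal)

lemma subset_closed_conv: "S \<subseteq> closed_conv S"
  unfolding closed_conv_def by (meson closure_subset hull_subset subset_trans)

text \<open>Simple functions in place of the \<open>Z j\<close> leave only finitely many possible
  hulls, so \<open>f\<close> of the hull is again simple, and Hausdorff continuity passes to the
  pointwise limit. Measurability is thus obtained without a sigma-algebra on the space of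
  sets.\<close>

lemma borel_measurable_hausdorff_continuous_hull:
  fixes f :: "(real^'d) set \<Rightarrow> real" and Z :: "nat \<Rightarrow> 'w \<Rightarrow> real^'d"
  assumes f: "hausdorff_continuous f" and Z: "\<And>j. Z j \<in> borel_measurable M"
  shows "(\<lambda>\<omega>. f (convex hull ((\<lambda>j. Z j \<omega>) ` {..k}))) \<in> borel_measurable M"
proof -
  have "\<exists>s. (\<forall>m. simple_function M (s m)) \<and> (\<forall>\<omega>\<in>space M. (\<lambda>m. s m \<omega>) \<longlonglongrightarrow> Z j \<omega>)" for j
    using borel_measurable_implies_sequence_metric[OF Z, of j 0] by blast
  then obtain s where s: "\<And>j m. simple_function M (s j m)"
    "\<And>j \<omega>. \<omega> \<in> space M \<Longrightarrow> (\<lambda>m. s j m \<omega>) \<longlonglongrightarrow> Z j \<omega>" by metis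
  have simp: "simple_function M (\<lambda>\<omega>. (\<lambda>j. s j m \<omega>) ` {..k})" for m k
  proof (induction k)
    case 0
    have "simple_function M (\<lambda>\<omega>. {s 0 m \<omega>})" using s(1)[of 0 m] by (rule simple_function_compose1)
    then show ?case by simp
  next
    case (Suc k)
    have "simple_function M (\<lambda>\<omega>. insert (s (Suc k) m \<omega>) ((\<lambda>j. s j m \<omega>) ` {..k}))"
      using s(1)[of "Suc k" m] Suc by (rule simple_function_compose2)
    then show ?case by (simp add: atMost_Suc)
  qed
  have "simple_function M (\<lambda>\<omega>. f (convex hull ((\<lambda>j. s j m \<omega>) ` {..k})))" for m
    using simp[of m k] by (rule simple_function_compose1[where g = "\<lambda>S. f (convex hull S)"])
  then have meas: "(\<lambda>\<omega>. f (convex hull ((\<lambda>j. s j m \<omega>) ` {..k}))) \<in> borel_measurable M" for m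
    by (rule borel_measurable_simple_function)
  show ?thesis
  proof (rule borel_measurable_LIMSEQ_real[OF _ meas])
    fix \<omega> assume \<omega>: "\<omega> \<in> space M"
    show "(\<lambda>m. f (convex hull ((\<lambda>j. s j m \<omega>) ` {..k}))) \<longlonglongrightarrow> f (convex hull ((\<lambda>j. Z j \<omega>) ` {..k}))"
    proof (rule hausdorff_continuous_tendsto[OF f])
      fix e :: real assume e: "0 < e"
      have "\<forall>\<^sub>F m in sequentially. \<forall>j\<in>{..k}. dist (s j m \<omega>) (Z j \<omega>) < e"
        using s(2)[OF \<omega>] e by (intro eventually_ball_finite) (auto simp: tendsto_iff)
      then show "\<forall>\<^sub>F m in sequentially. convex hull ((\<lambda>j. s j m \<omega>) ` {..k}) \<subseteq> open_nbhd e (convex hull ((\<lambda>j. Z j \<omega>) ` {..k}))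
        \<and> convex hull ((\<lambda>j. Z j \<omega>) ` {..k}) \<subseteq> open_nbhd e (convex hull ((\<lambda>j. s j m \<omega>) ` {..k}))"
      proof (rule eventually_mono, intro conjI hull_minimal convex_open_nbhd convex_convex_hull)
        fix m assume m: "\<forall>j\<in>{..k}. dist (s j m \<omega>) (Z j \<omega>) < e"
        show "(\<lambda>j. s j m \<omega>) ` {..k} \<subseteq> open_nbhd e (convex hull ((\<lambda>j. Z j \<omega>) ` {..k}))"
          "(\<lambda>j. Z j \<omega>) ` {..k} \<subseteq> open_nbhd e (convex hull ((\<lambda>j. s j m \<omega>) ` {..k}))"
          using m by (force simp: mem_open_nbhd dist_commute intro: hull_inc)+
      qed
    qed (auto intro!: finite_hull_compact_convex)
  qed
qed

text \<open>The initial hulls increase to a set that is dense in the closed hull. By compactness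
  finitely many of their open \<open>e\<close>-neighbourhoods cover it, and by monotonicity the
  largest of these already does.\<close>

lemma hausdorff_continuous_increasing_hulls:
  fixes f :: "(real^'d) set \<Rightarrow> real" and z :: "nat \<Rightarrow> real^'d"
  assumes f: "hausdorff_continuous f" and z: "bounded (range z)"
  shows "(\<lambda>k. f (convex hull (z ` {..k}))) \<longlonglongrightarrow> f (closed_conv (range z))"
proof (rule hausdorff_continuous_tendsto[OF f])
  let ?H = "\<lambda>k. convex hull (z ` {..k})"
  have mono: "?H k \<subseteq> ?H l" if "k \<le> l" for k l using that by (intro hull_mono image_mono) auto
  have Un: "convex hull (range z) \<subseteq> (\<Union>k. ?H k)"
  proof (rule hull_minimal)
    show "range z \<subseteq> (\<Union>k. ?H k)" by (auto intro!: exI hull_inc)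
    show "convex (\<Union>k. ?H k)"
    proof (rule convexI)
      fix x y u v assume xy: "x \<in> (\<Union>k. ?H k)" "y \<in> (\<Union>k. ?H k)" and uv: "0 \<le> u" "0 \<le> v" "u + v = (1::real)"
      then obtain k l where "x \<in> ?H k" "y \<in> ?H l" by auto
      then have "x \<in> ?H (max k l)" "y \<in> ?H (max k l)" using mono[of k "max k l"] mono[of l "max k l"] by auto
      then have "u *\<^sub>R x + v *\<^sub>R y \<in> ?H (max k l)" using uv by (intro convexD convex_convex_hull)
      then show "u *\<^sub>R x + v *\<^sub>R y \<in> (\<Union>k. ?H k)" by blast
    qed
  qed
  show "closed_conv (range z) \<in> compact_convex_sets" using z by (intro closed_conv_compact_convex) auto
  then have comp: "compact (closed_conv (range z))" by (simp add: compact_convex_sets_def)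
  fix e :: real assume e: "0 < e"
  have "closed_conv (range z) \<subseteq> (\<Union>k. open_nbhd e (?H k))"
  proof
    fix x assume "x \<in> closed_conv (range z)"
    then obtain y where "y \<in> convex hull (range z)" "dist y x < e"
      using e unfolding closed_conv_def closure_approachable by blast
    moreover from this obtain k where "y \<in> ?H k" using Un by blast
    ultimately have "x \<in> open_nbhd e (?H k)" unfolding mem_open_nbhd by blast
    then show "x \<in> (\<Union>k. open_nbhd e (?H k))" by blast
  qed
  moreover have "open (open_nbhd e (?H k))" for k by (auto simp: open_nbhd_def)
  ultimately obtain K where K: "finite K" "closed_conv (range z) \<subseteq> (\<Union>k\<in>K. open_nbhd e (?H k))"
    using compactE_image[OF comp, of UNIV "\<lambda>k. open_nbhd e (?H k)"] by auto
  \<comment> \<open>Inserting 0 keeps the maximum meaningful when \<open>K\<close> is empty.\<close>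
  have "?H k \<subseteq> open_nbhd e (closed_conv (range z)) \<and> closed_conv (range z) \<subseteq> open_nbhd e (?H k)"
    if k: "Max (insert 0 K) \<le> k" for k
  proof
    have "?H k \<subseteq> closed_conv (range z)"
      unfolding closed_conv_def by (rule order_trans[OF hull_mono closure_subset]) auto
    then show "?H k \<subseteq> open_nbhd e (closed_conv (range z))" using e by (force simp: mem_open_nbhd)
    show "closed_conv (range z) \<subseteq> open_nbhd e (?H k)"
    proof
      fix x assume "x \<in> closed_conv (range z)"
      then obtain l where l: "l \<in> K" "x \<in> open_nbhd e (?H l)" using K(2) by blast
      have "l \<le> k" using k K(1) l(1) by (auto simp: Max_le_iff)
      then show "x \<in> open_nbhd e (?H k)" using l(2) mono[of l k] by (auto simp: mem_open_nbhd)
    qed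
  qed
  then show "\<forall>\<^sub>F k in sequentially. ?H k \<subseteq> open_nbhd e (closed_conv (range z)) \<and> closed_conv (range z) \<subseteq> open_nbhd e (?H k)"
    unfolding eventually_sequentially by blast
qed (auto intro!: finite_hull_compact_convex)

subsection \<open>Bounded Gaussian processes\<close>

text \<open>The density is at most \<open>1 / sqrt (2 * pi) < 1 / 2\<close> and the interval has
  length at most 1. This turns a bound that holds with probability 1/2 into a bound on a standard
  deviation.\<close>

lemma std_normal_centered_interval:
  assumes "0 \<le> q" "q \<le> 1/2"
  shows "measure std_normal_distribution {x. \<bar>x\<bar> \<le> q} < 1/2"
proof -
  interpret prob_space std_normal_distribution by (rule prob_space_normal_density) simp
  have sq: "2 < sqrt (2 * pi)" by (rule real_less_rsqrt) (use pi_gt3 in simp)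
  have "emeasure std_normal_distribution {x. \<bar>x\<bar> \<le> q} = (\<integral>\<^sup>+x. ennreal (std_normal_density x) * indicator {-q..q} x \<partial>lborel)"
    by (subst emeasure_density) (auto intro!: nn_integral_cong split: split_indicator)
  also have "\<dots> \<le> (\<integral>\<^sup>+x. ennreal (1 / sqrt (2 * pi)) * indicator {-q..q} x \<partial>lborel)"
  proof (intro nn_integral_mono mult_right_mono ennreal_leI)
    fix x :: real
    have "1 / sqrt (2 * pi) * exp (- x\<^sup>2 / 2) \<le> 1 / sqrt (2 * pi) * 1" by (intro mult_left_mono) auto
    then show "std_normal_density x \<le> 1 / sqrt (2 * pi)" by (simp add: std_normal_density_def)
  qed simp
  also have "\<dots> = ennreal (1 / sqrt (2 * pi)) * ennreal (2 * q)"
    using assms by (subst nn_integral_cmult_indicator) auto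
  also have "\<dots> = ennreal (1 / sqrt (2 * pi) * (2 * q))" using assms by (subst ennreal_mult) auto
  finally have "measure std_normal_distribution {x. \<bar>x\<bar> \<le> q} \<le> 1 / sqrt (2 * pi) * (2 * q)"
    using assms unfolding emeasure_eq_measure by (subst (asm) ennreal_le_iff) auto
  also have "\<dots> \<le> 1 / sqrt (2 * pi) * 1" using assms by (intro mult_left_mono) auto
  also have "\<dots> < 1 / 2" using sq by (simp add: divide_simps)
  finally show ?thesis .
qed

lemma sets_countable_Ball:
  assumes "countable C" "\<And>t. t \<in> C \<Longrightarrow> {x \<in> space M. P t x} \<in> sets M"
  shows "{x \<in> space M. \<forall>t\<in>C. P t x} \<in> sets M"
proof -
  have "{x \<in> space M. \<forall>t\<in>C. P t x} = space M - (\<Union>t\<in>C. space M - {x \<in> space M. P t x})" by auto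
  also have "\<dots> \<in> sets M" using assms by (intro sets.Diff sets.top sets.countable_UN') auto
  finally show ?thesis .
qed

locale bounded_gaussian_process = prob_space M for M :: "'w measure" +
  fixes T :: "'t set" and X :: "'t \<Rightarrow> 'w \<Rightarrow> real^'d"
  assumes T_ne: "T \<noteq> {}" and gaussian: "centered_gaussian_process M T X" and bounded: "bounded_process M T X"
begin

definition sd :: "real^'d \<Rightarrow> 't \<Rightarrow> real" where
  "sd u t = sqrt (\<integral>\<omega>. (u \<bullet> X t \<omega>)\<^sup>2 \<partial>M)"

lemma X_measurable [measurable]: "t \<in> T \<Longrightarrow> X t \<in> borel_measurable M"
  using gaussian by (auto simp: centered_gaussian_process_def)

lemma gaussian_combination:
  assumes "finite F" "F \<subseteq> T"
  shows "centered_gaussian_law (distr M borel (\<lambda>\<omega>. \<Sum>t\<in>F. a t * (u \<bullet> X t \<omega>)))"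
  using gaussian assms unfolding centered_gaussian_process_def
  by (auto dest!: spec[of _ F] spec[of _ "\<lambda>t. a t *\<^sub>R u"])

lemma gaussian_projection: "t \<in> T \<Longrightarrow> centered_gaussian_law (distr M borel (\<lambda>\<omega>. u \<bullet> X t \<omega>))"
  using gaussian_combination[of "{t}" "\<lambda>_. 1" u] by simp

lemma sd_nonneg: "0 \<le> sd u t" by (auto simp: sd_def intro!: integral_nonneg_AE)

lemma projection_distr:
  "t \<in> T \<Longrightarrow> distr M borel (\<lambda>\<omega>. u \<bullet> X t \<omega>) = distr std_normal_distribution borel (\<lambda>x. sd u t * x)"
  unfolding sd_def by (rule centered_gaussian_var(5)[OF gaussian_projection]) auto

text \<open>The supremum over \<open>T\<close> may fail to be measurable, so the quantile is stated
  for finite subfamilies with a common \<open>K\<close>. If no integer served, the offending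
  families would have a countable union, on which the process is almost surely bounded; the events
  of being bounded by \<open>k\<close> there would have probabilities tending to 1 and yet at most
  1/2.\<close>

lemma median_bound:
  obtains K where "0 \<le> K" "\<And>F. finite F \<Longrightarrow> F \<subseteq> T \<Longrightarrow> 1/2 \<le> prob {\<omega> \<in> space M. \<forall>t\<in>F. norm (X t \<omega>) \<le> K}"
proof -
  have "\<exists>k::nat. \<forall>F. finite F \<longrightarrow> F \<subseteq> T \<longrightarrow> 1/2 \<le> prob {\<omega> \<in> space M. \<forall>t\<in>F. norm (X t \<omega>) \<le> real k}"
  proof (rule ccontr)
    assume "\<not> ?thesis"
    then have "\<forall>k. \<exists>F. finite F \<and> F \<subseteq> T \<and> prob {\<omega> \<in> space M. \<forall>t\<in>F. norm (X t \<omega>) \<le> real k} < 1/2"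
      unfolding not_ex not_all not_imp not_le by blast
    from choice[OF this] obtain F where "\<forall>k::nat. finite (F k) \<and> F k \<subseteq> T \<and>
      prob {\<omega> \<in> space M. \<forall>t\<in>F k. norm (X t \<omega>) \<le> real k} < 1/2" ..
    then have F: "\<And>k. finite (F k)" "\<And>k. F k \<subseteq> T"
      "\<And>k. prob {\<omega> \<in> space M. \<forall>t\<in>F k. norm (X t \<omega>) \<le> real k} < 1/2" by simp_all
    define C where "C = (\<Union>k. F k)"
    have C: "countable C" "C \<subseteq> T" 
      using F(1,2) by (auto simp: C_def countable_finite)
    define S where "S k = {\<omega> \<in> space M. \<forall>t\<in>C. norm (X t \<omega>) \<le> real k}" for k :: nat
    have [measurable]: "t \<in> C \<Longrightarrow> X t \<in> borel_measurable M" for t using C(2) X_measurable by blast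
    have S[measurable]: "S k \<in> sets M" for k
      unfolding S_def using C(1) by (rule sets_countable_Ball) measurable
    have "incseq S" by (auto simp: S_def incseq_def intro: order_trans)
    then have "(\<lambda>k. prob (S k)) \<longlonglongrightarrow> prob (\<Union>k. S k)" using S by (intro finite_Lim_measure_incseq) auto
    moreover have "prob (\<Union>k. S k) = 1"
    proof (subst prob_eq_1)
      show "AE \<omega> in M. \<omega> \<in> (\<Union>k. S k)"
        using bounded AE_space unfolding bounded_process_def
      proof eventually_elim
        case (elim \<omega>)
        then obtain B where B: "\<And>t. t \<in> T \<Longrightarrow> norm (X t \<omega>) \<le> B" by (auto simp: bounded_iff)
        obtain k :: nat where "B \<le> real k" using real_arch_simple by blast
        then have "\<omega> \<in> S k" using B C(2) elim(2) by (auto simp: S_def intro: order_trans)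
        then show ?case by blast
      qed
    qed auto
    moreover have "prob (S k) \<le> 1/2" for k
    proof -
      have "prob (S k) \<le> prob {\<omega> \<in> space M. \<forall>t\<in>F k. norm (X t \<omega>) \<le> real k}"
      proof (rule finite_measure_mono)
        show "{\<omega> \<in> space M. \<forall>t\<in>F k. norm (X t \<omega>) \<le> real k} \<in> sets M"
        proof (rule sets_countable_Ball)
          fix t assume "t \<in> F k"
          then have [measurable]: "X t \<in> borel_measurable M" using F(2)[of k] X_measurable by blast
          show "{\<omega> \<in> space M. norm (X t \<omega>) \<le> real k} \<in> sets M" by measurable
        qed (use F(1) in \<open>simp add: countable_finite\<close>)
      qed (auto simp: S_def C_def)
      then show ?thesis using F(3)[of k] by linarith
    qed
    ultimately have "1 \<le> (1/2 :: real)" by (intro LIMSEQ_le_const2) auto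
    then show False by simp
  qed
  then obtain k :: nat where "\<And>F. finite F \<Longrightarrow> F \<subseteq> T \<Longrightarrow> 1/2 \<le> prob {\<omega> \<in> space M. \<forall>t\<in>F. norm (X t \<omega>) \<le> real k}"
    by blast
  then show thesis by (rule that[of "real k", rotated]) auto
qed

text \<open>A standard normal variable scaled by more than \<open>2 * K\<close> stays within
  \<open>K\<close> with probability below 1/2, against the choice of \<open>K\<close>.\<close>

lemma sd_bounded:
  assumes K: "0 \<le> K" "\<And>F. finite F \<Longrightarrow> F \<subseteq> T \<Longrightarrow> 1/2 \<le> prob {\<omega> \<in> space M. \<forall>t\<in>F. norm (X t \<omega>) \<le> K}"
    and t: "t \<in> T" and u: "norm u = 1"
  shows "sd u t \<le> 2 * K"
proof (rule ccontr)
  assume "\<not> sd u t \<le> 2 * K"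
  then have s: "2 * K < sd u t" "0 < sd u t" using K(1) by auto
  note [measurable] = X_measurable[OF t]
  have "1/2 \<le> prob {\<omega> \<in> space M. \<forall>t\<in>{t}. norm (X t \<omega>) \<le> K}" using t by (intro K(2)) auto
  also have "\<dots> \<le> prob {\<omega> \<in> space M. \<bar>u \<bullet> X t \<omega>\<bar> \<le> K}"
    using Cauchy_Schwarz_ineq2[of u] u by (intro finite_measure_mono) (auto intro: order_trans)
  also have "\<dots> = measure (distr M borel (\<lambda>\<omega>. u \<bullet> X t \<omega>)) {y. \<bar>y\<bar> \<le> K}"
    by (subst measure_distr) (auto intro!: arg_cong[where f=prob])
  also have "\<dots> = measure std_normal_distribution {x. \<bar>sd u t * x\<bar> \<le> K}"
    unfolding projection_distr[OF t] by (subst measure_distr) (auto intro!: arg_cong[where f="measure _"])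
  also have "{x. \<bar>sd u t * x\<bar> \<le> K} = {x. \<bar>x\<bar> \<le> K / sd u t}"
    using s by (auto simp: abs_mult field_simps)
  also have "measure std_normal_distribution {x. \<bar>x\<bar> \<le> K / sd u t} < 1/2"
    using s K(1) by (intro std_normal_centered_interval) (auto simp: field_simps)
  finally show False by simp
qed

lemma ellipsoid_support:
  assumes t: "t \<in> T"
  shows "x \<in> concentration_ellipsoid M (X t) \<Longrightarrow> u \<bullet> x \<le> sd u t"
    "\<exists>x\<in>concentration_ellipsoid M (X t). u \<bullet> x = sd u t"
proof -
  have ax: "axis i 1 \<bullet> X t \<omega> = X t \<omega> $ i" for i \<omega>
    by (simp add: cart_eq_inner_axis inner_commute)
  note cv = centered_gaussian_var[OF gaussian_projection[OF t]]
  have m: "(\<lambda>\<omega>. u \<bullet> X t \<omega>) \<in> borel_measurable M" for u using X_measurable[OF t] by measurable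
  have "(\<integral>\<omega>. X t \<omega> $ i \<partial>M) = 0" "integrable M (\<lambda>\<omega>. (X t \<omega> $ i)\<^sup>2)" for i
    using cv(3)[OF m, of "axis i 1"] cv(1)[OF m, of "axis i 1"] unfolding ax by auto
  note c = cov_matrix_centered[OF prob_space_axioms X_measurable[OF t] this]
  show "x \<in> concentration_ellipsoid M (X t) \<Longrightarrow> u \<bullet> x \<le> sd u t"
    "\<exists>x\<in>concentration_ellipsoid M (X t). u \<bullet> x = sd u t"
    using concentration_ellipsoid_support(1)[OF c(1), of x u] concentration_ellipsoid_support(2)[OF c(1), of u]
    unfolding c(2) sd_def by auto
qed

lemma limit_hull_compact_convex: "limit_hull M T X \<in> compact_convex_sets"
  unfolding limit_hull_def
proof (rule closed_conv_compact_convex)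
  obtain K where K: "0 \<le> K" "\<And>F. finite F \<Longrightarrow> F \<subseteq> T \<Longrightarrow> 1/2 \<le> prob {\<omega> \<in> space M. \<forall>t\<in>F. norm (X t \<omega>) \<le> K}"
    using median_bound by blast
  have "norm x \<le> 2 * K" if t: "t \<in> T" and x: "x \<in> concentration_ellipsoid M (X t)" for x t
  proof (cases "x = 0")
    case False
    \<comment> \<open>Testing \<open>x\<close> in its own direction turns the support bound into a
      norm bound.\<close>
    have "((1 / norm x) *\<^sub>R x) \<bullet> x \<le> sd ((1 / norm x) *\<^sub>R x) t" by (rule ellipsoid_support(1)[OF t x])
    also have "\<dots> \<le> 2 * K" using False by (intro sd_bounded[OF K t]) auto
    also have "((1 / norm x) *\<^sub>R x) \<bullet> x = norm x" using False by (simp add: dot_square_norm power2_eq_square)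
    finally show ?thesis .
  qed (use K(1) in simp)
  then show "bounded (\<Union>t\<in>T. concentration_ellipsoid M (X t))"
    unfolding bounded_iff by (intro exI[of _ "2 * K"]) auto
  obtain t where "t \<in> T" using T_ne by blast
  then show "(\<Union>t\<in>T. concentration_ellipsoid M (X t)) \<noteq> {}" using ellipsoid_support(2)[of t 0] by blast
qed

text \<open>A closed half-space contains the hull as soon as it contains every ellipsoid, so the
  support function is the least upper bound of the standard deviations.\<close>

lemma support_limit_hull:
  shows "t \<in> T \<Longrightarrow> sd u t \<le> support_fun (limit_hull M T X) u"
    "(\<And>t. t \<in> T \<Longrightarrow> sd u t \<le> c) \<Longrightarrow> support_fun (limit_hull M T X) u \<le> c"
proof -
  have W: "compact (limit_hull M T X)" "limit_hull M T X \<noteq> {}"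
    using limit_hull_compact_convex by (auto simp: compact_convex_sets_def)
  {
    assume t: "t \<in> T"
    obtain x where x: "x \<in> concentration_ellipsoid M (X t)" "u \<bullet> x = sd u t" using ellipsoid_support(2)[OF t] by blast
    have "x \<in> limit_hull M T X" unfolding limit_hull_def
      by (rule subsetD[OF subset_closed_conv], rule UN_I[of t], rule t, rule x(1))
    then show "sd u t \<le> support_fun (limit_hull M T X) u" using support_fun(1)[OF W, of x u] x(2) by simp
  }
  assume c: "\<And>t. t \<in> T \<Longrightarrow> sd u t \<le> c"
  have "limit_hull M T X \<subseteq> {x. u \<bullet> x \<le> c}"
    unfolding limit_hull_def
  proof (rule closed_conv_minimal)
    show "(\<Union>t\<in>T. concentration_ellipsoid M (X t)) \<subseteq> {x. u \<bullet> x \<le> c}"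
    proof clarify
      fix t x assume t: "t \<in> T" and x: "x \<in> concentration_ellipsoid M (X t)"
      show "u \<bullet> x \<le> c" using ellipsoid_support(1)[OF t x, of u] c[OF t] by linarith
    qed
  qed (rule closed_halfspace_le convex_halfspace_le)+
  then show "support_fun (limit_hull M T X) u \<le> c" by (intro support_fun(2)[OF W]) auto
qed

lemma support_limit_hull_nonneg: "0 \<le> support_fun (limit_hull M T X) u"
  using T_ne support_limit_hull(1)[of _ u] sd_nonneg[of u] order_trans by blast

end

section \<open>Independent copies of the process\<close>

locale gaussian_sample = bounded_gaussian_process M T X + N: prob_space N
  for M :: "'w measure" and T :: "'t::metric_space set" and X :: "'t \<Rightarrow> 'w \<Rightarrow> real^'d" and N :: "'v measure" +
  fixes Xs :: "nat \<Rightarrow> 't \<Rightarrow> 'v \<Rightarrow> real^'d"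
  assumes iid: "iid_copies N Xs M T X"
    and sample_separable: "\<And>i. i \<ge> 1 \<Longrightarrow> separable_process N T (Xs i)"
    and sample_bounded: "\<And>i. i \<ge> 1 \<Longrightarrow> bounded_process N T (Xs i)"
begin

lemma path_measurable: "path_of T X \<in> measurable M (path_space T)"
  unfolding path_of_def by measurable

lemma sample_path_measurable: "i \<ge> 1 \<Longrightarrow> path_of T (Xs i) \<in> measurable N (path_space T)"
  using iid by (auto simp: iid_copies_def N.indep_vars_def)

lemma Xs_measurable [measurable]:
  assumes "i \<ge> 1" "t \<in> T"
  shows "Xs i t \<in> borel_measurable N"
proof -
  have "(\<lambda>\<omega>. path_of T (Xs i) \<omega> t) \<in> borel_measurable N"
    using sample_path_measurable[OF assms(1)] measurable_component_singleton[OF assms(2), of "\<lambda>_. borel"]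
    by (rule measurable_compose)
  then show ?thesis using assms(2) by (simp add: path_of_def)
qed

text \<open>Equality of laws moves only functionals that are measurable for the product
  sigma-algebra. Boundedness and separability of paths are in general not of this kind, whence they
  are assumed for the copies themselves.\<close>

lemma sample_distr:
  assumes i: "i \<ge> 1" and g: "g \<in> measurable (path_space T) L"
  shows "distr N L (\<lambda>\<omega>. g (path_of T (Xs i) \<omega>)) = distr M L (\<lambda>\<omega>. g (path_of T X \<omega>))"
proof -
  have "distr (distr N (path_space T) (path_of T (Xs i))) L g = distr (distr M (path_space T) (path_of T X)) L g"
    using iid i by (simp add: iid_copies_def)
  then show ?thesis
    using sample_path_measurable[OF i] path_measurable g by (simp add: distr_distr comp_def)
qed

lemma sample_combination_distr:
  assumes i: "i \<ge> 1" and F: "finite F" "F \<subseteq> T"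
  shows "distr N borel (\<lambda>\<omega>. \<Sum>t\<in>F. a t * (u \<bullet> Xs i t \<omega>)) = distr M borel (\<lambda>\<omega>. \<Sum>t\<in>F. a t * (u \<bullet> X t \<omega>))"
proof -
  have "(\<lambda>w. \<Sum>t\<in>F. a t * (u \<bullet> w t)) \<in> borel_measurable (path_space T)"
  proof (intro borel_measurable_sum)
    fix t assume "t \<in> F"
    then have [measurable]: "(\<lambda>w. w t) \<in> borel_measurable (path_space T)"
      using F(2) by (intro measurable_component_singleton) auto
    show "(\<lambda>w. a t * (u \<bullet> w t)) \<in> borel_measurable (path_space T)" by measurable
  qed
  from sample_distr[OF i this] show ?thesis
    using F(2) by (simp add: path_of_def subset_eq cong: sum.cong)
qed

lemma sample_projection_distr:
  assumes "i \<ge> 1" "t \<in> T"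
  shows "distr N borel (\<lambda>\<omega>. u \<bullet> Xs i t \<omega>) = distr std_normal_distribution borel (\<lambda>x. sd u t * x)"
  using sample_combination_distr[of i "{t}" "\<lambda>_. 1" u] assms projection_distr[of t u] by simp

lemma sample_second_moment:
  assumes "i \<ge> 1" "t \<in> T"
  shows "(\<integral>\<omega>. (u \<bullet> Xs i t \<omega>)\<^sup>2 \<partial>N) = (sd u t)\<^sup>2"
proof -
  have [measurable]: "Xs i t \<in> borel_measurable N" "X t \<in> borel_measurable M" using assms by auto
  have "(\<integral>\<omega>. (u \<bullet> Xs i t \<omega>)\<^sup>2 \<partial>N) = (\<integral>y. y\<^sup>2 \<partial>distr N borel (\<lambda>\<omega>. u \<bullet> Xs i t \<omega>))"
    by (subst integral_distr) auto
  also have "\<dots> = (\<integral>y. y\<^sup>2 \<partial>distr M borel (\<lambda>\<omega>. u \<bullet> X t \<omega>))"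
    using sample_projection_distr[OF assms] projection_distr[OF assms(2)] by simp
  also have "\<dots> = (\<integral>\<omega>. (u \<bullet> X t \<omega>)\<^sup>2 \<partial>M)" by (subst integral_distr) auto
  finally show ?thesis by (simp add: sd_def)
qed

text \<open>The bound for finite maxima does not depend on the finite set, so monotone convergence
  along an enumeration of \<open>S\<close> carries it to the supremum. Values in
  \<open>ennreal\<close> make the supremum meaningful without a prior bound.\<close>

lemma sample_sup_mgf:
  assumes S: "countable S" "S \<subseteq> T" "S \<noteq> {}" and i: "i \<ge> 1" and u: "norm u = 1" and c: "0 \<le> c"
    and K: "\<And>F. finite F \<Longrightarrow> F \<subseteq> T \<Longrightarrow> 1/2 \<le> prob {\<omega> \<in> space M. \<forall>t\<in>F. norm (X t \<omega>) \<le> K}"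
    and \<sigma>: "\<And>t. t \<in> T \<Longrightarrow> sd u t \<le> \<sigma>"
  shows "(\<integral>\<^sup>+\<omega>. (SUP t\<in>S. ennreal (exp (c * (u \<bullet> Xs i t \<omega>)))) \<partial>N)
    \<le> ennreal (exp (c\<^sup>2 * \<sigma>\<^sup>2 / 2 + c * (K + \<sigma>\<^sup>2 / 2 + ln 2)))"
proof -
  define s where "s = from_nat_into S"
  have s: "range s = S" unfolding s_def using S by (intro range_from_nat_into) auto
  have sT: "s k \<in> T" for k using s S(2) by auto
  have [measurable]: "Xs i (s k) \<in> borel_measurable N" for k using sT i by auto
  let ?e = "\<lambda>t \<omega>. ennreal (exp (c * (u \<bullet> Xs i t \<omega>)))"
  have \<sigma>0: "0 \<le> \<sigma>" using \<sigma>[OF sT[of 0]] sd_nonneg[of u "s 0"] by linarith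
  have fin: "(\<integral>\<^sup>+\<omega>. (SUP j\<in>{..k}. ?e (s j) \<omega>) \<partial>N) \<le> ennreal (exp (c\<^sup>2 * \<sigma>\<^sup>2 / 2 + c * (K + \<sigma>\<^sup>2 / 2 + ln 2)))" for k
  proof -
    let ?F = "s ` {..k}"
    have F: "finite ?F" "?F \<noteq> {}" "?F \<subseteq> T" using sT by auto
    have "(\<integral>\<^sup>+\<omega>. (SUP j\<in>{..k}. ?e (s j) \<omega>) \<partial>N) \<le> (\<integral>\<^sup>+\<omega>. ennreal (exp (c * Max ((\<lambda>t. u \<bullet> Xs i t \<omega>) ` ?F))) \<partial>N)"
    proof (intro nn_integral_mono SUP_least ennreal_leI)
      fix \<omega> j assume "j \<in> {..k}"
      then have "u \<bullet> Xs i (s j) \<omega> \<le> Max ((\<lambda>t. u \<bullet> Xs i t \<omega>) ` ?F)" by (intro Max_ge) auto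
      then show "exp (c * (u \<bullet> Xs i (s j) \<omega>)) \<le> exp (c * Max ((\<lambda>t. u \<bullet> Xs i t \<omega>) ` ?F))"
        using c by (simp add: mult_left_mono)
    qed
    also have "\<dots> \<le> ennreal (exp (c\<^sup>2 * \<sigma>\<^sup>2 / 2 + c * (K + \<sigma>\<^sup>2 / 2 + ln 2)))"
    proof (rule gaussian_max_mgf[OF N.prob_space_axioms F(1,2) _ _ _ \<sigma>0 _ c])
      show "(\<lambda>\<omega>. u \<bullet> Xs i t \<omega>) \<in> borel_measurable N" if "t \<in> ?F" for t
        using Xs_measurable[OF i, of t] that F(3) by auto
      show "centered_gaussian_law (distr N borel (\<lambda>\<omega>. \<Sum>t\<in>?F. a t * (u \<bullet> Xs i t \<omega>)))" for a
        unfolding sample_combination_distr[OF i F(1,3)] by (rule gaussian_combination[OF F(1,3)])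
      show "(\<integral>\<omega>. (u \<bullet> Xs i t \<omega>)\<^sup>2 \<partial>N) \<le> \<sigma>\<^sup>2" if "t \<in> ?F" for t
      proof -
        have t: "t \<in> T" using that F(3) by auto
        show ?thesis unfolding sample_second_moment[OF i t] using \<sigma>[OF t] sd_nonneg by (intro power_mono)
      qed
      have comp: "(\<lambda>w. w t) \<in> borel_measurable (path_space T)" if "t \<in> ?F" for t
        using that F(3) by (intro measurable_component_singleton) auto
      have meas: "(\<lambda>w. Max ((\<lambda>t. u \<bullet> w t) ` ?F)) \<in> borel_measurable (path_space T)"
        using F(1) comp by (intro borel_measurable_Max borel_measurable_inner borel_measurable_const)
      \<comment> \<open>The quantile is known on \<open>M\<close> and for norms; it is weakened to
        the direction \<open>u\<close> and then carried to \<open>N\<close> through the law of a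
        finite maximum on path space.\<close>
      have "prob {\<omega> \<in> space M. \<forall>t\<in>?F. norm (X t \<omega>) \<le> K} \<le> prob {\<omega> \<in> space M. \<forall>t\<in>?F. u \<bullet> X t \<omega> \<le> K}"
      proof (rule finite_measure_mono)
        show "{\<omega> \<in> space M. \<forall>t\<in>?F. norm (X t \<omega>) \<le> K} \<subseteq> {\<omega> \<in> space M. \<forall>t\<in>?F. u \<bullet> X t \<omega> \<le> K}"
          using u by (auto intro: order_trans[OF norm_cauchy_schwarz])
        show "{\<omega> \<in> space M. \<forall>t\<in>?F. u \<bullet> X t \<omega> \<le> K} \<in> sets M"
        proof (rule sets_countable_Ball)
          fix t assume "t \<in> ?F"
          then have [measurable]: "X t \<in> borel_measurable M" using F(3) by auto
          show "{\<omega> \<in> space M. u \<bullet> X t \<omega> \<le> K} \<in> sets M" by measurable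
        qed (use F(1) in \<open>simp add: countable_finite\<close>)
      qed
      also have "\<dots> = measure (distr M borel (\<lambda>\<omega>. Max ((\<lambda>t. u \<bullet> path_of T X \<omega> t) ` ?F))) {..K}"
        using measurable_compose[OF path_measurable meas] F
        by (subst measure_distr) (auto intro!: arg_cong[where f = prob] simp: path_of_def sT)
      also have "\<dots> = measure (distr N borel (\<lambda>\<omega>. Max ((\<lambda>t. u \<bullet> path_of T (Xs i) \<omega> t) ` ?F))) {..K}"
        by (subst sample_distr[OF i meas]) (rule refl)
      also have "\<dots> = measure N {\<omega> \<in> space N. \<forall>t\<in>?F. u \<bullet> Xs i t \<omega> \<le> K}"
        using measurable_compose[OF sample_path_measurable[OF i] meas] F
        by (subst measure_distr) (auto intro!: arg_cong[where f = N.prob] simp: path_of_def sT)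
      finally show "1/2 \<le> measure N {\<omega> \<in> space N. \<forall>t\<in>?F. u \<bullet> Xs i t \<omega> \<le> K}"
        using K[OF F(1,3)] by linarith
    qed
    finally show ?thesis .
  qed
  have "(SUP t\<in>S. ?e t \<omega>) = (SUP k. SUP j\<in>{..k}. ?e (s j) \<omega>)" for \<omega>
  proof (rule antisym)
    show "(SUP t\<in>S. ?e t \<omega>) \<le> (SUP k. SUP j\<in>{..k}. ?e (s j) \<omega>)"
    proof (rule SUP_least)
      fix t assume "t \<in> S"
      then obtain j where "t = s j" using s by auto
      then show "?e t \<omega> \<le> (SUP k. SUP j\<in>{..k}. ?e (s j) \<omega>)"
        by (intro SUP_upper2[of j UNIV] SUP_upper2[of j "{..j}"]) auto
    qed
    show "(SUP k. SUP j\<in>{..k}. ?e (s j) \<omega>) \<le> (SUP t\<in>S. ?e t \<omega>)"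
      using s by (intro SUP_least SUP_upper) auto
  qed
  then have "(\<integral>\<^sup>+\<omega>. (SUP t\<in>S. ?e t \<omega>) \<partial>N) = (\<integral>\<^sup>+\<omega>. (SUP k. SUP j\<in>{..k}. ?e (s j) \<omega>) \<partial>N)" by simp
  also have "\<dots> = (SUP k. \<integral>\<^sup>+\<omega>. (SUP j\<in>{..k}. ?e (s j) \<omega>) \<partial>N)"
    by (intro nn_integral_monotone_convergence_SUP) (auto simp: incseq_def le_fun_def intro!: SUP_subset_mono)
  also have "\<dots> \<le> ennreal (exp (c\<^sup>2 * \<sigma>\<^sup>2 / 2 + c * (K + \<sigma>\<^sup>2 / 2 + ln 2)))"
    by (intro SUP_least fin)
  finally show ?thesis .
qed

lemma sample_max_below:
  assumes t: "t \<in> T" and n: "n \<ge> 1"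
  shows "N.prob {\<omega> \<in> space N. \<forall>i\<in>{1..n}. u \<bullet> Xs i t \<omega> < q}
    = (measure std_normal_distribution {x. sd u t * x < q}) ^ n"
proof -
  have "N.indep_vars (\<lambda>_. borel) (\<lambda>i \<omega>. u \<bullet> path_of T (Xs i) \<omega> t) {1..}"
  proof (rule N.indep_vars_compose2[of "\<lambda>_. path_space T" "\<lambda>i. path_of T (Xs i)" _ "\<lambda>i w. u \<bullet> w t"])
    show "N.indep_vars (\<lambda>_. path_space T) (\<lambda>i. path_of T (Xs i)) {1..}" using iid by (simp add: iid_copies_def)
    have [measurable]: "(\<lambda>w. w t) \<in> borel_measurable (path_space T)"
      using t by (intro measurable_component_singleton)
    show "(\<lambda>w. u \<bullet> w t) \<in> borel_measurable (path_space T)" by measurable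
  qed
  then have ind: "N.indep_vars (\<lambda>_. borel) (\<lambda>i \<omega>. u \<bullet> Xs i t \<omega>) {1..}" using t by (simp add: path_of_def)
  have "{\<omega> \<in> space N. \<forall>i\<in>{1..n}. u \<bullet> Xs i t \<omega> < q} = (\<Inter>i\<in>{1..n}. (\<lambda>\<omega>. u \<bullet> Xs i t \<omega>) -` {..<q} \<inter> space N)"
    using n by auto
  also have "N.prob \<dots> = (\<Prod>i\<in>{1..n}. N.prob ((\<lambda>\<omega>. u \<bullet> Xs i t \<omega>) -` {..<q} \<inter> space N))"
    using n by (intro N.indep_varsD[OF ind]) auto
  also have "\<dots> = (\<Prod>i\<in>{1..n}. measure std_normal_distribution {x. sd u t * x < q})"
  proof (rule prod.cong[OF refl])
    fix i assume i: "i \<in> {1..n}"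
    then have [measurable]: "Xs i t \<in> borel_measurable N" using t by auto
    have "N.prob ((\<lambda>\<omega>. u \<bullet> Xs i t \<omega>) -` {..<q} \<inter> space N) = measure (distr N borel (\<lambda>\<omega>. u \<bullet> Xs i t \<omega>)) {..<q}"
      by (subst measure_distr) auto
    also have "\<dots> = measure std_normal_distribution {x. sd u t * x < q}"
      using i t by (subst sample_projection_distr) (auto simp: measure_distr intro!: arg_cong[where f = "measure _"])
    finally show "N.prob ((\<lambda>\<omega>. u \<bullet> Xs i t \<omega>) -` {..<q} \<inter> space N) = measure std_normal_distribution {x. sd u t * x < q}" .
  qed
  finally show ?thesis by simp
qed

text \<open>Each copy comes with its own separant and null event; as there are countably many
  copies, the union of the separants serves all of them outside one null event. Of separability only
  the closure statement on values is kept, since hulls do not see the index.\<close>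

lemma exists_separant:
  obtains S where "countable S" "S \<subseteq> T" "S \<noteq> {}"
    "AE \<omega> in N. \<forall>i\<ge>1. bounded ((\<lambda>t. Xs i t \<omega>) ` T) \<and> (\<forall>t\<in>T. Xs i t \<omega> \<in> closure ((\<lambda>t. Xs i t \<omega>) ` S))"
proof -
  have "\<exists>S. countable S \<and> S \<subseteq> T \<and> (AE \<omega> in N. \<forall>t\<in>T. Xs i t \<omega> \<in> closure ((\<lambda>t. Xs i t \<omega>) ` S))" if i: "i \<ge> 1" for i
  proof -
    obtain S where S: "countable S" "S \<subseteq> T" and AE: "AE \<omega> in N. \<forall>t\<in>T. \<exists>s. (\<forall>k::nat. s k \<in> S) \<and> s \<longlonglongrightarrow> t \<and>
           (\<lambda>k. Xs i (s k) \<omega>) \<longlonglongrightarrow> Xs i t \<omega>"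
      using sample_separable[OF i] unfolding separable_process_def by blast
    have "AE \<omega> in N. \<forall>t\<in>T. Xs i t \<omega> \<in> closure ((\<lambda>t. Xs i t \<omega>) ` S)"
      using AE
    proof eventually_elim
      case (elim \<omega>)
      show ?case
      proof
        fix t assume "t \<in> T"
        then obtain s where s: "\<And>k::nat. s k \<in> S" "(\<lambda>k. Xs i (s k) \<omega>) \<longlonglongrightarrow> Xs i t \<omega>" using elim by blast
        then show "Xs i t \<omega> \<in> closure ((\<lambda>t. Xs i t \<omega>) ` S)"
          unfolding closure_sequential by (intro exI[of _ "\<lambda>k. Xs i (s k) \<omega>"]) auto
      qed
    qed
    with S show ?thesis by blast
  qed
  then have "\<forall>i\<in>{1..}. \<exists>S. countable S \<and> S \<subseteq> T \<and> (AE \<omega> in N. \<forall>t\<in>T. Xs i t \<omega> \<in> closure ((\<lambda>t. Xs i t \<omega>) ` S))"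
    by simp
  from bchoice[OF this] obtain S where "\<forall>i\<in>{1..}. countable (S i) \<and> S i \<subseteq> T \<and>
    (AE \<omega> in N. \<forall>t\<in>T. Xs i t \<omega> \<in> closure ((\<lambda>t. Xs i t \<omega>) ` S i))" ..
  then have S: "\<And>i. i \<ge> 1 \<Longrightarrow> countable (S i) \<and> S i \<subseteq> T \<and> (AE \<omega> in N. \<forall>t\<in>T. Xs i t \<omega> \<in> closure ((\<lambda>t. Xs i t \<omega>) ` S i))"
    by simp
  obtain t0 where t0: "t0 \<in> T" using T_ne by blast
  define S' where "S' = insert t0 (\<Union>i\<in>{1..}. S i)"
  have AE: "AE \<omega> in N. \<forall>i\<in>{1..}. bounded ((\<lambda>t. Xs i t \<omega>) ` T) \<and> (\<forall>t\<in>T. Xs i t \<omega> \<in> closure ((\<lambda>t. Xs i t \<omega>) ` S'))"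
  proof (rule AE_ball_countable')
    fix i :: nat assume "i \<in> {1..}"
    then have i: "i \<ge> 1" by simp
    have "AE \<omega> in N. \<forall>t\<in>T. Xs i t \<omega> \<in> closure ((\<lambda>t. Xs i t \<omega>) ` S i)" using S[OF i] by simp
    moreover have "AE \<omega> in N. bounded ((\<lambda>t. Xs i t \<omega>) ` T)" using sample_bounded[OF i] by (simp add: bounded_process_def)
    ultimately show "AE \<omega> in N. bounded ((\<lambda>t. Xs i t \<omega>) ` T) \<and> (\<forall>t\<in>T. Xs i t \<omega> \<in> closure ((\<lambda>t. Xs i t \<omega>) ` S'))"
    proof eventually_elim
      case (elim \<omega>)
      have "(\<lambda>t. Xs i t \<omega>) ` S i \<subseteq> (\<lambda>t. Xs i t \<omega>) ` S'" using i by (auto simp: S'_def)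
      then show ?case using elim closure_mono by blast
    qed
  qed simp
  show thesis
  proof (rule that[of S'])
    show "countable S'" using S by (auto simp: S'_def)
    show "S' \<subseteq> T" using S t0 unfolding S'_def by auto
    show "AE \<omega> in N. \<forall>i\<ge>1. bounded ((\<lambda>t. Xs i t \<omega>) ` T) \<and> (\<forall>t\<in>T. Xs i t \<omega> \<in> closure ((\<lambda>t. Xs i t \<omega>) ` S'))"
      using AE by (simp add: atLeast_def Ball_def)
  qed (simp add: S'_def)
qed

end

subsection \<open>Limits along the scale\<close>

lemma borel_measurable_completion_AE:
  fixes g h :: "'a \<Rightarrow> real"
  assumes h: "h \<in> borel_measurable M" and ae: "AE x in M. g x = h x"
  shows "g \<in> borel_measurable (completion M)"
proof (rule measurableI)
  fix A :: "real set" assume A: "A \<in> sets borel"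
  have 1: "h -` A \<inter> space M \<in> sets (completion M)" using measurable_sets[OF h A] by auto
  have 2: "AE x in completion M. x \<in> h -` A \<inter> space M \<longleftrightarrow> x \<in> g -` A \<inter> space (completion M)"
    using AE_completion[OF ae] by eventually_elim auto
  show "g -` A \<inter> space (completion M) \<in> sets (completion M)"
    by (rule completion.in_sets_AE[OF 2 1]) simp
qed auto

lemma integral_completion_AE:
  fixes g h :: "'a \<Rightarrow> real"
  assumes h: "integrable M h" and ae: "AE x in M. g x = h x"
  shows "integrable (completion M) g" "(\<integral>x. g x \<partial>completion M) = (\<integral>x. h x \<partial>M)"
proof -
  have hm: "h \<in> borel_measurable M" using h by auto
  have gm: "g \<in> borel_measurable (completion M)" by (rule borel_measurable_completion_AE[OF hm ae])
  have hi: "integrable (completion M) h"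
    using h by (simp add: integrable_iff_bounded nn_integral_completion measurable_completion)
  have ae': "AE x in completion M. h x = g x" using AE_completion[OF ae] by eventually_elim simp
  show "integrable (completion M) g" using integrable_cong_AE_imp[OF hi gm ae'] .
  have "(\<integral>x. g x \<partial>completion M) = (\<integral>x. h x \<partial>completion M)"
    using ae' gm hi by (intro integral_cong_AE) auto
  then show "(\<integral>x. g x \<partial>completion M) = (\<integral>x. h x \<partial>M)" using integral_completion[OF hm] by simp
qed

text \<open>Second moments give uniform integrability, used in the form \<open>\<bar>y\<bar> \<le>
  \<theta> * y\<^sup>2 + 1 / (4 * \<theta>)\<close>: on the exceptional set the quadratic term is
  small by the choice of \<open>\<theta>\<close>, and the constant is multiplied by a probability
  that tends to 0.\<close>

lemma integral_tendsto_of_second_moments: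
  fixes h :: "nat \<Rightarrow> 'a \<Rightarrow> real"
  assumes N: "prob_space N" and m[measurable]: "\<And>n. h n \<in> borel_measurable N"
    and sq: "\<And>n. n \<ge> 2 \<Longrightarrow> (\<integral>\<^sup>+x. ennreal ((h n x)\<^sup>2) \<partial>N) \<le> ennreal C" and C: "0 \<le> C"
    and conv: "\<And>\<kappa>. 0 < \<kappa> \<Longrightarrow> \<exists>B. (\<forall>n. B n \<in> sets N) \<and> (\<lambda>n. measure N (B n)) \<longlonglongrightarrow> 0 \<and>
      (\<forall>n\<ge>2. AE x in N. x \<notin> B n \<longrightarrow> \<bar>h n x - a\<bar> < \<kappa>)"
  shows "n \<ge> 2 \<Longrightarrow> integrable N (h n)" "(\<lambda>n. \<integral>x. h n x \<partial>N) \<longlonglongrightarrow> a"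
proof -
  interpret prob_space N by fact
  have isq: "integrable N (\<lambda>x. (h n x)\<^sup>2)" "(\<integral>x. (h n x)\<^sup>2 \<partial>N) \<le> C" if n: "n \<ge> 2" for n
  proof -
    show i: "integrable N (\<lambda>x. (h n x)\<^sup>2)"
      using sq[OF n] by (intro integrableI_bounded) (auto intro: le_less_trans)
    have "ennreal (\<integral>x. (h n x)\<^sup>2 \<partial>N) \<le> ennreal C"
      using sq[OF n] by (subst nn_integral_eq_integral[symmetric, OF i]) auto
    then show "(\<integral>x. (h n x)\<^sup>2 \<partial>N) \<le> C" using C by simp
  qed
  have AMGM: "\<bar>y\<bar> \<le> \<theta> * y\<^sup>2 + 1 / (4 * \<theta>)" if "0 < \<theta>" for y \<theta> :: real
  proof -
    have "0 \<le> \<theta> * (\<bar>y\<bar> - 1 / (2 * \<theta>))\<^sup>2" using that by simp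
    also have "\<dots> = \<theta> * y\<^sup>2 + 1 / (4 * \<theta>) - \<bar>y\<bar>"
      using that by (simp add: power2_diff power_divide field_simps power2_eq_square)
    finally show ?thesis by simp
  qed
  show int: "integrable N (h n)" if n: "n \<ge> 2" for n
  proof (rule Bochner_Integration.integrable_bound)
    show "integrable N (\<lambda>x. (h n x)\<^sup>2 + 1)" using isq(1)[OF n] by simp
    show "AE x in N. norm (h n x) \<le> norm ((h n x)\<^sup>2 + 1)"
    proof (rule AE_I2)
      fix x show "norm (h n x) \<le> norm ((h n x)\<^sup>2 + 1)" using AMGM[of 1 "h n x"] by simp
    qed
  qed simp
  show "(\<lambda>n. \<integral>x. h n x \<partial>N) \<longlonglongrightarrow> a"
  proof (rule LIMSEQ_I)
    fix r :: real assume r: "0 < r"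
    define \<kappa> where "\<kappa> = r / 4"
    have \<kappa>: "0 < \<kappa>" using r by (simp add: \<kappa>_def)
    \<comment> \<open>Chosen so that \<open>\<theta>\<close> times the bound on the second moment of
      \<open>h n x - a\<close> is at most \<open>\<kappa>\<close>; the summand 1 keeps the
      denominator positive. The three errors then total at most
      \<open>3 * \<kappa> < r\<close>.\<close>
    define \<theta> where "\<theta> = \<kappa> / (2 * C + 2 * a\<^sup>2 + 1)"
    have den: "0 < 2 * C + 2 * a\<^sup>2 + 1" using C by (simp add: add_nonneg_pos)
    have \<theta>: "0 < \<theta>" using \<kappa> den by (simp add: \<theta>_def)
    have \<theta>2: "\<theta> * (2 * C + 2 * a\<^sup>2) \<le> \<kappa>"
    proof -
      have "\<theta> * (2 * C + 2 * a\<^sup>2) \<le> \<theta> * (2 * C + 2 * a\<^sup>2 + 1)" using \<theta> by (intro mult_left_mono) auto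
      also have "\<dots> = \<kappa>" using den by (simp add: \<theta>_def)
      finally show ?thesis .
    qed
    obtain B where B[measurable]: "\<And>n. B n \<in> sets N" and Bl: "(\<lambda>n. prob (B n)) \<longlonglongrightarrow> 0"
      and Bc: "\<And>n. n \<ge> 2 \<Longrightarrow> AE x in N. x \<notin> B n \<longrightarrow> \<bar>h n x - a\<bar> < \<kappa>"
      using conv[OF \<kappa>] by blast
    have "\<forall>\<^sub>F n in sequentially. prob (B n) < 4 * \<theta> * \<kappa>"
      using order_tendstoD(2)[OF Bl, of "4 * \<theta> * \<kappa>"] \<theta> \<kappa> by simp
    then obtain n0 where n0: "\<And>n. n \<ge> n0 \<Longrightarrow> prob (B n) < 4 * \<theta> * \<kappa>" by (auto simp: eventually_sequentially)
    have "norm ((\<integral>x. h n x \<partial>N) - a) < r" if n: "n \<ge> max 2 n0" for n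
    proof -
      have n2: "n \<ge> 2" using n by simp
      note [simp] = isq(1)[OF n2] int[OF n2]
      have "(\<integral>x. h n x \<partial>N) - a = (\<integral>x. h n x - a \<partial>N)" by (simp add: prob_space)
      also have "norm \<dots> \<le> (\<integral>x. norm (h n x - a) \<partial>N)" by (rule integral_norm_bound)
      also have "\<dots> \<le> (\<integral>x. \<kappa> + \<theta> * (2 * (h n x)\<^sup>2 + 2 * a\<^sup>2) + 1 / (4 * \<theta>) * indicator (B n) x \<partial>N)"
      proof (rule integral_mono_AE)
        show "integrable N (\<lambda>x. \<kappa> + \<theta> * (2 * (h n x)\<^sup>2 + 2 * a\<^sup>2) + 1 / (4 * \<theta>) * indicator (B n) x)"
          by (intro Bochner_Integration.integrable_add integrable_mult_right) (auto simp: less_top[symmetric])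
        show "AE x in N. norm (h n x - a) \<le> \<kappa> + \<theta> * (2 * (h n x)\<^sup>2 + 2 * a\<^sup>2) + 1 / (4 * \<theta>) * indicator (B n) x"
          using Bc[OF n2]
        proof eventually_elim
          case (elim x)
          have nn: "0 \<le> \<theta> * (2 * (h n x)\<^sup>2 + 2 * a\<^sup>2)" using \<theta> by simp
          show ?case
          proof (cases "x \<in> B n")
            case True
            have "(h n x - a)\<^sup>2 \<le> 2 * (h n x)\<^sup>2 + 2 * a\<^sup>2"
            proof -
              have "0 \<le> (h n x + a)\<^sup>2" by simp
              then show ?thesis by (simp add: power2_sum power2_diff)
            qed
            then have "\<theta> * (h n x - a)\<^sup>2 \<le> \<theta> * (2 * (h n x)\<^sup>2 + 2 * a\<^sup>2)" using \<theta> by (intro mult_left_mono) auto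
            then show ?thesis using AMGM[OF \<theta>, of "h n x - a"] \<kappa> True by simp
          qed (use elim nn in simp)
        qed
      qed simp
      also have "\<dots> = \<kappa> + \<theta> * (2 * (\<integral>x. (h n x)\<^sup>2 \<partial>N) + 2 * a\<^sup>2) + 1 / (4 * \<theta>) * prob (B n)"
      proof -
        have "integrable N (indicat_real (B n))" by (auto simp: less_top[symmetric])
        then show ?thesis by (simp add: prob_space)
      qed
      also have "\<dots> \<le> \<kappa> + \<theta> * (2 * C + 2 * a\<^sup>2) + 1 / (4 * \<theta>) * (4 * \<theta> * \<kappa>)"
        using isq(2)[OF n2] n0[of n] n \<theta> by (intro add_mono mult_left_mono) auto
      also have "\<dots> \<le> \<kappa> + \<kappa> + \<kappa>" using \<theta> \<theta>2 by simp
      also have "\<dots> < r" using r by (simp add: \<kappa>_def)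
      finally show ?thesis .
    qed
    then show "\<exists>no. \<forall>n\<ge>no. norm ((\<integral>x. h n x \<partial>N) - a) < r" by blast
  qed
qed

section \<open>The scale and the normal tails\<close>

abbreviation gauss_scale :: "nat \<Rightarrow> real" where "gauss_scale n \<equiv> sqrt (2 * ln (real n))"

text \<open>At \<open>n = 1\<close> the scale is 0; from \<open>n = 2\<close> on it may be divided
  by and is at most its own square.\<close>

lemma gauss_scale_ge_1: "n \<ge> 2 \<Longrightarrow> 1 \<le> gauss_scale n"
proof -
  assume n: "n \<ge> 2"
  have "1 / 2 \<le> ln (2::real)" using ln2_ge_two_thirds by simp
  also have "\<dots> \<le> ln (real n)" using n by simp
  finally show ?thesis by (intro real_le_rsqrt) simp
qed

lemma exp_gauss_scale: "n \<ge> 1 \<Longrightarrow> real n = exp ((gauss_scale n)\<^sup>2 / 2)"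
  by (simp add: abs_of_nonneg)

lemma gauss_scale_at_top: "filterlim gauss_scale at_top sequentially"
  by real_asymp

text \<open>The density decreases on the unit interval from \<open>y\<close> to
  \<open>y + 1\<close>. The loss against the exact tail is of lower order than the Gaussian
  exponent, hence harmless when \<open>y\<close> is a proper fraction of the scale.\<close>

lemma std_normal_lower_tail_bound:
  assumes "0 \<le> y"
  shows "measure std_normal_distribution {x. x < y} \<le> 1 - std_normal_density (y + 1)"
proof -
  interpret prob_space std_normal_distribution by (rule prob_space_normal_density) simp
  have "ennreal (std_normal_density (y + 1)) = (\<integral>\<^sup>+x. ennreal (std_normal_density (y + 1)) * indicator {y..y+1} x \<partial>lborel)"
    by (subst nn_integral_cmult_indicator) auto
  also have "\<dots> \<le> (\<integral>\<^sup>+x. ennreal (std_normal_density x) * indicator {y..} x \<partial>lborel)"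
  proof (intro nn_integral_mono)
    fix x :: real
    show "ennreal (std_normal_density (y + 1)) * indicator {y..y+1} x \<le> ennreal (std_normal_density x) * indicator {y..} x"
    proof (cases "x \<in> {y..y+1}")
      case True
      then have "x\<^sup>2 \<le> (y + 1)\<^sup>2" using assms by (intro power_mono) auto
      then have "std_normal_density (y + 1) \<le> std_normal_density x"
        unfolding std_normal_density_def by (intro mult_left_mono) auto
      then show ?thesis using True by (simp add: ennreal_leI)
    qed simp
  qed
  also have "\<dots> = emeasure std_normal_distribution {y..}" by (subst emeasure_density) auto
  finally have "std_normal_density (y + 1) \<le> prob {y..}" by (simp add: emeasure_eq_measure)
  moreover have "prob {x. x < y} = 1 - prob {y..}"
  proof -
    have "{x. x < y} = space std_normal_distribution - {y..}" by auto
    then show ?thesis by (simp only: prob_compl sets_density sets_lborel atLeast_borel)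
  qed
  ultimately show ?thesis by simp
qed

lemma gaussian_sample_max_limit:
  assumes s: "0 \<le> s" and q: "q < s"
  shows "(\<lambda>n. (measure std_normal_distribution {x. s * x < gauss_scale n * q}) ^ n) \<longlonglongrightarrow> 0"
proof (cases "s = 0")
  \<comment> \<open>Here the projection vanishes and \<open>q\<close> is negative; the event is
    empty, and its power is 0 because \<open>n \<ge> 1\<close>.\<close>
  case True
  have "(measure std_normal_distribution {x. s * x < gauss_scale n * q}) ^ n = 0" if "n \<ge> 1" for n
  proof -
    have "gauss_scale n * q \<le> 0" using q True that by (intro mult_nonneg_nonpos) auto
    then have "{x. s * x < gauss_scale n * q} = {}" using True by auto
    then show ?thesis using that by simp
  qed
  then show ?thesis by (intro tendsto_eventually eventually_sequentiallyI[of 1])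
next
  case False
  interpret prob_space std_normal_distribution by (rule prob_space_normal_density) simp
  \<comment> \<open>The tail bound asks for a nonnegative argument, so a negative threshold is
    raised to 0; what matters is \<open>\<kappa> < 1\<close>.\<close>
  define \<kappa> where "\<kappa> = max 0 (q / s)"
  have \<kappa>: "0 \<le> \<kappa>" "\<kappa> < 1" using False s q by (auto simp: \<kappa>_def)
  have bound: "(measure std_normal_distribution {x. s * x < gauss_scale n * q}) ^ n
      \<le> exp (- (real n * std_normal_density (\<kappa> * gauss_scale n + 1)))" if n: "n \<ge> 1" for n
  proof -
    have b: "0 \<le> gauss_scale n" using n by simp
    have "prob {x. s * x < gauss_scale n * q} \<le> prob {x. x < \<kappa> * gauss_scale n}"
    proof (rule finite_measure_mono)
      show "{x. s * x < gauss_scale n * q} \<subseteq> {x. x < \<kappa> * gauss_scale n}"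
      proof clarify
        fix x assume "s * x < gauss_scale n * q"
        then have "x < (q / s) * gauss_scale n" using False s by (simp add: field_simps)
        also have "\<dots> \<le> \<kappa> * gauss_scale n" using b by (intro mult_right_mono) (auto simp: \<kappa>_def)
        finally show "x < \<kappa> * gauss_scale n" .
      qed
    qed simp
    also have "\<dots> \<le> 1 - std_normal_density (\<kappa> * gauss_scale n + 1)"
      using \<kappa> b by (intro std_normal_lower_tail_bound) auto
    also have "\<dots> \<le> exp (- std_normal_density (\<kappa> * gauss_scale n + 1))"
      using exp_ge_add_one_self[of "- std_normal_density (\<kappa> * gauss_scale n + 1)"] by simp
    finally have "(prob {x. s * x < gauss_scale n * q}) ^ n \<le> exp (- std_normal_density (\<kappa> * gauss_scale n + 1)) ^ n"
      by (intro power_mono) auto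
    then show ?thesis by (simp add: exp_of_nat_mult[symmetric])
  qed
  \<comment> \<open>Apart from factors of at most linear exponent in the scale \<open>b\<close>, the
    expected number of copies beyond the threshold grows like
    \<open>exp (\<alpha> * b\<^sup>2)\<close>.\<close>
  define \<alpha> where "\<alpha> = (1 - \<kappa>\<^sup>2) / 2"
  have \<alpha>: "0 < \<alpha>" using \<kappa> by (simp add: \<alpha>_def power_less_one_iff abs_square_less_1)
  have eq: "real n * std_normal_density (\<kappa> * gauss_scale n + 1)
      = 1 / sqrt (2 * pi) * exp (\<alpha> * (gauss_scale n)\<^sup>2 - \<kappa> * gauss_scale n - 1 / 2)" if n: "n \<ge> 1" for n
  proof -
    have "real n * std_normal_density (\<kappa> * gauss_scale n + 1)
       = 1 / sqrt (2 * pi) * (exp ((gauss_scale n)\<^sup>2 / 2) * exp (- (\<kappa> * gauss_scale n + 1)\<^sup>2 / 2))"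
      unfolding std_normal_density_def by (subst exp_gauss_scale[OF n]) simp
    also have "exp ((gauss_scale n)\<^sup>2 / 2) * exp (- (\<kappa> * gauss_scale n + 1)\<^sup>2 / 2)
       = exp (\<alpha> * (gauss_scale n)\<^sup>2 - \<kappa> * gauss_scale n - 1 / 2)"
    proof -
      have "b\<^sup>2 / 2 + - (\<kappa> * b + 1)\<^sup>2 / 2 = \<alpha> * b\<^sup>2 - \<kappa> * b - 1 / 2" for b
        by (simp add: \<alpha>_def power2_eq_square field_simps)
      then show ?thesis by (simp only: exp_add[symmetric])
    qed
    finally show ?thesis .
  qed
  have lim: "((\<lambda>x. exp (- (1 / sqrt (2 * pi) * exp (\<alpha> * x\<^sup>2 - \<kappa> * x - 1 / 2)))) \<longlongrightarrow> 0) at_top"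
    using \<alpha> by real_asymp
  have "(\<lambda>n. exp (- (real n * std_normal_density (\<kappa> * gauss_scale n + 1)))) \<longlonglongrightarrow> 0"
  proof (rule Lim_transform_eventually[OF filterlim_compose[OF lim gauss_scale_at_top]])
    show "\<forall>\<^sub>F n in sequentially. exp (- (1 / sqrt (2 * pi) * exp (\<alpha> * (gauss_scale n)\<^sup>2 - \<kappa> * gauss_scale n - 1 / 2)))
      = exp (- (real n * std_normal_density (\<kappa> * gauss_scale n + 1)))"
      by (rule eventually_sequentiallyI[of 1]) (simp only: eq)
  qed
  then show ?thesis
    by (rule tendsto_sandwich[OF _ _ tendsto_const, rotated 2])
      (auto intro!: eventually_sequentiallyI[of 1] bound)
qed

lemma gaussian_sup_tail_limit:
  assumes \<sigma>: "0 \<le> \<sigma>" and q: "\<sigma> < q"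
  shows "(\<lambda>n. real n * (exp ((gauss_scale n / q)\<^sup>2 * \<sigma>\<^sup>2 / 2 + gauss_scale n / q * m)
    * exp (- (gauss_scale n / q * (gauss_scale n * q))))) \<longlonglongrightarrow> 0"
proof -
  define \<alpha> where "\<alpha> = (1 - (\<sigma> / q)\<^sup>2) / 2"
  have q0: "0 < q" using \<sigma> q by simp
  have "\<sigma> / q < 1" "0 \<le> \<sigma> / q" using \<sigma> q by auto
  then have \<alpha>: "0 < \<alpha>" by (simp add: \<alpha>_def abs_square_less_1)
  have lim: "((\<lambda>x. exp (- \<alpha> * x\<^sup>2 + m / q * x)) \<longlongrightarrow> 0) at_top"
    using \<alpha> by real_asymp
  show ?thesis
  proof (rule Lim_transform_eventually[OF filterlim_compose[OF lim gauss_scale_at_top]], rule eventually_sequentiallyI[of 1])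
    fix n :: nat assume n: "n \<ge> 1"
    have "real n * (exp ((gauss_scale n / q)\<^sup>2 * \<sigma>\<^sup>2 / 2 + gauss_scale n / q * m) * exp (- (gauss_scale n / q * (gauss_scale n * q))))
      = exp ((gauss_scale n)\<^sup>2 / 2) * (exp ((gauss_scale n / q)\<^sup>2 * \<sigma>\<^sup>2 / 2 + gauss_scale n / q * m) * exp (- (gauss_scale n / q * (gauss_scale n * q))))"
      by (subst exp_gauss_scale[OF n]) (rule refl)
    also have "\<dots> = exp (- \<alpha> * (gauss_scale n)\<^sup>2 + m / q * gauss_scale n)"
    proof -
      have "b\<^sup>2 / 2 + ((b / q)\<^sup>2 * \<sigma>\<^sup>2 / 2 + b / q * m + - (b / q * (b * q))) = - \<alpha> * b\<^sup>2 + m / q * b" for b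
        using q0 by (simp add: \<alpha>_def power2_eq_square field_simps)
      then show ?thesis by (simp only: exp_add[symmetric])
    qed
    finally show "exp (- \<alpha> * (gauss_scale n)\<^sup>2 + m / q * gauss_scale n)
      = real n * (exp ((gauss_scale n / q)\<^sup>2 * \<sigma>\<^sup>2 / 2 + gauss_scale n / q * m) * exp (- (gauss_scale n / q * (gauss_scale n * q))))" by simp
  qed
qed

text \<open>The rate \<open>1 / k\<close> is left free because a norm is bounded only by the
  dimension times a linear functional; \<open>k\<close> will be the dimension.\<close>

lemma power_conv_square_le_exp:
  assumes p: "0 \<le> p" and k: "0 < k"
  obtains C where "0 \<le> C" "\<And>r. 0 \<le> r \<Longrightarrow> (power_conv r p)\<^sup>2 \<le> C * exp (r / k)"
proof -
  obtain m :: nat where m: "p \<le> real m" using real_arch_simple by blast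
  \<comment> \<open>This factor gives
    \<open>1 + r \<le> d * exp (r / (2 * real (Suc m) * k))\<close>, and raising to the power
    \<open>2 * Suc m\<close> restores the rate \<open>1 / k\<close>.\<close>
  define d where "d = max 1 (2 * real (Suc m) * k)"
  have d: "1 \<le> d" "2 * real (Suc m) * k \<le> d" by (auto simp: d_def)
  have "(power_conv r p)\<^sup>2 \<le> d ^ (2 * Suc m) * exp (r / k)" if r: "0 \<le> r" for r
  proof -
    let ?k = "2 * real (Suc m) * k"
    have k1: "0 < ?k" using k by simp
    have "power_conv r p \<le> (1 + r) ^ Suc m"
    proof (cases "r = 0")
      case True
      then show ?thesis by (simp add: power_conv_def)
    next
      case False
      then have "power_conv r p = r powr p" by (simp add: power_conv_def)
      also have "\<dots> \<le> (1 + r) powr p" using r p by (intro powr_mono2) auto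
      also have "\<dots> \<le> (1 + r) powr real (Suc m)" using r m by (intro powr_mono) auto
      also have "\<dots> = (1 + r) ^ Suc m" using r by (intro powr_realpow) auto
      finally show ?thesis .
    qed
    then have "(power_conv r p)\<^sup>2 \<le> ((1 + r) ^ Suc m)\<^sup>2"
      by (intro power_mono) (auto simp: power_conv_def)
    also have "\<dots> = (1 + r) ^ (2 * Suc m)" by (subst power_mult[symmetric]) (simp only: mult.commute)
    also have "\<dots> \<le> (d * exp (r / ?k)) ^ (2 * Suc m)"
    proof (intro power_mono)
      have "r * 1 \<le> r * (d / ?k)" using r d(2) k1 by (intro mult_left_mono) auto
      then have "1 + r \<le> d * (1 + r / ?k)" using d(1) by (simp add: distrib_left mult.commute)
      also have "\<dots> \<le> d * exp (r / ?k)" using d(1) exp_ge_add_one_self[of "r / ?k"] by (intro mult_left_mono) auto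
      finally show "1 + r \<le> d * exp (r / ?k)" .
    qed (use r in auto)
    also have "\<dots> = d ^ (2 * Suc m) * exp (r / k)"
    proof -
      have "exp (r / ?k) ^ (2 * Suc m) = exp (real (2 * Suc m) * (r / ?k))" by (rule exp_of_nat_mult[symmetric])
      also have "real (2 * Suc m) * (r / ?k) = r / k" using k by (simp add: divide_simps)
      finally show ?thesis by (simp only: power_mult_distrib)
    qed
    finally show ?thesis .
  qed
  then show thesis using d by (intro that[of "d ^ (2 * Suc m)"]) auto
qed

subsection \<open>Convergence of the scaled hulls\<close>

lemma hausdorff_dist_commute: "hausdorff_dist A B = hausdorff_dist B A"
  by (simp add: hausdorff_dist_def max.commute)

lemma sets_countable_Bex:
  assumes "countable C" "\<And>t. t \<in> C \<Longrightarrow> {x \<in> space M. P t x} \<in> sets M"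
  shows "{x \<in> space M. \<exists>t\<in>C. P t x} \<in> sets M"
proof -
  have "{x \<in> space M. \<exists>t\<in>C. P t x} = (\<Union>t\<in>C. {x \<in> space M. P t x})" by auto
  also have "\<dots> \<in> sets M" using assms by (intro sets.countable_UN') auto
  finally show ?thesis .
qed

lemma tendsto_prob_finite_UN:
  assumes N: "prob_space N" and U: "finite U" and m: "\<And>u n. u \<in> U \<Longrightarrow> E u n \<in> sets N"
    and lim: "\<And>u. u \<in> U \<Longrightarrow> (\<lambda>n::nat. measure N (E u n)) \<longlonglongrightarrow> 0"
  shows "(\<lambda>n. measure N (\<Union>u\<in>U. E u n)) \<longlonglongrightarrow> 0"
proof -
  interpret prob_space N by fact
  have "(\<lambda>n. \<Sum>u\<in>U. prob (E u n)) \<longlonglongrightarrow> (\<Sum>u\<in>U. 0)" by (intro tendsto_sum lim)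
  then have sum: "(\<lambda>n. \<Sum>u\<in>U. prob (E u n)) \<longlonglongrightarrow> 0" by simp
  have le: "prob (\<Union>u\<in>U. E u n) \<le> (\<Sum>u\<in>U. prob (E u n))" for n
    using U m by (intro finite_measure_subadditive_finite) auto
  show ?thesis
    by (rule tendsto_sandwich[OF _ _ tendsto_const sum]; rule always_eventually; intro allI measure_nonneg le)
qed

section \<open>Suprema of the sample and the scaled hulls\<close>

context gaussian_sample
begin

abbreviation "W \<equiv> limit_hull M T X"

lemma exceed_sets:
  assumes "countable S" "S \<subseteq> T"
  shows "{\<omega> \<in> space N. \<exists>i\<in>{1..n}. \<exists>t\<in>S. y < u \<bullet> Xs i t \<omega>} \<in> sets N"
    "i \<ge> 1 \<Longrightarrow> {\<omega> \<in> space N. \<exists>t\<in>S. y < u \<bullet> Xs i t \<omega>} \<in> sets N"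
proof -
  show *: "{\<omega> \<in> space N. \<exists>t\<in>S. y < u \<bullet> Xs i t \<omega>} \<in> sets N" if "i \<ge> 1" for i
    using assms(1)
  proof (rule sets_countable_Bex)
    fix t assume "t \<in> S"
    then have [measurable]: "Xs i t \<in> borel_measurable N" using that assms(2) by auto
    show "{\<omega> \<in> space N. y < u \<bullet> Xs i t \<omega>} \<in> sets N" by measurable
  qed
  show "{\<omega> \<in> space N. \<exists>i\<in>{1..n}. \<exists>t\<in>S. y < u \<bullet> Xs i t \<omega>} \<in> sets N"
    by (rule sets_countable_Bex) (auto intro: *)
qed

lemma below_sets:
  assumes "t \<in> T"
  shows "{\<omega> \<in> space N. \<forall>i\<in>{1..n}. u \<bullet> Xs i t \<omega> < y} \<in> sets N"
proof (rule sets_countable_Ball)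
  fix i assume "i \<in> {1..n}"
  then have [measurable]: "Xs i t \<in> borel_measurable N" using assms by auto
  show "{\<omega> \<in> space N. u \<bullet> Xs i t \<omega> < y} \<in> sets N" by measurable
qed simp

lemma sup_measurable:
  assumes "countable S" "S \<subseteq> T" "i \<ge> 1"
  shows "(\<lambda>\<omega>. SUP t\<in>S. ennreal (exp (c * (u \<bullet> Xs i t \<omega>)))) \<in> borel_measurable N"
proof (rule borel_measurable_SUP[OF assms(1)])
  fix t assume "t \<in> S"
  then have [measurable]: "Xs i t \<in> borel_measurable N" using assms by auto
  show "(\<lambda>\<omega>. ennreal (exp (c * (u \<bullet> Xs i t \<omega>)))) \<in> borel_measurable N" by measurable
qed

text \<open>Markov's inequality for the exponential of the supremum over \<open>S\<close>.\<close>

lemma sample_exceed_prob: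
  assumes S: "countable S" "S \<subseteq> T" "S \<noteq> {}" and i: "i \<ge> 1" and u: "norm u = 1" and c: "0 \<le> c"
    and K: "\<And>F. finite F \<Longrightarrow> F \<subseteq> T \<Longrightarrow> 1/2 \<le> prob {\<omega> \<in> space M. \<forall>t\<in>F. norm (X t \<omega>) \<le> K}"
    and \<sigma>: "\<And>t. t \<in> T \<Longrightarrow> sd u t \<le> \<sigma>"
  shows "N.prob {\<omega> \<in> space N. \<exists>t\<in>S. y < u \<bullet> Xs i t \<omega>}
    \<le> exp (c\<^sup>2 * \<sigma>\<^sup>2 / 2 + c * (K + \<sigma>\<^sup>2 / 2 + ln 2)) * exp (- (c * y))"
proof -
  let ?E = "{\<omega> \<in> space N. \<exists>t\<in>S. y < u \<bullet> Xs i t \<omega>}"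
  let ?s = "\<lambda>\<omega>. SUP t\<in>S. ennreal (exp (c * (u \<bullet> Xs i t \<omega>)))"
  have "emeasure N ?E = (\<integral>\<^sup>+\<omega>. indicator ?E \<omega> \<partial>N)"
    using exceed_sets(2)[OF S(1,2) i] by (intro nn_integral_indicator[symmetric])
  also have "\<dots> \<le> (\<integral>\<^sup>+\<omega>. ennreal (exp (- (c * y))) * ?s \<omega> \<partial>N)"
  proof (rule nn_integral_mono)
    fix \<omega>
    show "indicator ?E \<omega> \<le> ennreal (exp (- (c * y))) * ?s \<omega>"
    proof (cases "\<omega> \<in> ?E")
      case True
      then obtain t where t: "t \<in> S" "y < u \<bullet> Xs i t \<omega>" by auto
      have "c * y \<le> c * (u \<bullet> Xs i t \<omega>)" using c t(2) by (intro mult_left_mono) auto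
      then have "1 \<le> exp (- (c * y)) * exp (c * (u \<bullet> Xs i t \<omega>))" by (simp add: exp_add[symmetric])
      then have "(1::ennreal) \<le> ennreal (exp (- (c * y)) * exp (c * (u \<bullet> Xs i t \<omega>)))" by simp
      also have "\<dots> = ennreal (exp (- (c * y))) * ennreal (exp (c * (u \<bullet> Xs i t \<omega>)))" by (simp add: ennreal_mult)
      also have "\<dots> \<le> ennreal (exp (- (c * y))) * ?s \<omega>" using t(1) by (intro mult_left_mono SUP_upper) auto
      finally show ?thesis using True by simp
    qed simp
  qed
  also have "\<dots> = ennreal (exp (- (c * y))) * (\<integral>\<^sup>+\<omega>. ?s \<omega> \<partial>N)"
    using S i by (intro nn_integral_cmult sup_measurable)
  also have "\<dots> \<le> ennreal (exp (- (c * y))) * ennreal (exp (c\<^sup>2 * \<sigma>\<^sup>2 / 2 + c * (K + \<sigma>\<^sup>2 / 2 + ln 2)))"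
    by (intro mult_left_mono sample_sup_mgf[OF S i u c K \<sigma>]) auto
  finally show ?thesis by (simp add: N.emeasure_eq_measure ennreal_mult[symmetric] mult.commute)
qed

lemma upper_limit:
  assumes S: "countable S" "S \<subseteq> T" "S \<noteq> {}" and u: "norm u = 1" and q: "support_fun W u < q"
  shows "(\<lambda>n. N.prob {\<omega> \<in> space N. \<exists>i\<in>{1..n}. \<exists>t\<in>S. gauss_scale n * q < u \<bullet> Xs i t \<omega>}) \<longlonglongrightarrow> 0"
proof -
  obtain K where K: "0 \<le> K" "\<And>F. finite F \<Longrightarrow> F \<subseteq> T \<Longrightarrow> 1/2 \<le> prob {\<omega> \<in> space M. \<forall>t\<in>F. norm (X t \<omega>) \<le> K}"
    using median_bound by blast
  define \<sigma> where "\<sigma> = support_fun W u"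
  have \<sigma>: "0 \<le> \<sigma>" "\<sigma> < q" using q support_limit_hull_nonneg by (auto simp: \<sigma>_def)
  let ?m = "K + \<sigma>\<^sup>2 / 2 + ln 2"
  let ?b = "\<lambda>n. real n * (exp ((gauss_scale n / q)\<^sup>2 * \<sigma>\<^sup>2 / 2 + gauss_scale n / q * ?m) * exp (- (gauss_scale n / q * (gauss_scale n * q))))"
  have bound: "N.prob {\<omega> \<in> space N. \<exists>i\<in>{1..n}. \<exists>t\<in>S. gauss_scale n * q < u \<bullet> Xs i t \<omega>} \<le> ?b n" if n: "n \<ge> 1" for n
  proof -
    let ?E = "\<lambda>i. {\<omega> \<in> space N. \<exists>t\<in>S. gauss_scale n * q < u \<bullet> Xs i t \<omega>}"
    have c: "0 \<le> gauss_scale n / q" using n \<sigma> by (intro divide_nonneg_nonneg) auto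
    have "{\<omega> \<in> space N. \<exists>i\<in>{1..n}. \<exists>t\<in>S. gauss_scale n * q < u \<bullet> Xs i t \<omega>} = (\<Union>i\<in>{1..n}. ?E i)" by auto
    also have "N.prob \<dots> \<le> (\<Sum>i\<in>{1..n}. N.prob (?E i))"
      using exceed_sets(2)[OF S(1,2)] by (intro N.finite_measure_subadditive_finite) auto
    also have "\<dots> \<le> (\<Sum>i\<in>{1..n}. exp ((gauss_scale n / q)\<^sup>2 * \<sigma>\<^sup>2 / 2 + gauss_scale n / q * ?m) * exp (- (gauss_scale n / q * (gauss_scale n * q))))"
    proof (rule sum_mono)
      fix i assume "i \<in> {1..n}"
      then have "i \<ge> 1" by simp
      then show "N.prob (?E i) \<le> exp ((gauss_scale n / q)\<^sup>2 * \<sigma>\<^sup>2 / 2 + gauss_scale n / q * ?m) * exp (- (gauss_scale n / q * (gauss_scale n * q)))"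
        unfolding \<sigma>_def by (rule sample_exceed_prob[OF S _ u c K(2) support_limit_hull(1)])
    qed
    also have "\<dots> = ?b n" by simp
    finally show ?thesis .
  qed
  show ?thesis
  proof (rule tendsto_sandwich[OF _ _ tendsto_const gaussian_sup_tail_limit[OF \<sigma>, of ?m]])
    show "\<forall>\<^sub>F n in sequentially. N.prob {\<omega> \<in> space N. \<exists>i\<in>{1..n}. \<exists>t\<in>S. gauss_scale n * q < u \<bullet> Xs i t \<omega>} \<le> ?b n"
      using bound by (rule eventually_sequentiallyI[of 1])
  qed (rule always_eventually, simp)
qed

lemma lower_limit:
  assumes t: "t \<in> T" and q: "q < sd u t"
  shows "(\<lambda>n. N.prob {\<omega> \<in> space N. \<forall>i\<in>{1..n}. u \<bullet> Xs i t \<omega> < gauss_scale n * q}) \<longlonglongrightarrow> 0"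
proof (rule Lim_transform_eventually[OF gaussian_sample_max_limit[OF sd_nonneg q]])
  show "\<forall>\<^sub>F n in sequentially. (measure std_normal_distribution {x. sd u t * x < gauss_scale n * q}) ^ n
    = N.prob {\<omega> \<in> space N. \<forall>i\<in>{1..n}. u \<bullet> Xs i t \<omega> < gauss_scale n * q}"
    using sample_max_below[OF t] by (intro eventually_sequentiallyI[of 1]) simp
qed

text \<open>With \<open>b\<close> the scale, \<open>exp s \<le> exp r (1 + exp (b\<^sup>2 (s - r)))\<close> for \<open>b \<ge> 1\<close>: the exponential moments of
  the scaled suprema are thus bounded by those of the suprema themselves, taken at the level \<open>b\<close>.\<close>

definition tail_sum :: "'t set \<Rightarrow> real \<Rightarrow> real^'d \<Rightarrow> nat \<Rightarrow> 'v \<Rightarrow> ennreal" where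
  "tail_sum S r e n \<omega> = ennreal (exp (- ((gauss_scale n)\<^sup>2 * r)))
     * (\<Sum>i\<in>{1..n}. SUP t\<in>S. ennreal (exp (gauss_scale n * (e \<bullet> Xs i t \<omega>))))"

text \<open>One \<open>r\<close> serves all directions and all \<open>n\<close>, because
  \<open>2 * K\<close> bounds the standard deviation in every unit direction.\<close>

lemma tail_sum_integral:
  assumes S: "countable S" "S \<subseteq> T" "S \<noteq> {}"
  obtains r where "\<And>e n. norm e = 1 \<Longrightarrow> n \<ge> 2 \<Longrightarrow> (\<integral>\<^sup>+\<omega>. tail_sum S r e n \<omega> \<partial>N) \<le> 1"
proof -
  obtain K where K: "0 \<le> K" "\<And>F. finite F \<Longrightarrow> F \<subseteq> T \<Longrightarrow> 1/2 \<le> prob {\<omega> \<in> space M. \<forall>t\<in>F. norm (X t \<omega>) \<le> K}"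
    using median_bound by blast
  define \<sigma> where "\<sigma> = 2 * K"
  define m where "m = K + \<sigma>\<^sup>2 / 2 + ln 2"
  have m: "0 \<le> m" using K(1) by (simp add: m_def)
  \<comment> \<open>The three terms absorb the number of copies \<open>exp (b\<^sup>2 / 2)\<close>,
    the Gaussian exponent and the linear term, the last by \<open>b \<le> b\<^sup>2\<close>.\<close>
  define r where "r = 1 / 2 + \<sigma>\<^sup>2 / 2 + m"
  show thesis
  proof (rule that[of r])
    fix e :: "real^'d" and n :: nat assume e: "norm e = 1" and n: "n \<ge> 2"
    define b where "b = gauss_scale n"
    have b: "1 \<le> b" using gauss_scale_ge_1[OF n] by (simp add: b_def)
    have nb: "real n = exp (b\<^sup>2 / 2)" unfolding b_def using n by (intro exp_gauss_scale) simp
    have "(\<integral>\<^sup>+\<omega>. tail_sum S r e n \<omega> \<partial>N)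
      = ennreal (exp (- (b\<^sup>2 * r))) * (\<Sum>i\<in>{1..n}. \<integral>\<^sup>+\<omega>. (SUP t\<in>S. ennreal (exp (b * (e \<bullet> Xs i t \<omega>)))) \<partial>N)"
    proof -
      have sm: "(\<lambda>\<omega>. SUP t\<in>S. ennreal (exp (b * (e \<bullet> Xs i t \<omega>)))) \<in> borel_measurable N" if "i \<in> {1..n}" for i
        using that by (intro sup_measurable[OF S(1,2)]) simp
      show ?thesis
        unfolding tail_sum_def b_def[symmetric]
        by (subst nn_integral_sum[OF sm, symmetric], assumption, rule nn_integral_cmult, rule borel_measurable_sum, rule sm)
    qed
    also have "\<dots> \<le> ennreal (exp (- (b\<^sup>2 * r))) * (\<Sum>i\<in>{1..n}. ennreal (exp (b\<^sup>2 * \<sigma>\<^sup>2 / 2 + b * m)))"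
    proof (intro mult_left_mono sum_mono)
      fix i assume "i \<in> {1..n}"
      then have i: "i \<ge> 1" by simp
      show "(\<integral>\<^sup>+\<omega>. (SUP t\<in>S. ennreal (exp (b * (e \<bullet> Xs i t \<omega>)))) \<partial>N) \<le> ennreal (exp (b\<^sup>2 * \<sigma>\<^sup>2 / 2 + b * m))"
        unfolding m_def
      proof (rule sample_sup_mgf[OF S i e _ K(2)])
        show "sd e t \<le> \<sigma>" if "t \<in> T" for t unfolding \<sigma>_def by (rule sd_bounded[OF K that e])
      qed (use b in simp_all)
    qed simp
    also have "\<dots> = ennreal (exp (- (b\<^sup>2 * r)) * (exp (b\<^sup>2 / 2) * exp (b\<^sup>2 * \<sigma>\<^sup>2 / 2 + b * m)))"
      by (simp add: ennreal_mult ennreal_of_nat_eq_real_of_nat nb[symmetric])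
    also have "\<dots> \<le> ennreal 1"
    proof (rule ennreal_leI)
      have "b * m \<le> b\<^sup>2 * m" using b m by (intro mult_right_mono) (auto simp: power2_eq_square)
      then have "- (b\<^sup>2 * r) + (b\<^sup>2 / 2 + (b\<^sup>2 * \<sigma>\<^sup>2 / 2 + b * m)) \<le> 0" by (simp add: r_def field_simps)
      then show "exp (- (b\<^sup>2 * r)) * (exp (b\<^sup>2 / 2) * exp (b\<^sup>2 * \<sigma>\<^sup>2 / 2 + b * m)) \<le> 1"
        by (simp add: exp_add[symmetric])
    qed
    finally show "(\<integral>\<^sup>+\<omega>. tail_sum S r e n \<omega> \<partial>N) \<le> 1" by simp
  qed
qed

text \<open>The almost sure condition that makes the geometry deterministic: compactness of a hull
  and its description by \<open>S\<close> are proved for a fixed \<open>\<omega>\<close> satisfying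
  it.\<close>

definition good_path :: "'t set \<Rightarrow> 'v \<Rightarrow> bool" where
  "good_path S \<omega> \<longleftrightarrow> (\<forall>i\<ge>1. bounded ((\<lambda>t. Xs i t \<omega>) ` T) \<and> (\<forall>t\<in>T. Xs i t \<omega> \<in> closure ((\<lambda>t. Xs i t \<omega>) ` S)))"

definition scaled_hull :: "nat \<Rightarrow> 'v \<Rightarrow> (real^'d) set" where
  "scaled_hull n \<omega> = (*\<^sub>R) (1 / gauss_scale n) ` sample_hull T Xs n \<omega>"

text \<open>Closed hulls do not distinguish a set from a dense subset, so on a good path countably
  many points determine the sample hull.\<close>

lemma sample_hull_separant:
  assumes S: "S \<subseteq> T" and good: "good_path S \<omega>"
  shows "sample_hull T Xs n \<omega> = closed_conv {Xs i t \<omega> | i t. i \<in> {1..n} \<and> t \<in> S}"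
proof
  show "sample_hull T Xs n \<omega> \<subseteq> closed_conv {Xs i t \<omega> | i t. i \<in> {1..n} \<and> t \<in> S}"
    unfolding sample_hull_def
  proof (rule closed_conv_minimal)
    show "{Xs i t \<omega> | i t. i \<in> {1..n} \<and> t \<in> T} \<subseteq> closed_conv {Xs i t \<omega> | i t. i \<in> {1..n} \<and> t \<in> S}"
    proof clarify
      fix i t assume i: "i \<in> {1..n}" and t: "t \<in> T"
      have "Xs i t \<omega> \<in> closure ((\<lambda>t. Xs i t \<omega>) ` S)" using good i t by (simp add: good_path_def)
      moreover have "(\<lambda>t. Xs i t \<omega>) ` S \<subseteq> convex hull {Xs i t \<omega> | i t. i \<in> {1..n} \<and> t \<in> S}"
        using i by (auto intro!: hull_inc)
      ultimately show "Xs i t \<omega> \<in> closed_conv {Xs i t \<omega> | i t. i \<in> {1..n} \<and> t \<in> S}"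
        unfolding closed_conv_def using closure_mono by blast
    qed
  qed (simp_all add: closed_conv_def convex_closure)
  show "closed_conv {Xs i t \<omega> | i t. i \<in> {1..n} \<and> t \<in> S} \<subseteq> sample_hull T Xs n \<omega>"
    unfolding sample_hull_def closed_conv_def using S by (intro closure_mono hull_mono) auto
qed

lemma sample_points_bounded:
  assumes "good_path S \<omega>"
  shows "bounded {Xs i t \<omega> | i t. i \<in> {1..n} \<and> t \<in> T}"
proof -
  have "{Xs i t \<omega> | i t. i \<in> {1..n} \<and> t \<in> T} = (\<Union>i\<in>{1..n}. (\<lambda>t. Xs i t \<omega>) ` T)" by blast
  also have "bounded \<dots>" using assms by (intro bounded_UN) (auto simp: good_path_def)
  finally show ?thesis .
qed

lemma sample_hull_compact_convex:
  assumes "good_path S \<omega>" "n \<ge> 1"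
  shows "sample_hull T Xs n \<omega> \<in> compact_convex_sets"
  unfolding sample_hull_def
proof (rule closed_conv_compact_convex[OF sample_points_bounded[OF assms(1)]])
  obtain t where "t \<in> T" using T_ne by blast
  then show "{Xs i t \<omega> | i t. i \<in> {1..n} \<and> t \<in> T} \<noteq> {}" using assms(2) by auto
qed

lemma scaled_hull_compact_convex:
  "good_path S \<omega> \<Longrightarrow> n \<ge> 1 \<Longrightarrow> scaled_hull n \<omega> \<in> compact_convex_sets"
  using sample_hull_compact_convex[of S \<omega> n]
  by (auto simp: scaled_hull_def compact_convex_sets_def intro: compact_scaling convex_scaling)

lemma scaled_hull_upper:
  assumes S: "S \<subseteq> T" and good: "good_path S \<omega>" and n: "n \<ge> 2"
    and le: "\<And>i t. i \<in> {1..n} \<Longrightarrow> t \<in> S \<Longrightarrow> u \<bullet> Xs i t \<omega> \<le> gauss_scale n * q"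
    and x: "x \<in> scaled_hull n \<omega>"
  shows "u \<bullet> x \<le> q"
proof -
  have b: "0 < gauss_scale n" using gauss_scale_ge_1[OF n] by linarith
  have "sample_hull T Xs n \<omega> \<subseteq> {z. u \<bullet> z \<le> gauss_scale n * q}"
    unfolding sample_hull_separant[OF S good]
    using le by (intro closed_conv_minimal closed_halfspace_le convex_halfspace_le) auto
  moreover obtain z where z: "z \<in> sample_hull T Xs n \<omega>" "x = (1 / gauss_scale n) *\<^sub>R z"
    using x by (auto simp: scaled_hull_def)
  ultimately have "u \<bullet> z \<le> gauss_scale n * q" by auto
  then show ?thesis using b by (simp add: z(2) field_simps)
qed

lemma scaled_hull_mem: "i \<in> {1..n} \<Longrightarrow> t \<in> T \<Longrightarrow> (1 / gauss_scale n) *\<^sub>R Xs i t \<omega> \<in> scaled_hull n \<omega>"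
  unfolding scaled_hull_def sample_hull_def by (intro imageI subsetD[OF subset_closed_conv]) auto

text \<open>With \<open>b\<close> the scale and \<open>L\<close> the logarithm of the tail sum, cut
  off below at 0, each term of the tail sum gives
  \<open>b * (e \<bullet> Xs i t \<omega>) \<le> b\<^sup>2 * r + L\<close>. The cutoff and
  \<open>b \<ge> 1\<close> give \<open>L \<le> b\<^sup>2 * L\<close>, and dividing by
  \<open>b\<close> twice bounds the scaled point by \<open>r + L\<close>.\<close>

lemma scaled_hull_exp_bound:
  assumes S: "S \<subseteq> T" and good: "good_path S \<omega>" and n: "n \<ge> 2" and x: "x \<in> scaled_hull n \<omega>"
  shows "ennreal (exp (e \<bullet> x)) \<le> ennreal (exp r) * (1 + tail_sum S r e n \<omega>)"
proof (cases "tail_sum S r e n \<omega>")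
  case (real v)
  define b where "b = gauss_scale n"
  have b: "1 \<le> b" using gauss_scale_ge_1[OF n] by (simp add: b_def)
  define L where "L = ln (max v 1)"
  have L: "0 \<le> L" "exp L = max v 1" by (auto simp: L_def)
  have "e \<bullet> x \<le> r + L"
  proof (rule scaled_hull_upper[OF S good n _ x])
    fix i t assume i: "i \<in> {1..n}" and t: "t \<in> S"
    have "ennreal (exp (- (b\<^sup>2 * r)) * exp (b * (e \<bullet> Xs i t \<omega>)))
      = ennreal (exp (- (b\<^sup>2 * r))) * ennreal (exp (b * (e \<bullet> Xs i t \<omega>)))" by (simp add: ennreal_mult)
    also have "\<dots> \<le> tail_sum S r e n \<omega>"
      unfolding tail_sum_def b_def[symmetric]
    proof (intro mult_left_mono)
      have "ennreal (exp (b * (e \<bullet> Xs i t \<omega>))) \<le> (SUP t\<in>S. ennreal (exp (b * (e \<bullet> Xs i t \<omega>))))"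
        using t by (rule SUP_upper)
      also have "\<dots> \<le> (\<Sum>i\<in>{1..n}. SUP t\<in>S. ennreal (exp (b * (e \<bullet> Xs i t \<omega>))))"
        using i by (intro member_le_sum) auto
      finally show "ennreal (exp (b * (e \<bullet> Xs i t \<omega>))) \<le> (\<Sum>i\<in>{1..n}. SUP t\<in>S. ennreal (exp (b * (e \<bullet> Xs i t \<omega>))))" .
    qed simp
    also have "\<dots> \<le> ennreal (exp L)" using real by (simp add: L(2) ennreal_leI)
    finally have "exp (- (b\<^sup>2 * r)) * exp (b * (e \<bullet> Xs i t \<omega>)) \<le> exp L" by simp
    then have "- (b\<^sup>2 * r) + b * (e \<bullet> Xs i t \<omega>) \<le> L" by (simp only: exp_add[symmetric] exp_le_cancel_iff)
    then have "b * (e \<bullet> Xs i t \<omega>) \<le> b\<^sup>2 * r + L" by simp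
    also have "L \<le> b\<^sup>2 * L" using b L(1) mult_right_mono[of 1 "b\<^sup>2" L] by simp
    finally have "b * (e \<bullet> Xs i t \<omega>) \<le> b * (b * (r + L))" by (simp add: power2_eq_square algebra_simps)
    then show "e \<bullet> Xs i t \<omega> \<le> gauss_scale n * (r + L)" using b by (simp add: b_def)
  qed
  then have "exp (e \<bullet> x) \<le> exp r * exp L" by (simp add: exp_add[symmetric])
  also have "\<dots> \<le> exp r * (1 + v)" using real(1) by (intro mult_left_mono) (auto simp: L(2))
  finally have "ennreal (exp (e \<bullet> x)) \<le> ennreal (exp r * (1 + v))" by (rule ennreal_leI)
  also have "\<dots> = ennreal (exp r) * (1 + tail_sum S r e n \<omega>)"
    using real by (simp add: ennreal_mult)
  finally show ?thesis .
next
  case top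
  then show ?thesis by (simp add: ennreal_mult_top)
qed

end

section \<open>The functional on the scaled hulls\<close>

locale gaussian_functional = gaussian_sample M T X N Xs
  for M :: "'w measure" and T :: "'t::metric_space set" and X :: "'t \<Rightarrow> 'w \<Rightarrow> real^'d"
    and N :: "'v measure" and Xs :: "nat \<Rightarrow> 't \<Rightarrow> 'v \<Rightarrow> real^'d" +
  fixes f :: "(real^'d) set \<Rightarrow> real" and p :: real
  assumes p_nonneg: "0 \<le> p" and f_cont: "hausdorff_continuous f"
    and f_nonneg: "\<And>A. A \<in> compact_convex_sets \<Longrightarrow> 0 \<le> f A"
    and f_mono: "\<And>A B. A \<in> compact_convex_sets \<Longrightarrow> B \<in> compact_convex_sets \<Longrightarrow> A \<subseteq> B \<Longrightarrow> f A \<le> f B"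
    and f_homogeneous: "\<And>c A. 0 \<le> c \<Longrightarrow> A \<in> compact_convex_sets \<Longrightarrow> f ((*\<^sub>R) c ` A) = power_conv c p * f A"
begin

lemma scaled_functional_eq: "scaled_functional f T Xs n \<omega> = f (scaled_hull n \<omega>)"
  by (simp add: scaled_functional_def scaled_hull_def)

text \<open>Homogeneity takes the scaling out of \<open>f\<close>, and on good paths
  \<open>f\<close> of the sample hull is a limit over hulls of finitely many random points. Taking
  \<open>h\<close> to be this \<open>lim\<close> everywhere, whatever its value where the limit
  fails to exist, makes \<open>h\<close> measurable on \<open>N\<close> itself.\<close>

lemma scaled_functional_AE_measurable:
  assumes S: "countable S" "S \<subseteq> T" "S \<noteq> {}"
  obtains h where "h \<in> borel_measurable N"
    "\<And>\<omega>. good_path S \<omega> \<Longrightarrow> n \<ge> 1 \<Longrightarrow> scaled_functional f T Xs n \<omega> = h \<omega>"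
proof -
  \<comment> \<open>The maximum with 1 makes \<open>D\<close> nonempty also for
    \<open>n = 0\<close>, so that it can be enumerated.\<close>
  define D where "D = {1..max 1 n} \<times> S"
  define e where "e = from_nat_into D"
  have D: "range e = D"
    unfolding e_def using S by (intro range_from_nat_into) (auto simp: D_def)
  have eD: "fst (e j) \<in> {1..max 1 n} \<and> snd (e j) \<in> S" for j
    using D unfolding D_def by (metis mem_Times_iff rangeI)
  define Z where "Z j \<omega> = Xs (fst (e j)) (snd (e j)) \<omega>" for j \<omega>
  have Z: "Z j \<in> borel_measurable N" for j
    unfolding Z_def using eD[of j] S(2) by (intro Xs_measurable) auto
  define h where "h \<omega> = power_conv (1 / gauss_scale n) p * lim (\<lambda>k. f (convex hull ((\<lambda>j. Z j \<omega>) ` {..k})))" for \<omega>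
  show thesis
  proof (rule that[of h])
    show "h \<in> borel_measurable N"
      unfolding h_def
      by (intro borel_measurable_times borel_measurable_const borel_measurable_lim_metric
          borel_measurable_hausdorff_continuous_hull f_cont Z)
    fix \<omega> assume good: "good_path S \<omega>" and n: "n \<ge> 1"
    have rng: "range (\<lambda>j. Z j \<omega>) = {Xs i t \<omega> | i t. i \<in> {1..n} \<and> t \<in> S}"
    proof -
      have "range (\<lambda>j. Z j \<omega>) = (\<lambda>d. Xs (fst d) (snd d) \<omega>) ` range e" by (simp add: Z_def image_image)
      also have "\<dots> = {Xs i t \<omega> | i t. i \<in> {1..n} \<and> t \<in> S}"
        unfolding D using n by (force simp: D_def max_def)
      finally show ?thesis .
    qed
    have "bounded (range (\<lambda>j. Z j \<omega>))"
      unfolding rng using sample_points_bounded[OF good, of n] by (rule bounded_subset) (use S(2) in auto)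
    from hausdorff_continuous_increasing_hulls[OF f_cont this]
    have "lim (\<lambda>k. f (convex hull ((\<lambda>j. Z j \<omega>) ` {..k}))) = f (sample_hull T Xs n \<omega>)"
      unfolding sample_hull_separant[OF S(2) good] rng[symmetric] by (rule limI)
    moreover have "f (scaled_hull n \<omega>) = power_conv (1 / gauss_scale n) p * f (sample_hull T Xs n \<omega>)"
      unfolding scaled_hull_def using n by (intro f_homogeneous sample_hull_compact_convex[OF good n]) auto
    ultimately show "scaled_functional f T Xs n \<omega> = h \<omega>" by (simp add: scaled_functional_eq h_def)
  qed
qed

text \<open>With \<open>x\<close> a point of \<open>A\<close> farthest from 0, \<open>A\<close> lies
  in the ball of radius \<open>norm x\<close>, so monotonicity and homogeneity bound
  \<open>f A\<close> by the power of \<open>norm x\<close> times the value at the unit ball. A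
  signed coordinate direction \<open>e\<close> that nearly carries the norm of \<open>x\<close> then
  makes the exponent linear in \<open>x\<close>.\<close>

lemma functional_square_bound:
  obtains C where "0 \<le> C" "\<And>A. A \<in> compact_convex_sets \<Longrightarrow> \<exists>x\<in>A. \<exists>e\<in>Basis \<union> uminus ` Basis. (f A)\<^sup>2 \<le> C * exp (e \<bullet> x)"
proof -
  obtain C where C: "0 \<le> C" "\<And>r. 0 \<le> r \<Longrightarrow> (power_conv r p)\<^sup>2 \<le> C * exp (r / real DIM(real^'d))"
    using power_conv_square_le_exp[OF p_nonneg, of "real DIM(real^'d)"] by auto
  define B where "B = f (cball 0 1)"
  have ball: "cball 0 1 \<in> (compact_convex_sets :: (real^'d) set set)" by (simp add: compact_convex_sets_def)
  show thesis
  proof (rule that[of "C * B\<^sup>2"])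
    show "0 \<le> C * B\<^sup>2" using C(1) by simp
    fix A :: "(real^'d) set" assume A: "A \<in> compact_convex_sets"
    then have "compact A" "A \<noteq> {}" by (auto simp: compact_convex_sets_def)
    then obtain x where x: "x \<in> A" "\<And>y. y \<in> A \<Longrightarrow> norm y \<le> norm x"
      using continuous_attains_sup[of A norm] continuous_on_norm_id by blast
    obtain e where e: "e \<in> Basis \<union> uminus ` Basis" "norm x \<le> DIM(real^'d) * (e \<bullet> x)"
      using norm_le_DIM_max_coordinate .
    have sc: "cball 0 (norm x) = (*\<^sub>R) (norm x) ` cball (0::real^'d) 1"
      by (cases "x = 0") (auto simp: cball_scale image_iff intro!: exI[of _ "0 :: real^'d"])
    have "f A \<le> f (cball 0 (norm x))"
      using A x(2) by (intro f_mono) (auto simp: compact_convex_sets_def)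
    also have "\<dots> = power_conv (norm x) p * B"
      unfolding sc B_def by (intro f_homogeneous ball) simp
    finally have "(f A)\<^sup>2 \<le> (power_conv (norm x) p * B)\<^sup>2" using f_nonneg[OF A] by (intro power_mono)
    also have "\<dots> = (power_conv (norm x) p)\<^sup>2 * B\<^sup>2" by (simp add: power_mult_distrib)
    also have "\<dots> \<le> C * exp (norm x / real DIM(real^'d)) * B\<^sup>2" by (intro mult_right_mono C(2)) auto
    also have "\<dots> \<le> C * exp (e \<bullet> x) * B\<^sup>2"
    proof (intro mult_right_mono mult_left_mono)
      have "norm x / real DIM(real^'d) \<le> e \<bullet> x" using e(2) by (simp add: divide_le_eq mult.commute)
      then show "exp (norm x / real DIM(real^'d)) \<le> exp (e \<bullet> x)" by simp
    qed (use C(1) in auto)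
    finally have "(f A)\<^sup>2 \<le> C * B\<^sup>2 * exp (e \<bullet> x)" by (simp add: mult_ac)
    with x(1) e(1) show "\<exists>x\<in>A. \<exists>e\<in>Basis \<union> uminus ` Basis. (f A)\<^sup>2 \<le> C * B\<^sup>2 * exp (e \<bullet> x)" by blast
  qed
qed

lemma second_moment_bound:
  assumes S: "countable S" "S \<subseteq> T" "S \<noteq> {}" and good: "AE \<omega> in N. good_path S \<omega>"
  obtains C where "0 \<le> C" "\<And>n. n \<ge> 2 \<Longrightarrow> (\<integral>\<^sup>+\<omega>. ennreal ((scaled_functional f T Xs n \<omega>)\<^sup>2) \<partial>N) \<le> ennreal C"
proof -
  let ?D = "Basis \<union> uminus ` Basis :: (real^'d) set"
  have D: "finite ?D" "\<And>e. e \<in> ?D \<Longrightarrow> norm e = 1" by auto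
  obtain C where C: "0 \<le> C" "\<And>A. A \<in> compact_convex_sets \<Longrightarrow> \<exists>x\<in>A. \<exists>e\<in>?D. (f A)\<^sup>2 \<le> C * exp (e \<bullet> x)"
    using functional_square_bound by blast
  obtain r where r: "\<And>e n. norm e = 1 \<Longrightarrow> n \<ge> 2 \<Longrightarrow> (\<integral>\<^sup>+\<omega>. tail_sum S r e n \<omega> \<partial>N) \<le> 1"
    using tail_sum_integral[OF S] by blast
  show thesis
  proof (rule that[of "C * exp r * (2 * real (card ?D))"])
    fix n :: nat assume n: "n \<ge> 2"
    have tm: "tail_sum S r e n \<in> borel_measurable N" for e
      unfolding tail_sum_def[abs_def]
      by (intro borel_measurable_times_ennreal borel_measurable_const borel_measurable_sum sup_measurable[OF S(1,2)]) simp
    have "(\<integral>\<^sup>+\<omega>. ennreal ((scaled_functional f T Xs n \<omega>)\<^sup>2) \<partial>N)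
        \<le> (\<integral>\<^sup>+\<omega>. ennreal (C * exp r) * (\<Sum>e\<in>?D. 1 + tail_sum S r e n \<omega>) \<partial>N)"
    proof (rule nn_integral_mono_AE)
      show "AE \<omega> in N. ennreal ((scaled_functional f T Xs n \<omega>)\<^sup>2) \<le> ennreal (C * exp r) * (\<Sum>e\<in>?D. 1 + tail_sum S r e n \<omega>)"
        using good
      proof eventually_elim
        case (elim \<omega>)
        have "scaled_hull n \<omega> \<in> compact_convex_sets" using elim n by (intro scaled_hull_compact_convex) auto
        from C(2)[OF this] obtain x e where x: "x \<in> scaled_hull n \<omega>" and e: "e \<in> ?D"
          and le: "(f (scaled_hull n \<omega>))\<^sup>2 \<le> C * exp (e \<bullet> x)" by blast
        have "ennreal ((scaled_functional f T Xs n \<omega>)\<^sup>2) \<le> ennreal (C * exp (e \<bullet> x))"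
          unfolding scaled_functional_eq using le by (rule ennreal_leI)
        also have "\<dots> = ennreal C * ennreal (exp (e \<bullet> x))" using C(1) by (simp add: ennreal_mult)
        also have "\<dots> \<le> ennreal C * (ennreal (exp r) * (1 + tail_sum S r e n \<omega>))"
          by (intro mult_left_mono scaled_hull_exp_bound[OF S(2) elim n x]) simp
        also have "\<dots> = ennreal (C * exp r) * (1 + tail_sum S r e n \<omega>)"
          using C(1) by (simp add: ennreal_mult mult.assoc)
        \<comment> \<open>The direction \<open>e\<close> depends on \<open>\<omega>\<close>; the sum
          over all signed coordinate directions removes this dependence.\<close>
        also have "\<dots> \<le> ennreal (C * exp r) * (\<Sum>e\<in>?D. 1 + tail_sum S r e n \<omega>)"
          using e D(1) by (intro mult_left_mono member_le_sum[where f = "\<lambda>e. 1 + tail_sum S r e n \<omega>"]) auto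
        finally show ?case .
      qed
    qed
    also have "\<dots> = ennreal (C * exp r) * (\<Sum>e\<in>?D. \<integral>\<^sup>+\<omega>. 1 + tail_sum S r e n \<omega> \<partial>N)"
    proof -
      have m1: "(\<lambda>\<omega>. 1 + tail_sum S r e n \<omega>) \<in> borel_measurable N" for e
        using tm by (intro borel_measurable_add borel_measurable_const)
      show ?thesis
        by (subst nn_integral_cmult[OF borel_measurable_sum[OF m1]], subst nn_integral_sum[OF m1]) (rule refl)
    qed
    also have "\<dots> \<le> ennreal (C * exp r) * (\<Sum>e\<in>?D. 2)"
    proof (intro mult_left_mono sum_mono)
      fix e assume e: "e \<in> ?D"
      have "(\<integral>\<^sup>+\<omega>. 1 + tail_sum S r e n \<omega> \<partial>N) = 1 + (\<integral>\<^sup>+\<omega>. tail_sum S r e n \<omega> \<partial>N)"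
        by (subst nn_integral_add) (auto simp: tm N.emeasure_space_1)
      also have "\<dots> \<le> 1 + 1" using r[OF D(2)[OF e] n] by (intro add_left_mono)
      finally show "(\<integral>\<^sup>+\<omega>. 1 + tail_sum S r e n \<omega> \<partial>N) \<le> 2" by simp
    qed simp
    also have "\<dots> = ennreal (C * exp r * (2 * real (card ?D)))"
    proof -
      have "(\<Sum>e\<in>?D. 2 :: ennreal) = ennreal (2 * real (card ?D))"
        by (simp add: ennreal_mult ennreal_of_nat_eq_real_of_nat mult.commute)
      then show ?thesis using C(1) by (simp add: ennreal_mult)
    qed
    finally show "(\<integral>\<^sup>+\<omega>. ennreal ((scaled_functional f T Xs n \<omega>)\<^sup>2) \<partial>N) \<le> ennreal (C * exp r * (2 * real (card ?D)))" .
  qed (use C(1) in simp)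
qed

lemma convergence_in_probability:
  assumes S: "countable S" "S \<subseteq> T" "S \<noteq> {}" and \<kappa>: "0 < \<kappa>"
  obtains B where "\<And>n. B n \<in> sets N" "(\<lambda>n. N.prob (B n)) \<longlonglongrightarrow> 0"
    "\<And>n \<omega>. n \<ge> 2 \<Longrightarrow> good_path S \<omega> \<Longrightarrow> \<omega> \<in> space N \<Longrightarrow> \<omega> \<notin> B n \<Longrightarrow> \<bar>f (scaled_hull n \<omega>) - f W\<bar> < \<kappa>"
proof -
  obtain \<delta> where \<delta>: "0 < \<delta>" "\<And>A. A \<in> compact_convex_sets \<Longrightarrow> hausdorff_dist W A < \<delta> \<Longrightarrow> \<bar>f A - f W\<bar> < \<kappa>"
    using f_cont limit_hull_compact_convex \<kappa> unfolding hausdorff_continuous_def by blast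
  obtain U \<epsilon> where U: "finite U" "U \<subseteq> sphere 0 1" "0 < \<epsilon>"
    and dist: "\<And>A. A \<in> compact_convex_sets \<Longrightarrow>
      (\<And>u x. u \<in> U \<Longrightarrow> x \<in> A \<Longrightarrow> u \<bullet> x \<le> support_fun W u + \<epsilon>) \<Longrightarrow>
      (\<And>u. u \<in> U \<Longrightarrow> \<exists>x\<in>A. support_fun W u - \<epsilon> \<le> u \<bullet> x) \<Longrightarrow> hausdorff_dist A W < \<delta>"
    using hausdorff_dist_finite_directions[OF limit_hull_compact_convex \<delta>(1)] by blast
  \<comment> \<open>For the lower bound a single index per direction suffices, one whose standard
    deviation comes within \<open>\<epsilon>\<close> of the supremum.\<close>
  have "\<exists>t\<in>T. support_fun W u - \<epsilon> < sd u t" for u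
  proof (rule ccontr)
    assume "\<not> ?thesis"
    then have "support_fun W u \<le> support_fun W u - \<epsilon>" by (intro support_limit_hull(2)) auto
    then show False using U(3) by simp
  qed
  then obtain \<tau> where \<tau>: "\<And>u. \<tau> u \<in> T" "\<And>u. support_fun W u - \<epsilon> < sd u (\<tau> u)" by metis
  \<comment> \<open>Off these events the points indexed by \<open>S\<close> control the hull from
    above, and one copy at the index \<open>\<tau> u\<close> controls it from below.\<close>
  define E where "E u n = {\<omega> \<in> space N. \<exists>i\<in>{1..n}. \<exists>t\<in>S. gauss_scale n * (support_fun W u + \<epsilon>) < u \<bullet> Xs i t \<omega>}" for u n
  define L where "L u n = {\<omega> \<in> space N. \<forall>i\<in>{1..n}. u \<bullet> Xs i (\<tau> u) \<omega> < gauss_scale n * (support_fun W u - \<epsilon>)}" for u n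
  have E: "E u n \<in> sets N" and L: "L u n \<in> sets N" for u n
    unfolding E_def L_def by (rule exceed_sets(1)[OF S(1,2)], rule below_sets[OF \<tau>(1)])
  have lim: "(\<lambda>n. N.prob (E u n \<union> L u n)) \<longlonglongrightarrow> 0" if u: "u \<in> U" for u
  proof -
    have 1: "(\<lambda>n. N.prob (E u n)) \<longlonglongrightarrow> 0"
      unfolding E_def using u U by (intro upper_limit[OF S]) auto
    have 2: "(\<lambda>n. N.prob (L u n)) \<longlonglongrightarrow> 0"
      unfolding L_def by (rule lower_limit[OF \<tau>])
    have sum: "(\<lambda>n. N.prob (E u n) + N.prob (L u n)) \<longlonglongrightarrow> 0" using tendsto_add[OF 1 2] by simp
    show ?thesis
      by (rule tendsto_sandwich[OF _ _ tendsto_const sum]; rule always_eventually;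
          intro allI measure_nonneg measure_Un_le E L)
  qed
  show thesis
  proof (rule that[of "\<lambda>n. \<Union>u\<in>U. E u n \<union> L u n"])
    show "(\<Union>u\<in>U. E u n \<union> L u n) \<in> sets N" for n using U(1) E L by (intro sets.finite_UN sets.Un)
    show "(\<lambda>n. N.prob (\<Union>u\<in>U. E u n \<union> L u n)) \<longlonglongrightarrow> 0"
      by (rule tendsto_prob_finite_UN[OF N.prob_space_axioms U(1)]) (auto intro: E L lim)
    fix n \<omega> assume n: "n \<ge> (2::nat)" and good: "good_path S \<omega>" and sp: "\<omega> \<in> space N"
      and B: "\<omega> \<notin> (\<Union>u\<in>U. E u n \<union> L u n)"
    have b: "0 < gauss_scale n" using gauss_scale_ge_1[OF n] by linarith
    have A: "scaled_hull n \<omega> \<in> compact_convex_sets" using n by (intro scaled_hull_compact_convex[OF good]) simp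
    have "hausdorff_dist (scaled_hull n \<omega>) W < \<delta>"
    proof (rule dist[OF A])
      fix u x assume u: "u \<in> U" and x: "x \<in> scaled_hull n \<omega>"
      show "u \<bullet> x \<le> support_fun W u + \<epsilon>"
      proof (rule scaled_hull_upper[OF S(2) good n _ x])
        fix i t assume "i \<in> {1..n}" "t \<in> S"
        then show "u \<bullet> Xs i t \<omega> \<le> gauss_scale n * (support_fun W u + \<epsilon>)"
          using B u sp unfolding E_def by (auto simp: not_less)
      qed
    next
      fix u assume u: "u \<in> U"
      then obtain i where i: "i \<in> {1..n}" "gauss_scale n * (support_fun W u - \<epsilon>) \<le> u \<bullet> Xs i (\<tau> u) \<omega>"
        using B sp unfolding L_def by (auto simp: not_less)
      have "support_fun W u - \<epsilon> \<le> u \<bullet> ((1 / gauss_scale n) *\<^sub>R Xs i (\<tau> u) \<omega>)"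
        using i(2) b by (simp add: field_simps)
      with scaled_hull_mem[OF i(1) \<tau>(1)] show "\<exists>x\<in>scaled_hull n \<omega>. support_fun W u - \<epsilon> \<le> u \<bullet> x" by (rule bexI[rotated])
    qed
    then show "\<bar>f (scaled_hull n \<omega>) - f W\<bar> < \<kappa>" by (intro \<delta>(2)[OF A]) (simp add: hausdorff_dist_commute)
  qed
qed

text \<open>On good paths the functional agrees with a function \<open>h n\<close> that is
  measurable on \<open>N\<close>. The second moments and the convergence in probability are moved to
  \<open>h n\<close>, the limit is taken there, and the completion carries it back to the functional
  itself.\<close>

theorem expectation_convergence:
  "n \<ge> 2 \<Longrightarrow> integrable (completion N) (scaled_functional f T Xs n)"
  "(\<lambda>n. \<integral>\<omega>. scaled_functional f T Xs n \<omega> \<partial>completion N) \<longlonglongrightarrow> f W"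
proof -
  obtain S where S: "countable S" "S \<subseteq> T" "S \<noteq> {}" and good: "AE \<omega> in N. good_path S \<omega>"
    using exists_separant unfolding good_path_def by blast
  have "\<exists>h. h \<in> borel_measurable N \<and> (\<forall>\<omega>. good_path S \<omega> \<longrightarrow> n \<ge> 1 \<longrightarrow> scaled_functional f T Xs n \<omega> = h \<omega>)" for n
    using scaled_functional_AE_measurable[OF S, of n] by blast
  then obtain h where hm: "\<And>n. h n \<in> borel_measurable N"
    and h: "\<And>n \<omega>. good_path S \<omega> \<Longrightarrow> n \<ge> 1 \<Longrightarrow> scaled_functional f T Xs n \<omega> = h n \<omega>" by metis
  have ae: "AE \<omega> in N. scaled_functional f T Xs n \<omega> = h n \<omega>" if "n \<ge> 2" for n
    using good by eventually_elim (use h that in auto)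
  obtain C where C: "0 \<le> C" "\<And>n. n \<ge> 2 \<Longrightarrow> (\<integral>\<^sup>+\<omega>. ennreal ((scaled_functional f T Xs n \<omega>)\<^sup>2) \<partial>N) \<le> ennreal C"
    using second_moment_bound[OF S good] by blast
  have sq: "(\<integral>\<^sup>+\<omega>. ennreal ((h n \<omega>)\<^sup>2) \<partial>N) \<le> ennreal C" if n: "n \<ge> 2" for n
  proof -
    have "(\<integral>\<^sup>+\<omega>. ennreal ((h n \<omega>)\<^sup>2) \<partial>N) = (\<integral>\<^sup>+\<omega>. ennreal ((scaled_functional f T Xs n \<omega>)\<^sup>2) \<partial>N)"
    proof (rule nn_integral_cong_AE)
      show "AE \<omega> in N. ennreal ((h n \<omega>)\<^sup>2) = ennreal ((scaled_functional f T Xs n \<omega>)\<^sup>2)"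
        using ae[OF n] by eventually_elim simp
    qed
    then show ?thesis using C(2)[OF n] by simp
  qed
  have conv: "\<exists>B. (\<forall>n. B n \<in> sets N) \<and> (\<lambda>n. N.prob (B n)) \<longlonglongrightarrow> 0 \<and>
      (\<forall>n\<ge>2. AE \<omega> in N. \<omega> \<notin> B n \<longrightarrow> \<bar>h n \<omega> - f W\<bar> < \<kappa>)" if \<kappa>: "0 < \<kappa>" for \<kappa>
  proof -
    obtain B where B: "\<And>n. B n \<in> sets N" "(\<lambda>n. N.prob (B n)) \<longlonglongrightarrow> 0"
      "\<And>n \<omega>. n \<ge> 2 \<Longrightarrow> good_path S \<omega> \<Longrightarrow> \<omega> \<in> space N \<Longrightarrow> \<omega> \<notin> B n \<Longrightarrow> \<bar>f (scaled_hull n \<omega>) - f W\<bar> < \<kappa>"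
      using convergence_in_probability[OF S \<kappa>] by blast
    have "AE \<omega> in N. \<omega> \<notin> B n \<longrightarrow> \<bar>h n \<omega> - f W\<bar> < \<kappa>" if n: "n \<ge> 2" for n
      using good AE_space
    proof eventually_elim
      case (elim \<omega>)
      have "h n \<omega> = f (scaled_hull n \<omega>)" using h[OF elim(1), of n] n by (simp add: scaled_functional_eq)
      then show ?case using B(3)[OF n elim] by simp
    qed
    with B(1,2) show ?thesis by blast
  qed
  have int: "integrable N (h n)" if "n \<ge> 2" for n
    by (rule integral_tendsto_of_second_moments(1)[OF N.prob_space_axioms hm sq C(1) conv that])
  have lim: "(\<lambda>n. \<integral>\<omega>. h n \<omega> \<partial>N) \<longlonglongrightarrow> f W"
    by (rule integral_tendsto_of_second_moments(2)[OF N.prob_space_axioms hm sq C(1) conv])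
  show "integrable (completion N) (scaled_functional f T Xs n)" if n: "n \<ge> 2"
    by (rule integral_completion_AE(1)[OF int[OF n] ae[OF n]])
  show "(\<lambda>n. \<integral>\<omega>. scaled_functional f T Xs n \<omega> \<partial>completion N) \<longlonglongrightarrow> f W"
  proof (rule Lim_transform_eventually[OF lim], rule eventually_sequentiallyI[of 2])
    fix n :: nat assume n: "n \<ge> 2"
    show "(\<integral>\<omega>. h n \<omega> \<partial>N) = (\<integral>\<omega>. scaled_functional f T Xs n \<omega> \<partial>completion N)"
      by (rule integral_completion_AE(2)[OF int[OF n] ae[OF n], symmetric])
  qed
qed

end

theorem theorem2:
  fixes T :: "'t::metric_space set"
    and M :: "'w measure" and X :: "'t \<Rightarrow> 'w \<Rightarrow> real^'d"
    and N :: "'v measure" and Xs :: "nat \<Rightarrow> 't \<Rightarrow> 'v \<Rightarrow> real^'d"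
    and p :: real and f :: "(real^'d) set \<Rightarrow> real"
  assumes "T \<noteq> {}" and "separable_space (top_of_set T)"
    and "prob_space M"
    and "centered_gaussian_process M T X"
    and "separable_process M T X" and "bounded_process M T X"
    and "prob_space N"
    and "iid_copies N Xs M T X"
    and "\<And>i. i \<ge> 1 \<Longrightarrow> separable_process N T (Xs i)"
    and "\<And>i. i \<ge> 1 \<Longrightarrow> bounded_process N T (Xs i)"
    and "p \<ge> 0"
    and "hausdorff_continuous f"
    and "\<And>A. A \<in> compact_convex_sets \<Longrightarrow> f A \<ge> 0"
    and "\<And>A1 A2. A1 \<in> compact_convex_sets \<Longrightarrow> A2 \<in> compact_convex_sets \<Longrightarrow> A1 \<subseteq> A2
           \<Longrightarrow> f A1 \<le> f A2"
    and "\<And>c A. c \<ge> 0 \<Longrightarrow> A \<in> compact_convex_sets \<Longrightarrow> f ((*\<^sub>R) c ` A) = power_conv c p * f A"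
  shows "(\<forall>n\<ge>2. integrable (completion N) (scaled_functional f T Xs n)) \<and>
         (\<lambda>n. \<integral>\<omega>. scaled_functional f T Xs n \<omega> \<partial>completion N) \<longlonglongrightarrow> f (limit_hull M T X)"
proof -
  interpret gaussian_functional M T X N Xs f p
    by (intro gaussian_functional.intro gaussian_sample.intro bounded_gaussian_process.intro
        bounded_gaussian_process_axioms.intro gaussian_sample_axioms.intro
        gaussian_functional_axioms.intro) (fact assms)+
  show ?thesis using expectation_convergence by blast
qed

end
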